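(* Over primitive recursive set theory extended by the axiom of dependent choice, the following two axiom schemas are equivalent (each schema proves every instance of the other): (1) Reflection for first order formulas with real parameters: for every formula $\psi(x)$ of first order set theory with a single free variable $x$ and no parameters, $$\forall_{r\subseteq\omega}\big(\psi(r)\to\exists_N(\text{$N$ is a transitive set}\land\psi(r)^N)\big).$$ (2) Induction over $\Delta(\mathbb R)$-definable well-founded classes: for every $\Sigma$-formula $\theta_\Sigma(x,y,r)$, every $\Pi$-formula $\theta_\Pi(x,y,r)$ and every formula $\varphi(x,\vec z)$ of set theory, $$\forall_{r\subseteq\omega}\big(\operatorname{\Delta\text{-}Rel}[X^r]\land\operatorname{WF}[X^r]\to\operatorname{Ind}[X^r,\varphi]\big).$$
   Context: Primitive recursive set theory (with infinity) consists of extensionality, regularity and infinity, together with axioms stating that the primitive recursive set functions of Jensen and Karp (where $\omega$ is admitted as a parameter) are total and satisfy their defining equations. $\psi(r)^N$ denotes the relativization of $\psi(r)$ to $N$ (all quantifiers bounded to $N$). Formulas are in negation normal form. A quantifier is bounded if it has the form $\forall_{x\in y}$ or $\exists_{x\in y}$ with $y$ a set variable or parameter; a $\Sigma$-formula (resp. $\Pi$-formula) is a negation-normal-form formula in which all universal (resp. existential) quantifiers are bounded. Given $\theta_\Sigma,\theta_\Pi$ and $r$, write $x\leq_X^r y:\equiv\theta_\Sigma(x,y,r)$, $x\in X^r:\equiv x\leq^r_X x$, and $x<^r_X y:\equiv x\leq^r_X y\land x\neq y$. Then $\operatorname{\Delta\text{-}Rel}[X^r]:\equiv\forall_{x,y}(x\leq_X^r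 y\to x\in X^r\land y\in X^r)\land\forall_{x,y}(\theta_\Sigma(x,y,r)\leftrightarrow\theta_\Pi(x,y,r))$; $\operatorname{WF}[X^r]:\equiv\forall_w(w\neq\emptyset\to\exists_{x\in w}\forall_{y\in w}\neg\,y<^r_X x)$ (with $w$ ranging over sets); $\operatorname{Ind}[X^r,\varphi]:\equiv\forall_{\vec z}\big(\forall_{x\in X^r}(\forall_{y<^r_X x}\varphi(y,\vec z)\to\varphi(x,\vec z))\to\forall_{x\in X^r}\varphi(x,\vec z)\big)$, with no restriction on the parameters $\vec z$. The class $X^r$ need not be set-like. *)

theory Defs
  imports Main
begin

section \<open>Function symbols\<close>

text \<open>
  Descriptions of the primitive recursive set functions, with \<open>\<omega>\<close> as a parameter:
    \<^item> \<open>Zero\<close>: the constant \<open>\<emptyset>\<close>;  \<open>Omega\<close>: the constant \<open>\<omega>\<close>;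
    \<^item> \<open>Proj n i\<close>: \<open>(x\<^sub>0,\<dots>,x\<^sub>n\<^sub>-\<^sub>1) \<mapsto> x\<^sub>i\<close>;
    \<^item> \<open>Adj\<close>: \<open>(x,y) \<mapsto> x \<union> {y}\<close>;
    \<^item> \<open>Cond\<close>: \<open>(x,y,u,v) \<mapsto> x\<close> if \<open>u \<in> v\<close>, and \<open>y\<close> otherwise;
    \<^item> \<open>Comp n g hs\<close>: \<open>n\<close>-ary composition \<open>x \<mapsto> g (h\<^sub>1 x, \<dots>, h\<^sub>m x)\<close>;
    \<^item> \<open>Rec g\<close>: the function with \<open>F (z, x) = g (\<Union>{F (u, x) | u \<in> z}, z, x)\<close>.
\<close>

datatype psf =
    Zero
  | Omega
  | Proj nat nat
  | Adj
  | Cond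
  | Comp nat psf "psf list"
  | Rec psf

primrec arity :: "psf \<Rightarrow> nat" where
  "arity Zero = 0"
| "arity Omega = 0"
| "arity (Proj n i) = n"
| "arity Adj = 2"
| "arity Cond = 4"
| "arity (Comp n g hs) = n"
| "arity (Rec g) = arity g - 1"

primrec wf_psf :: "psf \<Rightarrow> bool" where
  "wf_psf Zero \<longleftrightarrow> True"
| "wf_psf Omega \<longleftrightarrow> True"
| "wf_psf (Proj n i) \<longleftrightarrow> i < n"
| "wf_psf Adj \<longleftrightarrow> True"
| "wf_psf Cond \<longleftrightarrow> True"
| "wf_psf (Comp n g hs) \<longleftrightarrow>
     wf_psf g \<and> length hs = arity g \<and> list_all wf_psf hs \<and> list_all (\<lambda>h. arity h = n) hs"
| "wf_psf (Rec g) \<longleftrightarrow> wf_psf g \<and> 2 \<le> arity g"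


section \<open>Terms and formulas in negation normal form\<close>

text \<open>Variables are de Bruijn indices: \<open>Var 0\<close> refers to the innermost quantifier.\<close>

datatype trm = Var nat | Fn psf "trm list"

datatype fm =
    Mem trm trm
  | NMem trm trm
  | Eq trm trm
  | NEq trm trm
  | And fm fm
  | Or fm fm
  | All fm
  | Ex fm

primrec wf_trm :: "trm \<Rightarrow> bool" where
  "wf_trm (Var i) \<longleftrightarrow> True"
| "wf_trm (Fn f ts) \<longleftrightarrow> wf_psf f \<and> length ts = arity f \<and> list_all wf_trm ts"

primrec wf_fm :: "fm \<Rightarrow> bool" where
  "wf_fm (Mem s t) \<longleftrightarrow> wf_trm s \<and> wf_trm t"
| "wf_fm (NMem s t) \<longleftrightarrow> wf_trm s \<and> wf_trm t"
| "wf_fm (Eq s t) \<longleftrightarrow> wf_trm s \<and> wf_trm t"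
| "wf_fm (NEq s t) \<longleftrightarrow> wf_trm s \<and> wf_trm t"
| "wf_fm (And \<phi> \<psi>) \<longleftrightarrow> wf_fm \<phi> \<and> wf_fm \<psi>"
| "wf_fm (Or \<phi> \<psi>) \<longleftrightarrow> wf_fm \<phi> \<and> wf_fm \<psi>"
| "wf_fm (All \<phi>) \<longleftrightarrow> wf_fm \<phi>"
| "wf_fm (Ex \<phi>) \<longleftrightarrow> wf_fm \<phi>"

primrec fv_trm :: "trm \<Rightarrow> nat set" where
  "fv_trm (Var i) = {i}"
| "fv_trm (Fn f ts) = \<Union> (set (map fv_trm ts))"

primrec fv :: "fm \<Rightarrow> nat set" where
  "fv (Mem s t) = fv_trm s \<union> fv_trm t"
| "fv (NMem s t) = fv_trm s \<union> fv_trm t"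
| "fv (Eq s t) = fv_trm s \<union> fv_trm t"
| "fv (NEq s t) = fv_trm s \<union> fv_trm t"
| "fv (And \<phi> \<psi>) = fv \<phi> \<union> fv \<psi>"
| "fv (Or \<phi> \<psi>) = fv \<phi> \<union> fv \<psi>"
| "fv (All \<phi>) = {i. Suc i \<in> fv \<phi>}"
| "fv (Ex \<phi>) = {i. Suc i \<in> fv \<phi>}"

text \<open>Formulas of first order set theory, i.e. without primitive recursive function symbols.\<close>

primrec is_Var :: "trm \<Rightarrow> bool" where
  "is_Var (Var i) \<longleftrightarrow> True"
| "is_Var (Fn f ts) \<longleftrightarrow> False"

primrec set_fm :: "fm \<Rightarrow> bool" where
  "set_fm (Mem s t) \<longleftrightarrow> is_Var s \<and> is_Var t"
| "set_fm (NMem s t) \<longleftrightarrow> is_Var s \<and> is_Var t"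
| "set_fm (Eq s t) \<longleftrightarrow> is_Var s \<and> is_Var t"
| "set_fm (NEq s t) \<longleftrightarrow> is_Var s \<and> is_Var t"
| "set_fm (And \<phi> \<psi>) \<longleftrightarrow> set_fm \<phi> \<and> set_fm \<psi>"
| "set_fm (Or \<phi> \<psi>) \<longleftrightarrow> set_fm \<phi> \<and> set_fm \<psi>"
| "set_fm (All \<phi>) \<longleftrightarrow> set_fm \<phi>"
| "set_fm (Ex \<phi>) \<longleftrightarrow> set_fm \<phi>"

primrec sb_trm :: "(nat \<Rightarrow> trm) \<Rightarrow> trm \<Rightarrow> trm" where
  "sb_trm \<sigma> (Var i) = \<sigma> i"
| "sb_trm \<sigma> (Fn f ts) = Fn f (map (sb_trm \<sigma>) ts)"

definition lift_trm :: "trm \<Rightarrow> trm" where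
  "lift_trm = sb_trm (\<lambda>i. Var (Suc i))"

definition up :: "(nat \<Rightarrow> trm) \<Rightarrow> nat \<Rightarrow> trm" where
  "up \<sigma> i = (case i of 0 \<Rightarrow> Var 0 | Suc j \<Rightarrow> lift_trm (\<sigma> j))"

primrec sb :: "(nat \<Rightarrow> trm) \<Rightarrow> fm \<Rightarrow> fm" where
  "sb \<sigma> (Mem s t) = Mem (sb_trm \<sigma> s) (sb_trm \<sigma> t)"
| "sb \<sigma> (NMem s t) = NMem (sb_trm \<sigma> s) (sb_trm \<sigma> t)"
| "sb \<sigma> (Eq s t) = Eq (sb_trm \<sigma> s) (sb_trm \<sigma> t)"
| "sb \<sigma> (NEq s t) = NEq (sb_trm \<sigma> s) (sb_trm \<sigma> t)"
| "sb \<sigma> (And \<phi> \<psi>) = And (sb \<sigma> \<phi>) (sb \<sigma> \<psi>)"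
| "sb \<sigma> (Or \<phi> \<psi>) = Or (sb \<sigma> \<phi>) (sb \<sigma> \<psi>)"
| "sb \<sigma> (All \<phi>) = All (sb (up \<sigma>) \<phi>)"
| "sb \<sigma> (Ex \<phi>) = Ex (sb (up \<sigma>) \<phi>)"

definition lift :: "fm \<Rightarrow> fm" where
  "lift = sb (\<lambda>i. Var (Suc i))"

text \<open>
  \<open>inst \<phi> [t\<^sub>0,\<dots>,t\<^sub>n\<^sub>-\<^sub>1]\<close> is \<open>\<phi>(t\<^sub>0,\<dots>,t\<^sub>n\<^sub>-\<^sub>1)\<close>, with \<open>t\<^sub>i\<close> in place of the free variable
  \<open>Var i\<close>. The remaining free variables move down by \<open>n\<close>.
\<close>

definition inst :: "fm \<Rightarrow> trm list \<Rightarrow> fm" where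
  "inst \<phi> ts = sb (\<lambda>i. if i < length ts then ts ! i else Var (i - length ts)) \<phi>"

primrec neg :: "fm \<Rightarrow> fm" where
  "neg (Mem s t) = NMem s t"
| "neg (NMem s t) = Mem s t"
| "neg (Eq s t) = NEq s t"
| "neg (NEq s t) = Eq s t"
| "neg (And \<phi> \<psi>) = Or (neg \<phi>) (neg \<psi>)"
| "neg (Or \<phi> \<psi>) = And (neg \<phi>) (neg \<psi>)"
| "neg (All \<phi>) = Ex (neg \<phi>)"
| "neg (Ex \<phi>) = All (neg \<phi>)"

definition Imp :: "fm \<Rightarrow> fm \<Rightarrow> fm" where
  "Imp \<phi> \<psi> = Or (neg \<phi>) \<psi>"

definition Iff :: "fm \<Rightarrow> fm \<Rightarrow> fm" where
  "Iff \<phi> \<psi> = And (Imp \<phi> \<psi>) (Imp \<psi> \<phi>)"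

definition Alls :: "nat \<Rightarrow> fm \<Rightarrow> fm" where
  "Alls n \<phi> = (All ^^ n) \<phi>"

text \<open>The bound \<open>t\<close> of a bounded quantifier lives outside the scope of that quantifier.\<close>

definition BAll :: "trm \<Rightarrow> fm \<Rightarrow> fm" where
  "BAll t \<phi> = All (Or (NMem (Var 0) (lift_trm t)) \<phi>)"

definition BEx :: "trm \<Rightarrow> fm \<Rightarrow> fm" where
  "BEx t \<phi> = Ex (And (Mem (Var 0) (lift_trm t)) \<phi>)"

inductive sigma_fm :: "fm \<Rightarrow> bool" where
  "sigma_fm (Mem (Var i) (Var j))"
| "sigma_fm (NMem (Var i) (Var j))"
| "sigma_fm (Eq (Var i) (Var j))"
| "sigma_fm (NEq (Var i) (Var j))"
| "sigma_fm \<phi> \<Longrightarrow> sigma_fm \<psi> \<Longrightarrow> sigma_fm (And \<phi> \<psi>)"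
| "sigma_fm \<phi> \<Longrightarrow> sigma_fm \<psi> \<Longrightarrow> sigma_fm (Or \<phi> \<psi>)"
| "sigma_fm \<phi> \<Longrightarrow> sigma_fm (BAll (Var i) \<phi>)"
| "sigma_fm \<phi> \<Longrightarrow> sigma_fm (Ex \<phi>)"

inductive pi_fm :: "fm \<Rightarrow> bool" where
  "pi_fm (Mem (Var i) (Var j))"
| "pi_fm (NMem (Var i) (Var j))"
| "pi_fm (Eq (Var i) (Var j))"
| "pi_fm (NEq (Var i) (Var j))"
| "pi_fm \<phi> \<Longrightarrow> pi_fm \<psi> \<Longrightarrow> pi_fm (And \<phi> \<psi>)"
| "pi_fm \<phi> \<Longrightarrow> pi_fm \<psi> \<Longrightarrow> pi_fm (Or \<phi> \<psi>)"
| "pi_fm \<phi> \<Longrightarrow> pi_fm (All \<phi>)"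
| "pi_fm \<phi> \<Longrightarrow> pi_fm (BEx (Var i) \<phi>)"

text \<open>Relativization of all quantifiers to (the value of) a term.\<close>

primrec rel :: "trm \<Rightarrow> fm \<Rightarrow> fm" where
  "rel N (Mem s t) = Mem s t"
| "rel N (NMem s t) = NMem s t"
| "rel N (Eq s t) = Eq s t"
| "rel N (NEq s t) = NEq s t"
| "rel N (And \<phi> \<psi>) = And (rel N \<phi>) (rel N \<psi>)"
| "rel N (Or \<phi> \<psi>) = Or (rel N \<phi>) (rel N \<psi>)"
| "rel N (All \<phi>) = BAll N (rel (lift_trm N) \<phi>)"
| "rel N (Ex \<phi>) = BEx N (rel (lift_trm N) \<phi>)"


section \<open>Provability\<close>

text \<open>
  A one-sided sequent calculus for classical first order logic with equality. Sequents are read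
  disjunctively, and the members of \<open>T\<close> (sentences in all applications) serve as axioms.
\<close>

inductive derivable :: "fm set \<Rightarrow> fm list \<Rightarrow> bool" for T :: "fm set" where
  Ax: "\<phi> \<in> T \<Longrightarrow> derivable T [\<phi>]"
| Id: "wf_fm \<phi> \<Longrightarrow> derivable T [\<phi>, neg \<phi>]"
| Refl: "wf_trm t \<Longrightarrow> derivable T [Eq t t]"
| Repl: "wf_trm s \<Longrightarrow> wf_trm t \<Longrightarrow> wf_fm \<phi> \<Longrightarrow>
    derivable T [NEq s t, neg (inst \<phi> [s]), inst \<phi> [t]]"
| AndI: "derivable T (\<phi> # \<Gamma>) \<Longrightarrow> derivable T (\<psi> # \<Gamma>) \<Longrightarrow> derivable T (And \<phi> \<psi> # \<Gamma>)"
| OrI: "derivable T (\<phi> # \<psi> # \<Gamma>) \<Longrightarrow> derivable T (Or \<phi> \<psi> # \<Gamma>)"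
| AllI: "derivable T (\<phi> # map lift \<Gamma>) \<Longrightarrow> derivable T (All \<phi> # \<Gamma>)"
| ExI: "wf_trm t \<Longrightarrow> derivable T (inst \<phi> [t] # \<Gamma>) \<Longrightarrow> derivable T (Ex \<phi> # \<Gamma>)"
| Cut: "derivable T (\<phi> # \<Gamma>) \<Longrightarrow> derivable T (neg \<phi> # \<Gamma>) \<Longrightarrow> derivable T \<Gamma>"
| Weak: "derivable T \<Gamma> \<Longrightarrow> set \<Gamma> \<subseteq> set \<Delta> \<Longrightarrow> list_all wf_fm \<Delta> \<Longrightarrow> derivable T \<Delta>"

definition proves :: "fm set \<Rightarrow> fm \<Rightarrow> bool" (infix "\<turnstile>" 50) where
  "T \<turnstile> \<phi> \<longleftrightarrow> derivable T [\<phi>]"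


section \<open>Primitive recursive set theory with infinity\<close>

abbreviation zero :: trm where "zero \<equiv> Fn Zero []"

abbreviation omega :: trm where "omega \<equiv> Fn Omega []"

abbreviation adj :: "trm \<Rightarrow> trm \<Rightarrow> trm" where "adj s t \<equiv> Fn Adj [s, t]"

abbreviation succ :: "trm \<Rightarrow> trm" where "succ t \<equiv> adj t t"

abbreviation upair :: "trm \<Rightarrow> trm \<Rightarrow> trm" where "upair s t \<equiv> adj (adj zero s) t"

text \<open>Kuratowski pairs.\<close>

abbreviation pair :: "trm \<Rightarrow> trm \<Rightarrow> trm" where "pair s t \<equiv> upair (upair s s) (upair s t)"

definition Subset :: "trm \<Rightarrow> trm \<Rightarrow> fm" where
  "Subset s t = BAll s (Mem (Var 0) (lift_trm t))"

definition Transitive :: "trm \<Rightarrow> fm" where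
  "Transitive t = BAll t (Subset (Var 0) (lift_trm t))"

definition Inductive :: "trm \<Rightarrow> fm" where
  "Inductive t = And (Mem zero t) (BAll t (Mem (succ (Var 0)) (lift_trm t)))"

definition extensionality :: fm where
  "extensionality =
     All (All (Imp (All (Iff (Mem (Var 0) (Var 2)) (Mem (Var 0) (Var 1)))) (Eq (Var 1) (Var 0))))"

definition regularity :: fm where
  "regularity =
     All (Imp (NEq (Var 0) zero) (BEx (Var 0) (BAll (Var 1) (NMem (Var 0) (Var 1)))))"

definition infinity :: fm where
  "infinity = Ex (Inductive (Var 0))"

text \<open>
  Universal closures of the defining equations. Totality is built into the use of function symbols,
  except that in the case of \<open>F = Rec g\<close> the existence of \<open>w = \<Union>{F (u, x) | u \<in> z}\<close> has to be
  asserted.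
\<close>

primrec defining_axiom :: "psf \<Rightarrow> fm" where
  "defining_axiom Zero = All (NMem (Var 0) zero)"
| "defining_axiom Omega =
     And (Inductive omega) (All (Imp (Inductive (Var 0)) (Subset omega (Var 0))))"
| "defining_axiom (Proj n i) = Alls n (Eq (Fn (Proj n i) (map Var [0..<n])) (Var i))"
| "defining_axiom Adj =
     Alls 3 (Iff (Mem (Var 2) (adj (Var 0) (Var 1))) (Or (Mem (Var 2) (Var 0)) (Eq (Var 2) (Var 1))))"
| "defining_axiom Cond =
     Alls 4 (And
       (Imp (Mem (Var 2) (Var 3)) (Eq (Fn Cond [Var 0, Var 1, Var 2, Var 3]) (Var 0)))
       (Imp (NMem (Var 2) (Var 3)) (Eq (Fn Cond [Var 0, Var 1, Var 2, Var 3]) (Var 1))))"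
| "defining_axiom (Comp n g hs) =
     Alls n (Eq (Fn (Comp n g hs) (map Var [0..<n])) (Fn g (map (\<lambda>h. Fn h (map Var [0..<n])) hs)))"
| "defining_axiom (Rec g) =
     (let F = Rec g; n = arity F in
      Alls n (Ex (And
        (All (Iff (Mem (Var 0) (Var 1))
                  (BEx (Var 2) (Mem (Var 1) (Fn F (Var 0 # map Var [4..<n + 3]))))))
        (Eq (Fn F (map Var [1..<n + 1])) (Fn g (map Var [0..<n + 1]))))))"

definition PRS :: "fm set" where
  "PRS = {extensionality, regularity, infinity} \<union> {defining_axiom f | f. wf_psf f}"

text \<open>\<open>f\<close> is a function from \<open>D\<close> to \<open>A\<close>.\<close>

definition Function_to :: "trm \<Rightarrow> trm \<Rightarrow> trm \<Rightarrow> fm" where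
  "Function_to f D A =
     (let up1 = lift_trm; up2 = lift_trm \<circ> lift_trm; up3 = lift_trm \<circ> lift_trm \<circ> lift_trm in
      And (BAll f (BEx (up1 D) (BEx (up2 A) (Eq (Var 2) (pair (Var 1) (Var 0))))))
     (And (BAll D (BEx (up1 A) (Mem (pair (Var 1) (Var 0)) (up2 f))))
          (BAll D (BAll (up1 A) (BAll (up2 A)
            (Imp (And (Mem (pair (Var 2) (Var 1)) (up3 f)) (Mem (pair (Var 2) (Var 0)) (up3 f)))
                 (Eq (Var 1) (Var 0))))))))"

text \<open>
  For \<open>A \<noteq> \<emptyset>\<close> (\<open>Var 1\<close>) and \<open>R\<close> (\<open>Var 0\<close>) such that \<open>\<forall>x\<in>A. \<exists>y\<in>A. (x,y) \<in> R\<close>, there is a function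
  \<open>f : \<omega> \<rightarrow> A\<close> with \<open>(f n, f (n+1)) \<in> R\<close> for all \<open>n \<in> \<omega>\<close>.
\<close>

definition dependent_choice :: fm where
  "dependent_choice =
     All (All (Imp
       (And (NEq (Var 1) zero)
            (BAll (Var 1) (BEx (Var 2) (Mem (pair (Var 1) (Var 0)) (Var 2)))))
       (Ex (And (Function_to (Var 0) omega (Var 2))
                (BAll omega (BAll (Var 3) (BAll (Var 4)
                  (Imp (And (Mem (pair (Var 2) (Var 1)) (Var 3))
                            (Mem (pair (succ (Var 2)) (Var 0)) (Var 3)))
                       (Mem (pair (Var 1) (Var 0)) (Var 4))))))))))"

definition PRS_DC :: "fm set" where
  "PRS_DC = insert dependent_choice PRS"


section \<open>Reflection\<close>

definition reflection :: "fm \<Rightarrow> fm" where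
  "reflection \<psi> =
     All (Imp (Subset (Var 0) omega)
       (Imp (inst \<psi> [Var 0])
            (Ex (And (Transitive (Var 0)) (rel (Var 0) (inst \<psi> [Var 1]))))))"

definition Reflection :: "fm set" where
  "Reflection = {reflection \<psi> | \<psi>. set_fm \<psi> \<and> fv \<psi> \<subseteq> {0}}"


section \<open>Induction over well-founded classes\<close>

text \<open>
  In the formulas \<open>\<theta>(x, y, r)\<close>, the arguments \<open>x\<close>, \<open>y\<close>, \<open>r\<close> are \<open>Var 0\<close>, \<open>Var 1\<close>, \<open>Var 2\<close>.
  In \<open>\<phi>(x, z\<^sub>1, \<dots>, z\<^sub>k)\<close>, the argument \<open>x\<close> is \<open>Var 0\<close> and \<open>z\<^sub>i\<close> is \<open>Var i\<close>.
\<close>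

definition le_X :: "fm \<Rightarrow> trm \<Rightarrow> trm \<Rightarrow> trm \<Rightarrow> fm" where
  "le_X \<theta> r x y = inst \<theta> [x, y, r]"

definition in_X :: "fm \<Rightarrow> trm \<Rightarrow> trm \<Rightarrow> fm" where
  "in_X \<theta> r x = le_X \<theta> r x x"

definition less_X :: "fm \<Rightarrow> trm \<Rightarrow> trm \<Rightarrow> trm \<Rightarrow> fm" where
  "less_X \<theta> r x y = And (le_X \<theta> r x y) (NEq x y)"

text \<open>In the following three formulas, the parameter \<open>r\<close> is the free variable \<open>Var 0\<close>.\<close>

definition Delta_Rel :: "fm \<Rightarrow> fm \<Rightarrow> fm" where
  "Delta_Rel \<theta>\<^sub>\<Sigma> \<theta>\<^sub>\<Pi> =
     And (All (All (Imp (le_X \<theta>\<^sub>\<Sigma> (Var 2) (Var 1) (Var 0))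
                        (And (in_X \<theta>\<^sub>\<Sigma> (Var 2) (Var 1)) (in_X \<theta>\<^sub>\<Sigma> (Var 2) (Var 0))))))
         (All (All (Iff (inst \<theta>\<^sub>\<Sigma> [Var 1, Var 0, Var 2]) (inst \<theta>\<^sub>\<Pi> [Var 1, Var 0, Var 2]))))"

definition WF :: "fm \<Rightarrow> fm" where
  "WF \<theta> =
     All (Imp (NEq (Var 0) zero)
              (BEx (Var 0) (BAll (Var 1) (neg (less_X \<theta> (Var 3) (Var 0) (Var 1))))))"

text \<open>Inside the \<open>k\<close> quantifiers over \<open>z\<^sub>1, \<dots>, z\<^sub>k\<close>, the parameter \<open>r\<close> is \<open>Var k\<close>.\<close>

definition Ind :: "fm \<Rightarrow> nat \<Rightarrow> fm \<Rightarrow> fm" where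
  "Ind \<theta> k \<phi> =
     Alls k (Imp
       (All (Imp (in_X \<theta> (Var (k + 1)) (Var 0))
          (Imp (All (Imp (less_X \<theta> (Var (k + 2)) (Var 0) (Var 1))
                         (inst \<phi> (Var 0 # map Var [2..<k + 2]))))
               (inst \<phi> (Var 0 # map Var [1..<k + 1])))))
       (All (Imp (in_X \<theta> (Var (k + 1)) (Var 0))
                 (inst \<phi> (Var 0 # map Var [1..<k + 1])))))"

definition class_induction :: "fm \<Rightarrow> fm \<Rightarrow> nat \<Rightarrow> fm \<Rightarrow> fm" where
  "class_induction \<theta>\<^sub>\<Sigma> \<theta>\<^sub>\<Pi> k \<phi> =
     All (Imp (Subset (Var 0) omega)
              (Imp (And (Delta_Rel \<theta>\<^sub>\<Sigma> \<theta>\<^sub>\<Pi>) (WF \<theta>\<^sub>\<Sigma>)) (Ind \<theta>\<^sub>\<Sigma> k \<phi>)))"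

definition Class_Induction :: "fm set" where
  "Class_Induction = {class_induction \<theta>\<^sub>\<Sigma> \<theta>\<^sub>\<Pi> k \<phi> | \<theta>\<^sub>\<Sigma> \<theta>\<^sub>\<Pi> k \<phi>.
     sigma_fm \<theta>\<^sub>\<Sigma> \<and> fv \<theta>\<^sub>\<Sigma> \<subseteq> {0, 1, 2} \<and>
     pi_fm \<theta>\<^sub>\<Pi> \<and> fv \<theta>\<^sub>\<Pi> \<subseteq> {0, 1, 2} \<and>
     set_fm \<phi> \<and> fv \<phi> \<subseteq> {0..k}}"

end

theory Submission
  imports Defs "HOL-Library.Countable_Set"
begin

text \<open>
  By completeness it suffices to argue in an arbitrary model of primitive recursive set theory.

  Reflection implies induction: if induction over \<open>X\<^sup>r\<close> fails for \<open>\<phi>\<close>, then it fails in some transitive set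
  \<open>N\<close> with \<open>r \<in> N\<close>. The counterexamples in \<open>N\<close> form a set, and an \<open>X\<^sup>r\<close>-minimal one contradicts
  progressiveness in \<open>N\<close>, because the \<open>\<Sigma>\<close>-formula defining the order is upward absolute.

  Induction implies reflection: assume \<open>\<psi>(r)\<close>. The nodes of a class \<open>X\<^sup>r\<close> are finite sequences of claims
  \<open>(\<phi>, c)\<close>, where \<open>\<phi>\<close> is a subformula of \<open>\<psi>\<close> (conjoined with extensionality) and \<open>c\<close> an assignment. A
  node lies below another if it extends it and contains the claims that are needed to verify all
  claims of the larger node (a disjunct, a witness, the instances for all elements mentioned so far).
  Truth itself does not occur in the definition, which is \<open>\<Delta>\<^sub>0\<close>. A node whose claims are all true has a
  node of this kind below it, so if \<open>X\<^sup>r\<close> were well-founded, induction would show that the root claim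
  \<open>\<psi>(r)\<close> is false. Hence \<open>X\<^sup>r\<close> is not well-founded, and dependent choice yields a branch. The elements
  mentioned along the branch form an extensional set in which \<open>\<psi>(r)\<close> holds; collapse it.
\<close>

section \<open>Substitution\<close>

text \<open>The natural numbers of a model may be nonstandard, so the sequences are finite only in
  its own sense, and working off all tasks of a node is an induction inside the model whose
  invariant speaks of truth. Regularity yields induction only for predicates that admit separation;
  induction over \<omega> for arbitrary formulas comes from the class schema itself, applied to
  membership. Truth in the universe is not definable uniformly, but a fixed \<psi> has only finitely
  many subformulas. Recursion on formulas outside the model therefore suffices: each subformula is
  named by a numeral and has its own definable truth predicate. These predicates enter only the
  induction formula, which the schema leaves unrestricted. Well-foundedness refers to sets, so its
  failure provides a set of nodes without minimal element, and dependent choice for sets applies.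
  Since the formulas of the schema contain no function symbols, every notion used in the order has
  to be expressed by quantifiers bounded by sets at hand, whereas separation and the collapse are
  obtained from primitive recursive functions.\<close>

instance psf :: countable by countable_datatype
instance trm :: countable by countable_datatype
instance fm :: countable by countable_datatype

lemma sb_trm_sb_trm: "sb_trm \<sigma> (sb_trm \<tau> t) = sb_trm (\<lambda>i. sb_trm \<sigma> (\<tau> i)) t"
  by (induction t) auto

lemma sb_trm_cong: "(\<And>i. i \<in> fv_trm t \<Longrightarrow> \<sigma> i = \<tau> i) \<Longrightarrow> sb_trm \<sigma> t = sb_trm \<tau> t"
  by (induction t) auto

lemma sb_trm_Var [simp]: "sb_trm Var t = t"
  by (induction t) (auto simp: map_idI)

lemma up_0 [simp]: "up \<sigma> 0 = Var 0"
  and up_Suc [simp]: "up \<sigma> (Suc i) = lift_trm (\<sigma> i)"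
  by (simp_all add: up_def)

lemma lift_trm_Var [simp]: "lift_trm (Var i) = Var (Suc i)"
  and lift_trm_Fn [simp]: "lift_trm (Fn f ts) = Fn f (map lift_trm ts)"
  by (simp_all add: lift_trm_def)

lemma sb_trm_up_lift_trm [simp]: "sb_trm (up \<sigma>) (lift_trm t) = lift_trm (sb_trm \<sigma> t)"
  by (simp add: lift_trm_def sb_trm_sb_trm)

lemma sb_trm_up_up: "(\<lambda>i. sb_trm (up \<sigma>) (up \<tau> i)) = up (\<lambda>i. sb_trm \<sigma> (\<tau> i))"
  by (rule ext, case_tac i) auto

lemma sb_sb: "sb \<sigma> (sb \<tau> \<phi>) = sb (\<lambda>i. sb_trm \<sigma> (\<tau> i)) \<phi>"
  by (induction \<phi> arbitrary: \<sigma> \<tau>) (auto simp: sb_trm_sb_trm sb_trm_up_up)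

lemma up_cong: "(\<And>i. Suc i \<in> A \<Longrightarrow> \<sigma> i = \<tau> i) \<Longrightarrow> j \<in> A \<Longrightarrow> up \<sigma> j = up \<tau> j"
  by (cases j) auto

lemma sb_cong: "(\<And>i. i \<in> fv \<phi> \<Longrightarrow> \<sigma> i = \<tau> i) \<Longrightarrow> sb \<sigma> \<phi> = sb \<tau> \<phi>"
proof (induction \<phi> arbitrary: \<sigma> \<tau>)
  case (All \<phi>)
  have "sb (up \<sigma>) \<phi> = sb (up \<tau>) \<phi>"
    by (rule All.IH, rule up_cong[of "fv \<phi>"]) (use All.prems in auto)
  then show ?case by simp
next
  case (Ex \<phi>)
  have "sb (up \<sigma>) \<phi> = sb (up \<tau>) \<phi>"
    by (rule Ex.IH, rule up_cong[of "fv \<phi>"]) (use Ex.prems in auto)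
  then show ?case by simp
next
  case (And \<phi> \<psi>) then show ?case by (metis UnCI fv.simps(5) sb.simps(5))
next
  case (Or \<phi> \<psi>) then show ?case by (metis UnCI fv.simps(6) sb.simps(6))
qed (auto intro: sb_trm_cong)

lemma up_Var [simp]: "up Var = Var"
  by (rule ext, case_tac x) auto

lemma sb_Var [simp]: "sb Var \<phi> = \<phi>"
  by (induction \<phi>) auto

lemma sb_closed: "fv \<phi> = {} \<Longrightarrow> sb \<sigma> \<phi> = \<phi>"
  using sb_cong[of \<phi> \<sigma> Var] by simp

lemma neg_neg [simp]: "neg (neg \<phi>) = \<phi>"
  by (induction \<phi>) auto

lemma sb_neg [simp]: "sb \<sigma> (neg \<phi>) = neg (sb \<sigma> \<phi>)"
  by (induction \<phi> arbitrary: \<sigma>) auto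

lemma wf_fm_neg [simp]: "wf_fm (neg \<phi>) = wf_fm \<phi>"
  by (induction \<phi>) auto

lemma fv_neg [simp]: "fv (neg \<phi>) = fv \<phi>"
  by (induction \<phi>) auto

lemma set_fm_neg [simp]: "set_fm (neg \<phi>) = set_fm \<phi>"
  by (induction \<phi>) auto

lemma wf_sb_trm: "(\<And>i. wf_trm (\<sigma> i)) \<Longrightarrow> wf_trm t \<Longrightarrow> wf_trm (sb_trm \<sigma> t)"
  by (induction t) (auto simp: list_all_iff)

lemma wf_lift_trm: "wf_trm t \<Longrightarrow> wf_trm (lift_trm t)"
  by (simp add: lift_trm_def wf_sb_trm)

lemma wf_up: "(\<And>i. wf_trm (\<sigma> i)) \<Longrightarrow> wf_trm (up \<sigma> i)"
  by (cases i) (auto simp: wf_lift_trm)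

lemma wf_sb: "(\<And>i. wf_trm (\<sigma> i)) \<Longrightarrow> wf_fm \<phi> \<Longrightarrow> wf_fm (sb \<sigma> \<phi>)"
  by (induction \<phi> arbitrary: \<sigma>) (simp_all add: wf_sb_trm wf_up)

lemma inst_neg [simp]: "inst (neg \<phi>) ts = neg (inst \<phi> ts)"
  by (simp add: inst_def)

lemma wf_inst: "wf_fm \<phi> \<Longrightarrow> list_all wf_trm ts \<Longrightarrow> wf_fm (inst \<phi> ts)"
  unfolding inst_def by (rule wf_sb) (auto simp: list_all_length)

lemma inst_single: "inst \<phi> [t] = sb (case_nat t Var) \<phi>"
  unfolding inst_def by (rule sb_cong) (auto split: nat.splits)

lemma inst_sb_up: "inst (sb (up \<sigma>) \<phi>) [t] = sb (case_nat t \<sigma>) \<phi>"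
proof -
  have "(\<lambda>i. sb_trm (case_nat t Var) (up \<sigma> i)) = case_nat t \<sigma>"
    by (rule ext, case_tac i) (auto simp: lift_trm_def sb_trm_sb_trm)
  then show ?thesis by (simp add: inst_single sb_sb)
qed

lemma sb_inst_single: "sb \<sigma> (inst \<phi> [t]) = inst (sb (up \<sigma>) \<phi>) [sb_trm \<sigma> t]"
proof -
  have "(\<lambda>i. sb_trm \<sigma> (case_nat t Var i)) = case_nat (sb_trm \<sigma> t) \<sigma>"
    by (rule ext, case_tac i) auto
  then show ?thesis by (simp add: inst_sb_up) (simp add: inst_single sb_sb)
qed

lemma sb_up_lift: "sb (up \<sigma>) (lift \<phi>) = lift (sb \<sigma> \<phi>)"
proof -
  have "(\<lambda>i. sb_trm (\<lambda>i. Var (Suc i)) (\<sigma> i)) = (\<lambda>i. lift_trm (\<sigma> i))"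
    by (simp add: lift_trm_def)
  then show ?thesis by (simp add: lift_def sb_sb)
qed

lemma finite_fv_trm: "finite (fv_trm t)"
  by (induction t) auto

lemma finite_fv: "finite (fv \<phi>)"
proof (induction \<phi>)
  case (All \<phi>)
  then show ?case using finite_vimageI[of "fv \<phi>" Suc] by (simp add: vimage_def)
next
  case (Ex \<phi>)
  then show ?case using finite_vimageI[of "fv \<phi>" Suc] by (simp add: vimage_def)
qed (auto simp: finite_fv_trm)

text \<open>Derivations are stable under substitution because the axioms are closed; at the rule
  \<open>AllI\<close>, \<open>up\<close> commutes with \<open>lift\<close>. The case of interest is
  the renaming in \<open>derivable_generalize\<close>.\<close>

lemma derivable_sb:
  assumes "derivable T \<Gamma>" "\<forall>\<phi>\<in>T. fv \<phi> = {}" "\<And>i. wf_trm (\<sigma> i)"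
  shows "derivable T (map (sb \<sigma>) \<Gamma>)"
  using assms(1,3)
proof (induction arbitrary: \<sigma>)
  case (Ax \<phi>)
  then show ?case using assms(2) by (simp add: sb_closed derivable.Ax)
next
  case (Id \<phi>)
  then show ?case by (simp add: derivable.Id wf_sb)
next
  case (Refl t)
  then show ?case by (simp add: derivable.Refl wf_sb_trm)
next
  case (Repl s t \<phi>)
  then show ?case
    by (simp add: sb_inst_single derivable.Repl wf_sb_trm wf_sb wf_up)
next
  case (AndI \<phi> \<Gamma> \<psi>)
  then show ?case by (simp add: derivable.AndI)
next
  case (OrI \<phi> \<psi> \<Gamma>)
  then show ?case by (simp add: derivable.OrI)
next
  case (AllI \<phi> \<Gamma>)
  have "derivable T (map (sb (up \<sigma>)) (\<phi> # map lift \<Gamma>))"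
    by (rule AllI.IH) (simp add: AllI.prems wf_up)
  then have "derivable T (sb (up \<sigma>) \<phi> # map lift (map (sb \<sigma>) \<Gamma>))"
    by (simp add: sb_up_lift o_def)
  then show ?case by (simp add: derivable.AllI)
next
  case (ExI t \<phi> \<Gamma>)
  have "derivable T (inst (sb (up \<sigma>) \<phi>) [sb_trm \<sigma> t] # map (sb \<sigma>) \<Gamma>)"
    using ExI.IH[of \<sigma>] ExI.prems by (simp add: sb_inst_single)
  then show ?case using ExI by (simp add: derivable.ExI[of "sb_trm \<sigma> t"] wf_sb_trm)
next
  case (Cut \<phi> \<Gamma>)
  show ?case by (rule derivable.Cut[of T "sb \<sigma> \<phi>"]) (use Cut.IH[of \<sigma>] Cut.prems in simp_all)
next
  case (Weak \<Gamma> \<Delta>)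
  show ?case
    by (rule derivable.Weak[OF Weak.IH[of \<sigma>]]) (use Weak in \<open>auto simp: list_all_iff intro: wf_sb\<close>)
qed

text \<open>The rule \<open>AllI\<close> shifts its context, whereas the Henkin construction uses a
  free variable \<open>n\<close> that is fresh in the usual sense. The renaming that sends
  \<open>n\<close> to 0 and every other index up by one translates between the two.\<close>

lemma derivable_generalize:
  assumes "derivable T (inst \<phi> [Var n] # \<Gamma>)" "\<forall>\<phi>\<in>T. fv \<phi> = {}"
    and fresh: "n \<notin> fv (All \<phi>)" "\<forall>\<gamma>\<in>set \<Gamma>. n \<notin> fv \<gamma>"
  shows "derivable T (All \<phi> # \<Gamma>)"
proof -
  define \<sigma> where "\<sigma> i = (if i = n then Var 0 else Var (Suc i))" for i
  have d: "derivable T (map (sb \<sigma>) (inst \<phi> [Var n] # \<Gamma>))"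
    by (rule derivable_sb[OF assms(1,2)]) (simp add: \<sigma>_def)
  have "sb \<sigma> (inst \<phi> [Var n]) = sb Var \<phi>"
    unfolding inst_single sb_sb
    by (rule sb_cong) (use fresh in \<open>auto simp: \<sigma>_def split: nat.splits\<close>)
  moreover have "map (sb \<sigma>) \<Gamma> = map lift \<Gamma>"
    unfolding lift_def by (rule map_cong, simp, rule sb_cong) (use fresh in \<open>auto simp: \<sigma>_def\<close>)
  ultimately have "derivable T (\<phi> # map lift \<Gamma>)" using d by (simp del: map_eq_conv)
  then show ?thesis by (rule derivable.AllI)
qed


section \<open>Semantics\<close>

primrec val :: "(psf \<Rightarrow> 'a list \<Rightarrow> 'a) \<Rightarrow> (nat \<Rightarrow> 'a) \<Rightarrow> trm \<Rightarrow> 'a" where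
  "val F e (Var i) = e i"
| "val F e (Fn f ts) = F f (map (val F e) ts)"

text \<open>Quantifiers range over \<open>U\<close>, which covers both truth and relativized truth.\<close>

primrec sat :: "('a \<Rightarrow> 'a \<Rightarrow> bool) \<Rightarrow> (psf \<Rightarrow> 'a list \<Rightarrow> 'a) \<Rightarrow> 'a set \<Rightarrow> (nat \<Rightarrow> 'a) \<Rightarrow> fm \<Rightarrow> bool"
where
  "sat E F U e (Mem s t) \<longleftrightarrow> E (val F e s) (val F e t)"
| "sat E F U e (NMem s t) \<longleftrightarrow> \<not> E (val F e s) (val F e t)"
| "sat E F U e (Eq s t) \<longleftrightarrow> val F e s = val F e t"
| "sat E F U e (NEq s t) \<longleftrightarrow> val F e s \<noteq> val F e t"
| "sat E F U e (And \<phi> \<psi>) \<longleftrightarrow> sat E F U e \<phi> \<and> sat E F U e \<psi>"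
| "sat E F U e (Or \<phi> \<psi>) \<longleftrightarrow> sat E F U e \<phi> \<or> sat E F U e \<psi>"
| "sat E F U e (All \<phi>) \<longleftrightarrow> (\<forall>x\<in>U. sat E F U (case_nat x e) \<phi>)"
| "sat E F U e (Ex \<phi>) \<longleftrightarrow> (\<exists>x\<in>U. sat E F U (case_nat x e) \<phi>)"

lemma sat_neg [simp]: "sat E F U e (neg \<phi>) \<longleftrightarrow> \<not> sat E F U e \<phi>"
  by (induction \<phi> arbitrary: e) auto

lemma sat_Imp [simp]: "sat E F U e (Imp \<phi> \<psi>) \<longleftrightarrow> (sat E F U e \<phi> \<longrightarrow> sat E F U e \<psi>)"
  and sat_Iff [simp]: "sat E F U e (Iff \<phi> \<psi>) \<longleftrightarrow> (sat E F U e \<phi> \<longleftrightarrow> sat E F U e \<psi>)"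
  by (auto simp: Imp_def Iff_def)

lemma val_sb_trm [simp]: "val F e (sb_trm \<sigma> t) = val F (\<lambda>i. val F e (\<sigma> i)) t"
  by (induction t) (auto simp: o_def cong: map_cong)

lemma val_lift_trm [simp]: "val F (case_nat x e) (lift_trm t) = val F e t"
  by (simp add: lift_trm_def)

lemma val_up: "(\<lambda>i. val F (case_nat x e) (up \<sigma> i)) = case_nat x (\<lambda>i. val F e (\<sigma> i))"
  by (rule ext, case_tac i) auto

lemma sat_sb [simp]: "sat E F U e (sb \<sigma> \<phi>) \<longleftrightarrow> sat E F U (\<lambda>i. val F e (\<sigma> i)) \<phi>"
  by (induction \<phi> arbitrary: e \<sigma>) (simp_all add: val_up)

lemma val_cong: "(\<And>i. i \<in> fv_trm t \<Longrightarrow> e i = e' i) \<Longrightarrow> val F e t = val F e' t"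
proof (induction t)
  case (Fn f ts)
  then have "map (val F e) ts = map (val F e') ts" by auto
  then show ?case by (simp only: val.simps)
qed simp

lemma case_nat_cong: "(\<And>i. Suc i \<in> A \<Longrightarrow> e i = e' i) \<Longrightarrow> j \<in> A \<Longrightarrow> case_nat x e j = case_nat x e' j"
  by (cases j) auto

lemma sat_cong: "(\<And>i. i \<in> fv \<phi> \<Longrightarrow> e i = e' i) \<Longrightarrow> sat E F U e \<phi> \<longleftrightarrow> sat E F U e' \<phi>"
proof (induction \<phi> arbitrary: e e')
  case (All \<phi>)
  have "sat E F U (case_nat x e) \<phi> \<longleftrightarrow> sat E F U (case_nat x e') \<phi>" for x
    by (rule All.IH, rule case_nat_cong[of "fv \<phi>"]) (use All.prems in auto)
  then show ?case by simp
next
  case (Ex \<phi>)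
  have "sat E F U (case_nat x e) \<phi> \<longleftrightarrow> sat E F U (case_nat x e') \<phi>" for x
    by (rule Ex.IH, rule case_nat_cong[of "fv \<phi>"]) (use Ex.prems in auto)
  then show ?case by simp
next
  case (And \<phi> \<psi>) then show ?case by (metis UnCI fv.simps(5) sat.simps(5))
next
  case (Or \<phi> \<psi>) then show ?case by (metis UnCI fv.simps(6) sat.simps(6))
next
  case (Mem s t) then show ?case using val_cong[of s e e' F] val_cong[of t e e' F] by simp
next
  case (NMem s t) then show ?case using val_cong[of s e e' F] val_cong[of t e e' F] by simp
next
  case (Eq s t) then show ?case using val_cong[of s e e' F] val_cong[of t e e' F] by simp
next
  case (NEq s t) then show ?case using val_cong[of s e e' F] val_cong[of t e e' F] by simp
qed

lemma sat_inst:
  "sat E F U e (inst \<phi> ts) \<longleftrightarrow>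
   sat E F U (\<lambda>i. if i < length ts then val F e (ts ! i) else e (i - length ts)) \<phi>"
proof -
  have "(\<lambda>i. val F e (if i < length ts then ts ! i else Var (i - length ts))) =
        (\<lambda>i. if i < length ts then val F e (ts ! i) else e (i - length ts))" by auto
  then show ?thesis by (simp add: inst_def)
qed

lemma sat_BAll [simp]:
  "sat E F U e (BAll t \<phi>) \<longleftrightarrow> (\<forall>x\<in>U. E x (val F e t) \<longrightarrow> sat E F U (case_nat x e) \<phi>)"
  and sat_BEx [simp]:
  "sat E F U e (BEx t \<phi>) \<longleftrightarrow> (\<exists>x\<in>U. E x (val F e t) \<and> sat E F U (case_nat x e) \<phi>)"
  by (auto simp: BAll_def BEx_def)

lemma sat_rel:
  "sat E F UNIV e (rel N \<phi>) \<longleftrightarrow> sat E F {x. E x (val F e N)} e \<phi>"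
  by (induction \<phi> arbitrary: e N) auto

text \<open>A block of \<open>n\<close> quantifiers is read as one choice of \<open>e'\<close>: its
  first \<open>n\<close> values are the bound ones, and shifting by \<open>n\<close> gives back the
  old assignment.\<close>

lemma sat_Alls:
  "sat E F U e (Alls n \<phi>) \<longleftrightarrow>
   (\<forall>e'. (\<forall>i<n. e' i \<in> U) \<and> (\<forall>i. e' (n + i) = e i) \<longrightarrow> sat E F U e' \<phi>)"
proof (induction n arbitrary: e)
  case 0
  have "(\<forall>i. e' i = e i) \<longleftrightarrow> e' = e" for e' by auto
  then show ?case by (simp add: Alls_def)
next
  case (Suc n)
  have "sat E F U e (Alls (Suc n) \<phi>) \<longleftrightarrow> (\<forall>x\<in>U. sat E F U (case_nat x e) (Alls n \<phi>))"
    by (simp add: Alls_def)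
  also have "\<dots> \<longleftrightarrow> (\<forall>x\<in>U. \<forall>e'. (\<forall>i<n. e' i \<in> U) \<and> (\<forall>i. e' (n + i) = case_nat x e i)
      \<longrightarrow> sat E F U e' \<phi>)"
    unfolding Suc.IH ..
  also have "\<dots> \<longleftrightarrow>
      (\<forall>e'. (\<forall>i<Suc n. e' i \<in> U) \<and> (\<forall>i. e' (Suc n + i) = e i) \<longrightarrow> sat E F U e' \<phi>)"
  proof -
    have "(\<forall>i. e' (n + i) = case_nat x e i) \<longleftrightarrow> x = e' n \<and> (\<forall>i. e' (Suc n + i) = e i)" for e' x
    proof
      assume *: "\<forall>i. e' (n + i) = case_nat x e i"
      then show "x = e' n \<and> (\<forall>i. e' (Suc n + i) = e i)"
        using *[rule_format, of 0] *[rule_format, of "Suc _"] by simp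
    next
      assume "x = e' n \<and> (\<forall>i. e' (Suc n + i) = e i)"
      then show "\<forall>i. e' (n + i) = case_nat x e i" by (auto split: nat.split)
    qed
    moreover have "(\<forall>i<Suc n. e' i \<in> U) \<longleftrightarrow> (\<forall>i<n. e' i \<in> U) \<and> e' n \<in> U" for e'
      by (auto simp: less_Suc_eq)
    ultimately show ?thesis by (simp only:) blast
  qed
  finally show ?case .
qed

section \<open>Completeness\<close>

locale henkin =
  fixes T H :: "fm set"
  assumes wf_H: "\<phi> \<in> H \<Longrightarrow> wf_fm \<phi>"
    and consistent: "set \<Gamma> \<subseteq> H \<Longrightarrow> \<not> derivable T (map neg \<Gamma>)"
    and complete: "wf_fm \<phi> \<Longrightarrow> \<phi> \<in> H \<or> neg \<phi> \<in> H"
    and witness: "Ex \<phi> \<in> H \<Longrightarrow> \<exists>n. inst \<phi> [Var n] \<in> H"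
begin

section \<open>Closure properties of a maximal consistent theory\<close>

lemma derivable_H:
  assumes "derivable T (\<phi> # map neg \<Gamma>)" "set \<Gamma> \<subseteq> H" "wf_fm \<phi>"
  shows "\<phi> \<in> H"
  using complete[OF assms(3)] consistent[of "neg \<phi> # \<Gamma>"] assms by auto

lemma axiom_H: "\<phi> \<in> T \<Longrightarrow> wf_fm \<phi> \<Longrightarrow> \<phi> \<in> H"
  using derivable_H[of \<phi> "[]"] by (simp add: derivable.Ax)

lemma neg_H: "wf_fm \<phi> \<Longrightarrow> neg \<phi> \<in> H \<longleftrightarrow> \<phi> \<notin> H"
  using complete[of \<phi>] consistent[of "[neg \<phi>, \<phi>]"] derivable.Id[of \<phi> T] by auto

lemma And_H:
  assumes "wf_fm \<phi>" "wf_fm \<psi>"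
  shows "And \<phi> \<psi> \<in> H \<longleftrightarrow> \<phi> \<in> H \<and> \<psi> \<in> H"
proof -
  have w1: "derivable T [\<phi>, neg \<phi>, neg \<psi>]"
    by (rule derivable.Weak[OF derivable.Id[of \<phi>]]) (use assms in simp_all)
  have w2: "derivable T [\<psi>, neg \<phi>, neg \<psi>]"
    by (rule derivable.Weak[OF derivable.Id[of \<psi>]]) (use assms in simp_all)
  have o1: "derivable T [Or (neg \<phi>) (neg \<psi>), \<phi>]"
    by (rule derivable.OrI, rule derivable.Weak[OF w1]) (use assms in simp_all)
  have o2: "derivable T [Or (neg \<phi>) (neg \<psi>), \<psi>]"
    by (rule derivable.OrI, rule derivable.Weak[OF w2]) (use assms in simp_all)
  have "derivable T (\<phi> # map neg [And \<phi> \<psi>])"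
    by (rule derivable.Weak[OF o1]) (use assms in simp_all)
  then have 1: "And \<phi> \<psi> \<in> H \<Longrightarrow> \<phi> \<in> H"
    by (rule derivable_H) (use assms in simp_all)
  have "derivable T (\<psi> # map neg [And \<phi> \<psi>])"
    by (rule derivable.Weak[OF o2]) (use assms in simp_all)
  then have 2: "And \<phi> \<psi> \<in> H \<Longrightarrow> \<psi> \<in> H"
    by (rule derivable_H) (use assms in simp_all)
  have "derivable T (And \<phi> \<psi> # map neg [\<phi>, \<psi>])"
    using derivable.AndI[OF w1 w2] by simp
  then have "\<phi> \<in> H \<Longrightarrow> \<psi> \<in> H \<Longrightarrow> And \<phi> \<psi> \<in> H"
    by (rule derivable_H) (use assms in simp_all)
  then show ?thesis using 1 2 by blast
qed

lemma Or_H: "wf_fm \<phi> \<Longrightarrow> wf_fm \<psi> \<Longrightarrow> Or \<phi> \<psi> \<in> H \<longleftrightarrow> \<phi> \<in> H \<or> \<psi> \<in> H"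
  using And_H[of "neg \<phi>" "neg \<psi>"] neg_H[of "Or \<phi> \<psi>"] neg_H[of \<phi>] neg_H[of \<psi>] by auto

lemma instance_H:
  assumes "wf_fm \<phi>" "wf_trm t" "All \<phi> \<in> H"
  shows "inst \<phi> [t] \<in> H"
proof -
  have "derivable T [neg (inst \<phi> [t]), inst \<phi> [t]]"
    using derivable.Id[of "neg (inst \<phi> [t])" T] assms wf_inst[of \<phi> "[t]"] by simp
  then have "derivable T [Ex (neg \<phi>), inst \<phi> [t]]"
    using assms by (auto intro: derivable.ExI)
  then have "derivable T [inst \<phi> [t], Ex (neg \<phi>)]"
    by (rule derivable.Weak) (use assms wf_inst[of \<phi> "[t]"] in auto)
  then show ?thesis
    using derivable_H[of "inst \<phi> [t]" "[All \<phi>]"] assms wf_inst[of \<phi> "[t]"] by auto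
qed

lemma All_H:
  assumes "wf_fm \<phi>"
  shows "All \<phi> \<in> H \<longleftrightarrow> (\<forall>n. inst \<phi> [Var n] \<in> H)"
proof
  assume "All \<phi> \<in> H"
  then show "\<forall>n. inst \<phi> [Var n] \<in> H" using instance_H[OF assms] by simp
next
  assume *: "\<forall>n. inst \<phi> [Var n] \<in> H"
  show "All \<phi> \<in> H"
  proof (rule ccontr)
    assume "All \<phi> \<notin> H"
    then have "Ex (neg \<phi>) \<in> H" using neg_H[of "All \<phi>"] assms by simp
    then obtain n where "neg (inst \<phi> [Var n]) \<in> H" using witness[of "neg \<phi>"] by auto
    then show False using * neg_H[of "inst \<phi> [Var n]"] assms by (simp add: wf_inst)
  qed
qed

lemma Ex_H:
  assumes "wf_fm \<phi>"
  shows "Ex \<phi> \<in> H \<longleftrightarrow> (\<exists>n. inst \<phi> [Var n] \<in> H)"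
proof -
  have "Ex \<phi> \<in> H \<longleftrightarrow> All (neg \<phi>) \<notin> H" using neg_H[of "Ex \<phi>"] assms by simp
  also have "\<dots> \<longleftrightarrow> (\<exists>n. neg (inst \<phi> [Var n]) \<notin> H)" using All_H[of "neg \<phi>"] assms by simp
  also have "\<dots> \<longleftrightarrow> (\<exists>n. inst \<phi> [Var n] \<in> H)" using neg_H assms by (simp add: wf_inst)
  finally show ?thesis .
qed

lemma Eq_refl_H: "wf_trm t \<Longrightarrow> Eq t t \<in> H"
  using derivable_H[of "Eq t t" "[]"] by (simp add: derivable.Refl)

lemma replace_H:
  assumes "wf_trm s" "wf_trm t" "wf_fm \<phi>" "Eq s t \<in> H" "inst \<phi> [s] \<in> H"
  shows "inst \<phi> [t] \<in> H"
proof -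
  have "derivable T [inst \<phi> [t], neg (Eq s t), neg (inst \<phi> [s])]"
    by (rule derivable.Weak[OF derivable.Repl[of s t \<phi>]]) (use assms in \<open>auto simp: wf_inst\<close>)
  then show ?thesis
    using derivable_H[of "inst \<phi> [t]" "[Eq s t, inst \<phi> [s]]"] assms by (simp add: wf_inst)
qed

lemma sb_trm_case_nat_lift [simp]: "sb_trm (case_nat t Var) (lift_trm s) = s"
  by (simp add: lift_trm_def sb_trm_sb_trm)

lemma Eq_sym_H:
  assumes "wf_trm s" "wf_trm t" "Eq s t \<in> H" shows "Eq t s \<in> H"
  using replace_H[of s t "Eq (Var 0) (lift_trm s)"] assms
  by (simp add: inst_single Eq_refl_H wf_lift_trm)

lemma Eq_trans_H:
  assumes "wf_trm s" "wf_trm t" "wf_trm u" "Eq s t \<in> H" "Eq t u \<in> H" shows "Eq s u \<in> H"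
  using replace_H[of t u "Eq (lift_trm s) (Var 0)"] assms
  by (simp add: inst_single wf_lift_trm)

lemma Mem_cong_H:
  assumes "wf_trm s" "wf_trm t" "wf_trm s'" "wf_trm t'" "Eq s s' \<in> H" "Eq t t' \<in> H" "Mem s t \<in> H"
  shows "Mem s' t' \<in> H"
  using replace_H[of s s' "Mem (Var 0) (lift_trm t)"] replace_H[of t t' "Mem (lift_trm s') (Var 0)"]
    assms by (simp add: inst_single wf_lift_trm)

text \<open>\<open>Repl\<close> exchanges one term at a time. The prefix \<open>us\<close> collects
  the arguments already exchanged, and transitivity links the successive steps.\<close>

lemma Fn_cong_H:
  assumes "list_all2 (\<lambda>s t. wf_trm s \<and> wf_trm t \<and> Eq s t \<in> H) ss ts"
    and "wf_psf f" "list_all wf_trm us" "length us + length ss = arity f"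
  shows "Eq (Fn f (us @ ss)) (Fn f (us @ ts)) \<in> H"
  using assms
proof (induction ss ts arbitrary: us rule: list_all2_induct)
  case Nil
  then show ?case by (simp add: Eq_refl_H)
next
  case (Cons s ss t ts)
  have wf: "list_all wf_trm ss" "list_all wf_trm ts" "length ts = length ss"
    using Cons.hyps by (auto simp: list_all2_conv_all_nth list_all_length)
  let ?\<phi> = "Eq (Fn f (map lift_trm (us @ s # ss)))
    (Fn f (map lift_trm us @ Var 0 # map lift_trm ss))"
  have inst: "inst ?\<phi> [v] = Eq (Fn f (us @ s # ss)) (Fn f (us @ v # ss))" for v
    by (simp add: inst_single o_def)
  have "wf_fm ?\<phi>"
    using Cons.prems Cons.hyps wf by (simp add: list_all_iff wf_lift_trm ball_Un)
  moreover have "Eq (Fn f (us @ s # ss)) (Fn f (us @ s # ss)) \<in> H"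
    using Cons.prems Cons.hyps wf by (simp add: Eq_refl_H)
  ultimately have "Eq (Fn f (us @ s # ss)) (Fn f (us @ t # ss)) \<in> H"
    using replace_H[of s t ?\<phi>] Cons.hyps inst by simp
  moreover have "Eq (Fn f ((us @ [t]) @ ss)) (Fn f ((us @ [t]) @ ts)) \<in> H"
    by (rule Cons.IH) (use Cons.prems Cons.hyps in auto)
  ultimately show ?case
    using Eq_trans_H[of "Fn f (us @ s # ss)" "Fn f (us @ t # ss)" "Fn f (us @ t # ts)"]
      Cons.prems Cons.hyps wf by simp
qed

text \<open>
  Every term is provably equal to a variable, so the values \<open>c t\<close> of terms are already values of
  variables, and the model with domain \<open>range (\<lambda>n. c (Var n))\<close> satisfies exactly the members of \<open>H\<close>.
\<close>

lemma term_variable_H: "wf_trm t \<Longrightarrow> \<exists>n. Eq t (Var n) \<in> H"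
proof -
  assume t: "wf_trm t"
  have "derivable T [Ex (Eq (lift_trm t) (Var 0))]"
    by (rule derivable.ExI[of t]) (use t in \<open>auto simp: inst_single derivable.Refl\<close>)
  then have "Ex (Eq (lift_trm t) (Var 0)) \<in> H"
    using derivable_H[of "Ex (Eq (lift_trm t) (Var 0))" "[]"] t by (simp add: wf_lift_trm)
  then show ?thesis using witness[of "Eq (lift_trm t) (Var 0)"] by (simp add: inst_single)
qed

text \<open>The naming \<open>c\<close> of values stays abstract because it is used twice: with
  equivalence classes, where the domain is shown to be infinite, and then with a numbering of these
  classes by all natural numbers.\<close>

context
  fixes c :: "trm \<Rightarrow> 'd"
  assumes c_eq: "\<And>s t. wf_trm s \<Longrightarrow> wf_trm t \<Longrightarrow> c s = c t \<longleftrightarrow> Eq s t \<in> H"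
begin

definition rep :: "'d \<Rightarrow> trm" where
  "rep d = Var (SOME n. c (Var n) = d)"

definition memH :: "'d \<Rightarrow> 'd \<Rightarrow> bool" where
  "memH d d' \<longleftrightarrow> Mem (rep d) (rep d') \<in> H"

definition funH :: "psf \<Rightarrow> 'd list \<Rightarrow> 'd" where
  "funH f ds = c (Fn f (map rep ds))"

lemma wf_rep: "wf_trm (rep d)"
  by (simp add: rep_def)

lemma c_in_range: "wf_trm t \<Longrightarrow> c t \<in> range (\<lambda>n. c (Var n))"
  using term_variable_H[of t] c_eq[of t "Var _"] by auto

lemma c_rep: "wf_trm t \<Longrightarrow> c (rep (c t)) = c t"
  using c_in_range[of t] someI_ex[of "\<lambda>n. c (Var n) = c t"] unfolding rep_def by (auto simp: eq_commute)

lemma Eq_rep_H: "wf_trm t \<Longrightarrow> Eq (rep (c t)) t \<in> H"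
  using c_rep c_eq wf_rep by blast

lemma val_funH:
  assumes "\<And>i. wf_trm (\<sigma> i)" "wf_trm t"
  shows "val funH (\<lambda>i. c (\<sigma> i)) t = c (sb_trm \<sigma> t)"
  using assms(2)
proof (induction t)
  case (Fn f ts)
  let ?ss = "map (\<lambda>t. rep (c (sb_trm \<sigma> t))) ts" and ?ts = "map (sb_trm \<sigma>) ts"
  have wf: "list_all wf_trm ?ss" "list_all wf_trm ?ts"
    using Fn.prems assms(1) by (auto simp: list_all_iff wf_rep wf_sb_trm)
  have "Eq (Fn f ([] @ ?ss)) (Fn f ([] @ ?ts)) \<in> H"
    by (rule Fn_cong_H) (use Fn.prems assms(1) in
      \<open>auto simp: list_all2_conv_all_nth list_all_length wf_rep wf_sb_trm Eq_rep_H\<close>)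
  then have "c (Fn f ?ss) = c (Fn f ?ts)"
    using c_eq[of "Fn f ?ss" "Fn f ?ts"] Fn.prems wf by simp
  moreover have "map (val funH (\<lambda>i. c (\<sigma> i))) ts = map (\<lambda>t. c (sb_trm \<sigma> t)) ts"
    using Fn by (auto simp: list_all_iff)
  ultimately show ?case by (simp only: val.simps sb_trm.simps funH_def[of f] map_map o_def)
qed simp

lemma funH_in_range: "wf_psf f \<Longrightarrow> length ds = arity f \<Longrightarrow> funH f ds \<in> range (\<lambda>n. c (Var n))"
  unfolding funH_def by (rule c_in_range) (auto simp: list_all_iff wf_rep)

lemma memH_c:
  assumes "wf_trm s" "wf_trm t"
  shows "memH (c s) (c t) \<longleftrightarrow> Mem s t \<in> H"
proof -
  have eq: "Eq (rep (c s)) s \<in> H" "Eq (rep (c t)) t \<in> H" using Eq_rep_H assms by auto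
  then have "Eq s (rep (c s)) \<in> H" "Eq t (rep (c t)) \<in> H" using Eq_sym_H wf_rep assms by auto
  then show ?thesis unfolding memH_def using eq Mem_cong_H wf_rep assms by blast
qed

text \<open>The truth lemma. It is stated for all substitutions at once, since instantiating a
  quantifier changes \<sigma> into \<open>case_nat (Var n) \<sigma>\<close>.\<close>

lemma sat_H:
  assumes "\<And>i. wf_trm (\<sigma> i)" "wf_fm \<phi>"
  shows "sat memH funH (range (\<lambda>n. c (Var n))) (\<lambda>i. c (\<sigma> i)) \<phi> \<longleftrightarrow> sb \<sigma> \<phi> \<in> H"
  using assms
proof (induction \<phi> arbitrary: \<sigma>)
  case (All \<phi>)
  have "sat memH funH (range (\<lambda>n. c (Var n))) (case_nat (c (Var n)) (\<lambda>i. c (\<sigma> i))) \<phi> \<longleftrightarrow>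
      inst (sb (up \<sigma>) \<phi>) [Var n] \<in> H" for n
  proof -
    have "case_nat (c (Var n)) (\<lambda>i. c (\<sigma> i)) = (\<lambda>i. c (case_nat (Var n) \<sigma> i))"
      by (rule ext) (simp split: nat.split)
    moreover have "wf_trm (case_nat (Var n) \<sigma> i)" for i using All.prems by (cases i) auto
    moreover have "wf_fm \<phi>" using All.prems by simp
    ultimately show ?thesis
      unfolding inst_sb_up by (metis (no_types) All.IH[of "case_nat (Var n) \<sigma>"])
  qed
  moreover have "wf_fm (sb (up \<sigma>) \<phi>)" by (rule wf_sb) (use All.prems in \<open>simp_all add: wf_up\<close>)
  ultimately show ?case by (simp add: All_H)
next
  case (Ex \<phi>)
  have "sat memH funH (range (\<lambda>n. c (Var n))) (case_nat (c (Var n)) (\<lambda>i. c (\<sigma> i))) \<phi> \<longleftrightarrow>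
      inst (sb (up \<sigma>) \<phi>) [Var n] \<in> H" for n
  proof -
    have "case_nat (c (Var n)) (\<lambda>i. c (\<sigma> i)) = (\<lambda>i. c (case_nat (Var n) \<sigma> i))"
      by (rule ext) (simp split: nat.split)
    moreover have "wf_trm (case_nat (Var n) \<sigma> i)" for i using Ex.prems by (cases i) auto
    moreover have "wf_fm \<phi>" using Ex.prems by simp
    ultimately show ?thesis
      unfolding inst_sb_up by (metis (no_types) Ex.IH[of "case_nat (Var n) \<sigma>"])
  qed
  moreover have "wf_fm (sb (up \<sigma>) \<phi>)" by (rule wf_sb) (use Ex.prems in \<open>simp_all add: wf_up\<close>)
  ultimately show ?case by (simp add: Ex_H)
next
  case (NMem s t)
  then show ?case using neg_H[of "Mem (sb_trm \<sigma> s) (sb_trm \<sigma> t)"]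
    by (simp add: val_funH memH_c wf_sb_trm)
next
  case (NEq s t)
  then show ?case using neg_H[of "Eq (sb_trm \<sigma> s) (sb_trm \<sigma> t)"]
    by (simp add: val_funH c_eq wf_sb_trm)
next
  case (And \<phi> \<psi>)
  then show ?case using And_H[of "sb \<sigma> \<phi>" "sb \<sigma> \<psi>"] by (simp add: wf_sb)
next
  case (Or \<phi> \<psi>)
  then show ?case using Or_H[of "sb \<sigma> \<phi>" "sb \<sigma> \<psi>"] by (simp add: wf_sb)
qed (simp_all add: val_funH memH_c c_eq wf_sb_trm)

end

text \<open>
  A finite model of \<open>T\<close> would contain a set of all its elements, against regularity.
\<close>

lemma infinite_range:
  fixes c :: "trm \<Rightarrow> 'd"
  assumes c_eq: "\<And>s t. wf_trm s \<Longrightarrow> wf_trm t \<Longrightarrow> c s = c t \<longleftrightarrow> Eq s t \<in> H"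
    and T: "regularity \<in> T" "defining_axiom Zero \<in> T" "defining_axiom Adj \<in> T"
    and closed: "\<forall>\<phi>\<in>T. wf_fm \<phi> \<and> fv \<phi> = {}"
  shows "infinite (range (\<lambda>n. c (Var n)))"
proof
  let ?U = "range (\<lambda>n. c (Var n))" and ?E = "memH c" and ?F = "funH c"
  let ?e = "\<lambda>i. c (Var i)"
  assume "finite ?U"
  have sat: "sat ?E ?F ?U ?e \<phi>" if "\<phi> \<in> T" for \<phi>
    using sat_H[OF c_eq, of Var \<phi>] axiom_H that closed by simp
  let ?z = "?F Zero []" and ?a = "\<lambda>x y. ?F Adj [x, y]"
  have inU: "?F f ds \<in> ?U" if "wf_psf f" "length ds = arity f" for f ds
    using funH_in_range[OF c_eq that] .
  have zU: "?z \<in> ?U" by (rule inU) auto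
  have aU: "?a x y \<in> ?U" for x y by (rule inU) auto
  have z: "\<not> ?E x ?z" if "x \<in> ?U" for x
    using sat[OF T(2)] that by auto
  have a: "?E u (?a x y) \<longleftrightarrow> ?E u x \<or> u = y" if "u \<in> ?U" "x \<in> ?U" "y \<in> ?U" for u x y
    using sat[OF T(3)] that by (auto simp: Alls_def numeral_3_eq_3 numeral_2_eq_2)
  have reg: "\<exists>x\<in>?U. ?E x y \<and> (\<forall>v\<in>?U. ?E v y \<longrightarrow> \<not> ?E v x)" if "y \<in> ?U" "y \<noteq> ?z" for y
    using sat[OF T(1)] that by (auto simp: regularity_def)
  have "\<exists>u\<in>?U. \<forall>x\<in>A. ?E x u" if "finite A" "A \<subseteq> ?U" for A
    using that
  proof (induction A)
    case empty
    then show ?case using zU by auto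
  next
    case (insert y A)
    then obtain u where u: "u \<in> ?U" "\<forall>x\<in>A. ?E x u" by auto
    have "\<forall>x\<in>insert y A. ?E x (?a u y)"
    proof
      fix x assume x: "x \<in> insert y A"
      then show "?E x (?a u y)" using a[of x u y] u insert.prems by auto
    qed
    then show ?case using aU by blast
  qed
  then obtain u where u: "u \<in> ?U" "\<forall>x\<in>?U. ?E x u" using \<open>finite ?U\<close> by blast
  \<comment> \<open>Regularity for the singleton of \<open>u\<close> says that \<open>u\<close> is
    not its own element, although \<open>u\<close> contains everything.\<close>
  let ?s = "?a ?z u"
  have s: "?E x ?s \<longleftrightarrow> x = u" if "x \<in> ?U" for x using a[OF that zU u(1)] z[OF that] by simp
  have "?s \<noteq> ?z" using s[OF u(1)] z[OF u(1)] by metis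
  then show False using reg[of ?s] aU s u by metis
qed

end

text \<open>Lindenbaum's construction along an enumeration of all formulas: a formula consistent
  with the current finite list is added, an existential one together with a witness, so each stage
  stays finite and consistent.\<close>

lemma ex_henkin:
  assumes T: "\<forall>\<phi>\<in>T. fv \<phi> = {}" and \<chi>: "wf_fm \<chi>" "\<not> derivable T [\<chi>]"
  shows "\<exists>H. henkin T H \<and> neg \<chi> \<in> H"
proof -
  define fresh :: "fm list \<Rightarrow> nat" where "fresh \<Gamma> = (SOME n. \<forall>\<gamma>\<in>set \<Gamma>. n \<notin> fv \<gamma>)" for \<Gamma>
  have fresh: "\<forall>\<gamma>\<in>set \<Gamma>. fresh \<Gamma> \<notin> fv \<gamma>" for \<Gamma>
  proof -
    have "finite (\<Union>\<gamma>\<in>set \<Gamma>. fv \<gamma>)" by (simp add: finite_fv)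
    then obtain n where "n \<notin> (\<Union>\<gamma>\<in>set \<Gamma>. fv \<gamma>)" using ex_new_if_finite infinite_UNIV_nat by blast
    then have "\<exists>n. \<forall>\<gamma>\<in>set \<Gamma>. n \<notin> fv \<gamma>" by auto
    then show ?thesis unfolding fresh_def by (rule someI_ex)
  qed
  define wit where "wit \<Gamma> = (case hd \<Gamma> of Ex \<phi> \<Rightarrow> inst \<phi> [Var (fresh \<Gamma>)] # \<Gamma> | _ \<Rightarrow> \<Gamma>)" for \<Gamma>
  define ok where "ok \<Gamma> \<longleftrightarrow> list_all wf_fm \<Gamma> \<and> \<not> derivable T (map neg \<Gamma>)" for \<Gamma>
  define stage where "stage = rec_nat [neg \<chi>]
    (\<lambda>k \<Gamma>. if ok (from_nat k # \<Gamma>) then wit (from_nat k # \<Gamma>) else \<Gamma>)"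
  have stage_0: "stage 0 = [neg \<chi>]" by (simp add: stage_def)
  have stage_Suc: "stage (Suc k) =
      (if ok (from_nat k # stage k) then wit (from_nat k # stage k) else stage k)" for k
    by (simp add: stage_def)
  have set_wit: "set \<Gamma> \<subseteq> set (wit \<Gamma>)" for \<Gamma> by (auto simp: wit_def split: fm.splits)
  have ok_wit: "ok (wit (\<phi> # \<Gamma>))" if ok: "ok (\<phi> # \<Gamma>)" for \<phi> \<Gamma>
  proof (cases "\<exists>\<phi>'. \<phi> = Ex \<phi>'")
    case True
    then obtain \<phi>' where [simp]: "\<phi> = Ex \<phi>'" by auto
    let ?n = "fresh (\<phi> # \<Gamma>)" and ?\<Delta> = "map neg (\<phi> # \<Gamma>)"
    have wf: "wf_fm \<phi>'" "list_all wf_fm \<Gamma>" using ok by (auto simp: ok_def)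
    have "\<not> derivable T (inst (neg \<phi>') [Var ?n] # ?\<Delta>)"
    proof
      assume "derivable T (inst (neg \<phi>') [Var ?n] # ?\<Delta>)"
      then have "derivable T (All (neg \<phi>') # ?\<Delta>)"
        by (rule derivable_generalize[OF _ T]) (use fresh[of "\<phi> # \<Gamma>"] in auto)
      then have "derivable T ?\<Delta>"
        by (rule derivable.Weak) (use wf in \<open>auto simp: list.pred_map list_all_iff\<close>)
      then show False using ok by (simp add: ok_def)
    qed
    then show ?thesis using wf by (auto simp: ok_def wit_def wf_inst)
  next
    case False
    then have "wit (\<phi> # \<Gamma>) = \<phi> # \<Gamma>" by (cases \<phi>) (auto simp: wit_def)
    then show ?thesis using ok by simp
  qed
  have ok_stage: "ok (stage k)" for k
    by (induction k) (use \<chi> ok_wit in \<open>auto simp: stage_0 stage_Suc ok_def[of "[neg \<chi>]"]\<close>)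
  have mono_Suc: "set (stage k) \<subseteq> set (stage (Suc k))" for k
    using set_wit[of "from_nat k # stage k"] by (auto simp: stage_Suc)
  have mono: "set (stage k) \<subseteq> set (stage l)" if "k \<le> l" for k l
    using that by (rule lift_Suc_mono_le[of "\<lambda>k. set (stage k)", OF mono_Suc])
  define H where "H = (\<Union>k. set (stage k))"
  have finite_H: "\<exists>k. A \<subseteq> set (stage k)" if "finite A" "A \<subseteq> H" for A
    using that
  proof (induction A)
    case (insert \<phi> A)
    then obtain k l where "A \<subseteq> set (stage k)" "\<phi> \<in> set (stage l)" by (auto simp: H_def)
    then have "insert \<phi> A \<subseteq> set (stage (max k l))"
      using mono[of k "max k l"] mono[of l "max k l"] by auto
    then show ?case by blast
  qed simp
  have inconsistent: False if d: "derivable T (map neg \<Gamma>)" and sub: "set \<Gamma> \<subseteq> H" for \<Gamma>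
  proof -
    obtain k where k: "set \<Gamma> \<subseteq> set (stage k)" using finite_H[OF _ sub] by auto
    have "derivable T (map neg (stage k))"
      by (rule derivable.Weak[OF d]) (use k ok_stage[of k] in \<open>auto simp: ok_def list_all_iff\<close>)
    then show False using ok_stage[of k] by (simp add: ok_def)
  qed
  have stage_H: "set (stage k) \<subseteq> H" for k by (auto simp: H_def)
  have added: "\<phi> \<in> H \<or> derivable T (neg \<phi> # map neg (stage (to_nat \<phi>)))" if "wf_fm \<phi>" for \<phi>
  proof (cases "ok (\<phi> # stage (to_nat \<phi>))")
    case True
    then have "\<phi> \<in> set (stage (Suc (to_nat \<phi>)))"
      using set_wit[of "\<phi> # stage (to_nat \<phi>)"] by (auto simp: stage_Suc)
    then show ?thesis using stage_H by blast
  next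
    case False
    then show ?thesis using ok_stage[of "to_nat \<phi>"] that by (auto simp: ok_def)
  qed
  have "henkin T H"
  proof
    show "wf_fm \<phi>" if "\<phi> \<in> H" for \<phi>
      using that ok_stage by (auto simp: H_def ok_def list_all_iff)
    show "\<not> derivable T (map neg \<Gamma>)" if "set \<Gamma> \<subseteq> H" for \<Gamma>
      using inconsistent that by blast
    show "\<phi> \<in> H \<or> neg \<phi> \<in> H" if wf: "wf_fm \<phi>" for \<phi>
    proof (rule ccontr)
      let ?k = "max (to_nat \<phi>) (to_nat (neg \<phi>))"
      assume "\<not> ?thesis"
      then have d: "derivable T (neg \<phi> # map neg (stage (to_nat \<phi>)))"
          "derivable T (\<phi> # map neg (stage (to_nat (neg \<phi>))))"
        using added[of \<phi>] added[of "neg \<phi>"] wf by auto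
      have "derivable T (neg \<phi> # map neg (stage ?k))"
        by (rule derivable.Weak[OF d(1)])
          (use mono[of "to_nat \<phi>" ?k] ok_stage[of ?k] wf in \<open>auto simp: ok_def list_all_iff\<close>)
      moreover have "derivable T (\<phi> # map neg (stage ?k))"
        by (rule derivable.Weak[OF d(2)])
          (use mono[of "to_nat (neg \<phi>)" ?k] ok_stage[of ?k] wf in \<open>auto simp: ok_def list_all_iff\<close>)
      ultimately have "derivable T (map neg (stage ?k))" by (metis derivable.Cut)
      then show False using inconsistent stage_H by blast
    qed
    show "\<exists>n. inst \<phi> [Var n] \<in> H" if exH: "Ex \<phi> \<in> H" for \<phi>
    proof -
      \<comment> \<open>\<open>Ex \<phi>\<close> may have entered \<open>H\<close> at another stage,
        for instance as a witness instance. A witness is certainly added when its own number comes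
        up: there it passes the consistency test because it belongs to \<open>H\<close>.\<close>
      let ?k = "to_nat (Ex \<phi>)"
      obtain l where l: "Ex \<phi> \<in> set (stage l)" using exH by (auto simp: H_def)
      have "ok (Ex \<phi> # stage ?k)"
      proof (rule ccontr)
        assume "\<not> ?thesis"
        moreover have "wf_fm (Ex \<phi>)" using l ok_stage[of l] by (auto simp: ok_def list_all_iff)
        ultimately have "derivable T (map neg (Ex \<phi> # stage ?k))"
          using ok_stage[of ?k] by (auto simp: ok_def)
        then show False by (rule inconsistent) (use exH stage_H in auto)
      qed
      then have "inst \<phi> [Var (fresh (Ex \<phi> # stage ?k))] \<in> set (stage (Suc ?k))"
        by (simp add: stage_Suc wit_def)
      then show ?thesis using stage_H by blast
    qed
  qed
  moreover have "neg \<chi> \<in> H" using stage_H[of 0] by (simp add: stage_0)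
  ultimately show ?thesis by blast
qed

text \<open>Testing validity on the single carrier \<open>nat\<close> suffices because the Henkin
  model is countable and, by the three named axioms, infinite: its elements can be numbered by all
  natural numbers.\<close>

theorem completeness:
  assumes T: "regularity \<in> T" "defining_axiom Zero \<in> T" "defining_axiom Adj \<in> T"
    and closed: "\<forall>\<phi>\<in>T. wf_fm \<phi> \<and> fv \<phi> = {}"
    and \<chi>: "wf_fm \<chi>"
    and valid: "\<And>(E :: nat \<Rightarrow> nat \<Rightarrow> bool) F e.
      (\<And>\<phi> e. \<phi> \<in> T \<Longrightarrow> sat E F UNIV e \<phi>) \<Longrightarrow> sat E F UNIV e \<chi>"
  shows "T \<turnstile> \<chi>"
proof (rule ccontr)
  assume "\<not> T \<turnstile> \<chi>"
  then obtain H where "henkin T H" and H: "neg \<chi> \<in> H"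
    using ex_henkin[of T \<chi>] closed \<chi> by (auto simp: proves_def)
  interpret henkin T H by fact
  \<comment> \<open>The class of a term is recorded by the variables equal to it. By
    \<open>term_variable_H\<close> it is nonempty for well-formed terms, so equal sets of variables
    force equal terms.\<close>
  define cls where "cls t = {n. Eq t (Var n) \<in> H}" for t
  have cls: "cls s = cls t \<longleftrightarrow> Eq s t \<in> H" if "wf_trm s" "wf_trm t" for s t
  proof
    assume "cls s = cls t"
    moreover obtain n where "Eq s (Var n) \<in> H" using term_variable_H \<open>wf_trm s\<close> by blast
    ultimately have "Eq s (Var n) \<in> H" "Eq t (Var n) \<in> H" by (auto simp: cls_def)
    then show "Eq s t \<in> H" using Eq_sym_H Eq_trans_H that by (meson wf_trm.simps(1))
  next
    assume "Eq s t \<in> H"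
    moreover from this have "Eq t s \<in> H" by (rule Eq_sym_H[OF that])
    ultimately have "Eq s (Var n) \<in> H \<longleftrightarrow> Eq t (Var n) \<in> H" for n
      using Eq_trans_H[OF that, of "Var n"] Eq_trans_H[OF that(2,1), of "Var n"] by fastforce
    then show "cls s = cls t" by (simp add: cls_def)
  qed
  let ?Q = "range (\<lambda>n. cls (Var n))"
  have Q: "infinite ?Q" "countable ?Q" using infinite_range[OF cls T closed] by auto
  define c where "c t = to_nat_on ?Q (cls t)" for t
  have clsQ: "cls t \<in> ?Q" if "wf_trm t" for t using c_in_range[OF cls that] .
  have c: "c s = c t \<longleftrightarrow> Eq s t \<in> H" if "wf_trm s" "wf_trm t" for s t
    using cls[OF that] clsQ that Q unfolding c_def by (simp add: to_nat_on_inj)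
  have surj: "range (\<lambda>n. c (Var n)) = UNIV"
  proof -
    have "range (\<lambda>n. c (Var n)) = to_nat_on ?Q ` ?Q" by (auto simp: c_def image_image)
    then show ?thesis using to_nat_on_infinite[OF Q(2,1)] by (simp add: bij_betw_def)
  qed
  have sat: "sat (memH c) (funH c) UNIV (\<lambda>i. c (Var i)) \<phi> \<longleftrightarrow> \<phi> \<in> H" if "wf_fm \<phi>" for \<phi>
    using sat_H[OF c, of Var \<phi>] that surj by simp
  have "sat (memH c) (funH c) UNIV e \<phi>" if "\<phi> \<in> T" for e \<phi>
    using sat[of \<phi>] axiom_H[of \<phi>] sat_cong[of \<phi> e "\<lambda>i. c (Var i)"] that closed by auto
  then have "sat (memH c) (funH c) UNIV (\<lambda>i. c (Var i)) \<chi>" by (rule valid)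
  then show False using sat[OF \<chi>] H neg_H[OF \<chi>] by simp
qed

section \<open>Models of primitive recursive set theory\<close>

locale prs_model =
  fixes E :: "'a \<Rightarrow> 'a \<Rightarrow> bool" (infix "\<epsilon>" 50) and F :: "psf \<Rightarrow> 'a list \<Rightarrow> 'a"
  assumes PRS: "\<phi> \<in> PRS \<Longrightarrow> sat E F UNIV e \<phi>"
begin

abbreviation emp :: 'a where "emp \<equiv> F Zero []"
abbreviation om :: 'a where "om \<equiv> F Omega []"
abbreviation ins :: "'a \<Rightarrow> 'a \<Rightarrow> 'a" where "ins x y \<equiv> F Adj [x, y]"
abbreviation upr :: "'a \<Rightarrow> 'a \<Rightarrow> 'a" where "upr x y \<equiv> ins (ins emp x) y"
abbreviation one :: 'a where "one \<equiv> ins emp emp"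

lemma defining_axiom: "wf_psf f \<Longrightarrow> sat E F UNIV e (defining_axiom f)"
  by (rule PRS) (auto simp: PRS_def)

lemma ext: "(\<And>x. x \<epsilon> a \<longleftrightarrow> x \<epsilon> b) \<Longrightarrow> a = b"
  using PRS[of extensionality undefined] by (simp add: PRS_def extensionality_def)

lemma not_in_emp [simp]: "\<not> x \<epsilon> emp"
  using defining_axiom[of Zero undefined] by simp

lemma in_ins [simp]: "u \<epsilon> ins x y \<longleftrightarrow> u \<epsilon> x \<or> u = y"
  using defining_axiom[of Adj undefined] by (simp add: Alls_def numeral_3_eq_3)

lemma nonempty: "a \<noteq> emp \<longleftrightarrow> (\<exists>x. x \<epsilon> a)"
  using ext[of a emp] by auto

lemma regular: "x \<epsilon> a \<Longrightarrow> \<exists>y. y \<epsilon> a \<and> (\<forall>z. z \<epsilon> a \<longrightarrow> \<not> z \<epsilon> y)"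
  using PRS[of regularity undefined] nonempty[of a] by (auto simp: PRS_def regularity_def)

lemma mem_irrefl: "\<not> x \<epsilon> x"
  using regular[of x "ins emp x"] by auto

lemma sat_Alls_UNIV: "sat E F UNIV (\<lambda>i. e (n + i)) (Alls n \<phi>) \<Longrightarrow> sat E F UNIV e \<phi>"
  by (auto simp: sat_Alls)

lemma cond: "F Cond [x, y, u, v] = (if u \<epsilon> v then x else y)"
proof -
  let ?e = "case_nat x (case_nat y (case_nat u (\<lambda>_. v)))"
  have "sat E F UNIV ?e (And
       (Imp (Mem (Var 2) (Var 3)) (Eq (Fn Cond [Var 0, Var 1, Var 2, Var 3]) (Var 0)))
       (Imp (NMem (Var 2) (Var 3)) (Eq (Fn Cond [Var 0, Var 1, Var 2, Var 3]) (Var 1))))"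
    by (rule sat_Alls_UNIV[where n = 4]) (rule defining_axiom[of Cond, unfolded defining_axiom.simps], simp)
  then show ?thesis by simp
qed

lemma proj: "i < n \<Longrightarrow> F (Proj n i) (map e [0..<n]) = e i"
  using defining_axiom[of "Proj n i" "\<lambda>i. e (n + i)"] by (auto simp: sat_Alls o_def)

lemma comp:
  assumes "wf_psf (Comp n g hs)"
  shows "F (Comp n g hs) (map e [0..<n]) = F g (map (\<lambda>h. F h (map e [0..<n])) hs)"
  using defining_axiom[OF assms, of "\<lambda>i. e (n + i)"] by (auto simp: sat_Alls o_def)

lemma rec:
  assumes "wf_psf g" "arity g = Suc n" "0 < n"
  shows "\<exists>w. (\<forall>v. v \<epsilon> w \<longleftrightarrow> (\<exists>u. u \<epsilon> e 0 \<and> v \<epsilon> F (Rec g) (u # map e [1..<n]))) \<and>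
             F (Rec g) (map e [0..<n]) = F g (w # map e [0..<n])"
proof -
  \<comment> \<open>Three bound variables \<open>u\<close>, \<open>v\<close>, \<open>w\<close>
    precede the arguments here, so \<open>e 0\<close> has index 3 and the fixed arguments start at
    index 4.\<close>
  have 1: "map (\<lambda>i. case_nat a (case_nat b (case_nat c e)) i) [4..<n + 3] = map e [1..<n]" for a b c
    by (rule nth_equalityI; simp del: upt_Suc; simp add: numeral_eq_Suc)
  have 2: "map (case_nat a e) [1..<n + 1] = map e [0..<n]" for a
    by (rule nth_equalityI) (auto simp del: upt_Suc)
  have 3: "map (case_nat a e) [0..<n + 1] = a # map e [0..<n]" for a
    by (rule nth_equalityI) (auto simp del: upt_Suc simp: nth_Cons split: nat.split)
  have "sat E F UNIV (\<lambda>i. e (n + i)) (defining_axiom (Rec g))"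
    by (rule defining_axiom) (use assms in simp)
  then have "\<forall>e'. (\<forall>i. e' (n + i) = e (n + i)) \<longrightarrow> sat E F UNIV e' (Ex (And
        (All (Iff (Mem (Var 0) (Var 1))
                  (BEx (Var 2) (Mem (Var 1) (Fn (Rec g) (Var 0 # map Var [4..<n + 3]))))))
        (Eq (Fn (Rec g) (map Var [1..<n + 1])) (Fn g (map Var [0..<n + 1])))))"
    using assms by (simp add: sat_Alls Let_def del: sat.simps sat_Iff sat_BEx upt_Suc)
  then have "sat E F UNIV e (Ex (And
        (All (Iff (Mem (Var 0) (Var 1))
                  (BEx (Var 2) (Mem (Var 1) (Fn (Rec g) (Var 0 # map Var [4..<n + 3]))))))
        (Eq (Fn (Rec g) (map Var [1..<n + 1])) (Fn g (map Var [0..<n + 1])))))" by blast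
  then show ?thesis
    unfolding sat.simps sat_Iff sat_BEx val.simps list.map map_map o_def 1 2 3
    by (simp add: numeral_2_eq_2)
qed


subsection \<open>Primitive recursive functions and predicates\<close>

text \<open>Having a function symbol in every large enough arity makes it easy to pass to a common arity.\<close>

definition PRF :: "((nat \<Rightarrow> 'a) \<Rightarrow> 'a) \<Rightarrow> bool" where
  "PRF f \<longleftrightarrow> (\<exists>m. \<forall>n\<ge>m. \<exists>p. wf_psf p \<and> arity p = n \<and> (\<forall>e. F p (map e [0..<n]) = f e))"

lemma PRF_var: "PRF (\<lambda>e. e i)"
  unfolding PRF_def
proof (intro exI[of _ "Suc i"] allI impI)
  fix n assume "Suc i \<le> n"
  then show "\<exists>p. wf_psf p \<and> arity p = n \<and> (\<forall>e. F p (map e [0..<n]) = e i)"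
    using proj[of i n] by (intro exI[of _ "Proj n i"]) auto
qed

lemma PRF_fun:
  assumes "wf_psf g" "length hs = arity g" "\<And>h. h \<in> set hs \<Longrightarrow> PRF h"
  shows "PRF (\<lambda>e. F g (map (\<lambda>h. h e) hs))"
proof -
  have "\<exists>m. \<forall>n\<ge>m. \<forall>h\<in>set hs. \<exists>p. wf_psf p \<and> arity p = n \<and> (\<forall>e. F p (map e [0..<n]) = h e)"
    using assms(3)
  proof (induction hs)
    case (Cons h hs)
    then obtain m where m: "\<forall>n\<ge>m. \<forall>h\<in>set hs.
        \<exists>p. wf_psf p \<and> arity p = n \<and> (\<forall>e. F p (map e [0..<n]) = h e)" by auto
    obtain m' where m': "\<forall>n\<ge>m'. \<exists>p. wf_psf p \<and> arity p = n \<and> (\<forall>e. F p (map e [0..<n]) = h e)"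
      using Cons.prems[of h] by (auto simp: PRF_def)
    show ?case by (rule exI[of _ "max m m'"]) (use m m' in auto)
  qed simp
  then obtain m where m: "\<forall>n\<ge>m. \<forall>h\<in>set hs.
      \<exists>p. wf_psf p \<and> arity p = n \<and> (\<forall>e. F p (map e [0..<n]) = h e)" by blast
  show ?thesis
    unfolding PRF_def
  proof (intro exI[of _ m] allI impI)
    fix n assume "m \<le> n"
    with m obtain p where p: "wf_psf (p h)" "arity (p h) = n" "F (p h) (map e [0..<n]) = h e"
      if "h \<in> set hs" for h e by metis
    let ?q = "Comp n g (map p hs)"
    have wf: "wf_psf ?q" using assms p by (auto simp: list_all_iff)
    have "F ?q (map e [0..<n]) = F g (map (\<lambda>h. h e) hs)" for e
      using comp[OF wf, of e] p(3) by (auto simp: o_def cong: map_cong)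
    then show "\<exists>q. wf_psf q \<and> arity q = n \<and> (\<forall>e. F q (map e [0..<n]) = F g (map (\<lambda>h. h e) hs))"
      using wf by (intro exI[of _ ?q]) auto
  qed
qed

text \<open>A primitive recursive \<open>f\<close> depends on finitely many places of
  \<open>e\<close> only, so all places can be substituted simultaneously.\<close>

lemma PRF_subst:
  assumes "PRF f" "\<And>i. PRF (g i)"
  shows "PRF (\<lambda>e. f (\<lambda>i. g i e))"
proof -
  obtain n p where p: "wf_psf p" "arity p = n" "\<And>e. F p (map e [0..<n]) = f e"
    using assms(1) by (auto simp: PRF_def)
  have "PRF (\<lambda>e. F p (map (\<lambda>h. h e) (map g [0..<n])))"
    by (rule PRF_fun) (use p assms(2) in auto)
  moreover have "F p (map (\<lambda>h. h e) (map g [0..<n])) = f (\<lambda>i. g i e)" for e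
    using p(3)[of "\<lambda>i. g i e"] by (simp add: o_def)
  ultimately show ?thesis by simp
qed

lemma PRF_emp: "PRF (\<lambda>e. emp)"
  using PRF_fun[of Zero "[]"] by simp

lemma PRF_ins: "PRF f \<Longrightarrow> PRF g \<Longrightarrow> PRF (\<lambda>e. ins (f e) (g e))"
  using PRF_fun[of Adj "[f, g]"] by auto

lemma PRF_cond:
  "PRF f \<Longrightarrow> PRF g \<Longrightarrow> PRF h \<Longrightarrow> PRF k \<Longrightarrow> PRF (\<lambda>e. if h e \<epsilon> k e then f e else g e)"
  using PRF_fun[of Cond "[f, g, h, k]"] by (auto simp: cond)

definition is_set :: "('a \<Rightarrow> bool) \<Rightarrow> bool" where
  "is_set P \<longleftrightarrow> (\<exists>b. \<forall>v. v \<epsilon> b \<longleftrightarrow> P v)"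

definition coll :: "('a \<Rightarrow> bool) \<Rightarrow> 'a" where
  "coll P = (THE b. \<forall>v. v \<epsilon> b \<longleftrightarrow> P v)"

lemma coll_eq: "(\<And>v. v \<epsilon> b \<longleftrightarrow> P v) \<Longrightarrow> coll P = b"
  unfolding coll_def by (rule the_equality) (auto intro: ext)

lemma in_coll: "is_set P \<Longrightarrow> v \<epsilon> coll P \<longleftrightarrow> P v"
  unfolding is_set_def using coll_eq by fastforce

lemma PRF_coll_witness:
  assumes "PRF g" "\<And>e v. v \<epsilon> g e \<longleftrightarrow> P e v"
  shows "PRF (\<lambda>e. coll (P e))" "is_set (P e)"
proof -
  have "coll (P e) = g e" for e by (rule coll_eq) (rule assms(2))
  then show "PRF (\<lambda>e. coll (P e))" using assms(1) by simp
  show "is_set (P e)" using assms(2) by (auto simp: is_set_def)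
qed

text \<open>
  The recursion \<open>R(z, y, e) = (if z \<epsilon> y then h(z, e) else \<Union>u\<epsilon>z. R(u, y, e))\<close> turns the union over
  values of \<open>R\<close> itself into a union over values of \<open>h\<close>, by taking \<open>z = y\<close>.
\<close>

lemma PRF_Union_witness:
  assumes f: "PRF f" and h: "PRF (\<lambda>e. h (e 0) (\<lambda>i. e (Suc i)))"
  shows "\<exists>g. PRF g \<and> (\<forall>e v. v \<epsilon> g e \<longleftrightarrow> (\<exists>u. u \<epsilon> f e \<and> v \<epsilon> h u e))"
proof -
  \<comment> \<open>Argument places of the step function: 0 holds the union of the earlier values, 1
    the recursion variable \<open>z\<close>, 2 the set \<open>y\<close>, and the places from 3 on
    hold \<open>e\<close>.\<close>
  let ?k = "\<lambda>i e. case i of 0 \<Rightarrow> e 1 | Suc i \<Rightarrow> e (i + 3)"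
  have "PRF (?k i)" for i by (cases i) (auto simp: PRF_var)
  from PRF_subst[OF h, of ?k, OF this]
  have "PRF (\<lambda>e. h (e 1) (\<lambda>i. e (i + 3)))" by simp
  then have "PRF (\<lambda>e. if e 1 \<epsilon> e 2 then h (e 1) (\<lambda>i. e (i + 3)) else e 0)"
    by (intro PRF_cond PRF_var)
  then obtain m where m: "\<forall>n\<ge>m. \<exists>q. wf_psf q \<and> arity q = n \<and>
      (\<forall>e. F q (map e [0..<n]) = (if e 1 \<epsilon> e 2 then h (e 1) (\<lambda>i. e (i + 3)) else e 0))"
    by (auto simp: PRF_def)
  define n where "n = max m 2"
  obtain q where q: "wf_psf q" "arity q = Suc n"
      "\<And>e. F q (map e [0..<Suc n]) = (if e 1 \<epsilon> e 2 then h (e 1) (\<lambda>i. e (i + 3)) else e 0)"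
    using m[rule_format, of "Suc n"] le_SucI[OF max.cobounded1[of m 2], folded n_def] by blast
  have n: "2 \<le> n" by (simp add: n_def)
  have Cons: "map (case_nat w e) [0..<Suc k] = w # map e [0..<k]" for w k and e :: "nat \<Rightarrow> 'a"
    by (rule nth_equalityI) (auto simp del: upt_Suc simp: nth_Cons split: nat.split)
  have R: "\<exists>w. (\<forall>v. v \<epsilon> w \<longleftrightarrow> (\<exists>u. u \<epsilon> e 0 \<and> v \<epsilon> F (Rec q) (u # map e [1..<n]))) \<and>
      F (Rec q) (map e [0..<n]) = (if e 0 \<epsilon> e 1 then h (e 0) (\<lambda>i. e (i + 2)) else w)" for e
  proof -
    obtain w where w: "\<forall>v. v \<epsilon> w \<longleftrightarrow> (\<exists>u. u \<epsilon> e 0 \<and> v \<epsilon> F (Rec q) (u # map e [1..<n]))"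
        "F (Rec q) (map e [0..<n]) = F q (w # map e [0..<n])"
      using rec[OF q(1,2), of e] n by auto
    have "F q (w # map e [0..<n]) = (if e 0 \<epsilon> e 1 then h (e 0) (\<lambda>i. e (i + 2)) else w)"
      using q(3)[of "case_nat w e"] unfolding Cons by (simp add: numeral_eq_Suc)
    with w show ?thesis by auto
  qed
  let ?E = "\<lambda>e. case_nat (f e) (case_nat (f e) e)"
  let ?g = "\<lambda>e. F (Rec q) (map (?E e) [0..<n])"
  have "PRF (\<lambda>e. ?E e i)" for i
    by (cases i; cases "i - 1") (auto simp: f PRF_var)
  then have "PRF (\<lambda>e. F (Rec q) (map (\<lambda>h. h e) (map (\<lambda>i e. ?E e i) [0..<n])))"
    by (intro PRF_fun) (use q n in auto)
  then have g: "PRF ?g" by (simp add: o_def)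
  have "v \<epsilon> ?g e \<longleftrightarrow> (\<exists>u. u \<epsilon> f e \<and> v \<epsilon> h u e)" for e v
  proof -
    have tail: "u # map (?E e) [1..<n] = map (case_nat u (case_nat (f e) e)) [0..<n]" for u
      by (rule nth_equalityI) (use n in \<open>auto simp: nth_Cons split: nat.split\<close>)
    have val: "F (Rec q) (u # map (?E e) [1..<n]) = h u e" if "u \<epsilon> f e" for u
      using R[of "case_nat u (case_nat (f e) e)"] that unfolding tail by auto
    \<comment> \<open>For \<open>z = y\<close> the test \<open>z \<epsilon> y\<close> fails by
      irreflexivity, which leaves the union over all \<open>u \<epsilon> y\<close>, and for these
      the test succeeds.\<close>
    have "v \<epsilon> ?g e \<longleftrightarrow> (\<exists>u. u \<epsilon> f e \<and> v \<epsilon> F (Rec q) (u # map (?E e) [1..<n]))"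
      using R[of "?E e"] mem_irrefl[of "f e"] by auto
    then show ?thesis using val by auto
  qed
  with g show ?thesis by blast
qed

lemma PRF_Union:
  assumes "PRF f" "PRF (\<lambda>e. h (e 0) (\<lambda>i. e (Suc i)))"
  shows "PRF (\<lambda>e. coll (\<lambda>v. \<exists>u. u \<epsilon> f e \<and> v \<epsilon> h u e))" "is_set (\<lambda>v. \<exists>u. u \<epsilon> f e \<and> v \<epsilon> h u e)"
proof -
  obtain g where g: "PRF g" "\<forall>e v. v \<epsilon> g e \<longleftrightarrow> (\<exists>u. u \<epsilon> f e \<and> v \<epsilon> h u e)"
    using PRF_Union_witness[where h = h, OF assms] by blast
  show "PRF (\<lambda>e. coll (\<lambda>v. \<exists>u. u \<epsilon> f e \<and> v \<epsilon> h u e))" "is_set (\<lambda>v. \<exists>u. u \<epsilon> f e \<and> v \<epsilon> h u e)"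
    using PRF_coll_witness[OF g(1), of "\<lambda>e v. \<exists>u. u \<epsilon> f e \<and> v \<epsilon> h u e"] g(2) by auto
qed

section \<open>Primitive recursive predicates and separation\<close>

definition PRP :: "((nat \<Rightarrow> 'a) \<Rightarrow> bool) \<Rightarrow> bool" where
  "PRP P \<longleftrightarrow> PRF (\<lambda>e. if P e then one else emp)"

lemma PRF_one: "PRF (\<lambda>e. one)"
  by (intro PRF_ins PRF_emp)

lemma PRF_If:
  assumes "PRP P" "PRF f" "PRF g"
  shows "PRF (\<lambda>e. if P e then f e else g e)"
proof -
  have "emp \<epsilon> (if P e then one else emp) \<longleftrightarrow> P e" for e by simp
  then show ?thesis
    using PRF_cond[OF assms(2,3) PRF_emp assms(1)[unfolded PRP_def]] by (simp only:)
qed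

lemma PRP_mem: "PRF f \<Longrightarrow> PRF g \<Longrightarrow> PRP (\<lambda>e. f e \<epsilon> g e)"
  unfolding PRP_def by (intro PRF_cond PRF_one PRF_emp)

lemma PRP_eq: "PRF f \<Longrightarrow> PRF g \<Longrightarrow> PRP (\<lambda>e. f e = g e)"
  using PRP_mem[of f "\<lambda>e. ins emp (g e)"] by (simp add: PRF_ins PRF_emp)

lemma if_not: "(if \<not> b then x else y) = (if b then y else x)"
  by simp

lemma PRP_not: "PRP P \<Longrightarrow> PRP (\<lambda>e. \<not> P e)"
  using PRF_If[of P "\<lambda>e. emp" "\<lambda>e. one"] PRF_one PRF_emp
  unfolding PRP_def if_not by blast

lemma PRP_conj:
  assumes "PRP P" "PRP Q"
  shows "PRP (\<lambda>e. P e \<and> Q e)"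
proof -
  have "PRF (\<lambda>e. if P e then if Q e then one else emp else emp)"
    using assms by (intro PRF_If PRF_one PRF_emp)
  moreover have "(if P e then if Q e then one else emp else emp) = (if P e \<and> Q e then one else emp)" for e
    by simp
  ultimately show ?thesis by (simp add: PRP_def)
qed

lemma PRP_disj: "PRP P \<Longrightarrow> PRP Q \<Longrightarrow> PRP (\<lambda>e. P e \<or> Q e)"
  using PRP_not[OF PRP_conj[of "\<lambda>e. \<not> P e" "\<lambda>e. \<not> Q e"]] by (simp add: PRP_not)

lemma PRP_subst: "PRP P \<Longrightarrow> (\<And>i. PRF (g i)) \<Longrightarrow> PRP (\<lambda>e. P (\<lambda>i. g i e))"
  unfolding PRP_def by (rule PRF_subst)

lemma PRP_rename: "PRP P \<Longrightarrow> PRP (\<lambda>e. P (\<lambda>i. e (\<rho> i)))"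
  by (erule PRP_subst) (rule PRF_var)

text \<open>The union of the truth values over \<open>f e\<close> contains \<open>emp\<close>
  exactly if one of them is \<open>one\<close>; bounded quantifiers thus reduce to
  \<open>PRF_Union\<close>.\<close>

lemma PRP_bex:
  assumes "PRF f" "PRP (\<lambda>e. P (e 0) (\<lambda>i. e (Suc i)))"
  shows "PRP (\<lambda>e. \<exists>u. u \<epsilon> f e \<and> P u e)"
proof -
  let ?h = "\<lambda>u e. if P u e then one else emp"
  have U: "PRF (\<lambda>e. coll (\<lambda>v. \<exists>u. u \<epsilon> f e \<and> v \<epsilon> ?h u e))"
      "is_set (\<lambda>v. \<exists>u. u \<epsilon> f e \<and> v \<epsilon> ?h u e)" for e
    using PRF_Union[where h = ?h, OF assms(1)] assms(2) unfolding PRP_def by auto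
  have "PRP (\<lambda>e. emp \<epsilon> coll (\<lambda>v. \<exists>u. u \<epsilon> f e \<and> v \<epsilon> ?h u e))"
    by (rule PRP_mem[OF PRF_emp U(1)])
  moreover have "emp \<epsilon> coll (\<lambda>v. \<exists>u. u \<epsilon> f e \<and> v \<epsilon> ?h u e) \<longleftrightarrow> (\<exists>u. u \<epsilon> f e \<and> P u e)" for e
    unfolding in_coll[OF U(2)] by auto
  ultimately show ?thesis by simp
qed

lemma PRP_ball:
  assumes "PRF f" "PRP (\<lambda>e. P (e 0) (\<lambda>i. e (Suc i)))"
  shows "PRP (\<lambda>e. \<forall>u. u \<epsilon> f e \<longrightarrow> P u e)"
  using PRP_not[OF PRP_bex[OF assms(1), of "\<lambda>u e. \<not> P u e"]] assms(2) by (simp add: PRP_not)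

lemma PRF_image:
  assumes "PRF f" "PRF (\<lambda>e. h (e 0) (\<lambda>i. e (Suc i)))"
  shows "PRF (\<lambda>e. coll (\<lambda>v. \<exists>u. u \<epsilon> f e \<and> v = h u e))" "is_set (\<lambda>v. \<exists>u. u \<epsilon> f e \<and> v = h u e)"
  using PRF_Union[OF assms(1), of "\<lambda>u e. ins emp (h u e)"] assms(2)
  by (simp_all add: PRF_ins PRF_emp)

text \<open>The set is a union of singletons and empty sets. This covers primitive recursive
  predicates; the theory has no separation axiom for arbitrary formulas.\<close>

lemma separation:
  assumes "PRP (\<lambda>e. P (e 0) (\<lambda>i. e (Suc i)))"
  shows "is_set (\<lambda>v. v \<epsilon> a \<and> P v d)"
proof -
  let ?h = "\<lambda>u e. if P u (\<lambda>i. e (Suc i)) then ins emp u else emp"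
  let ?\<rho> = "\<lambda>i. case i of 0 \<Rightarrow> 0 | Suc i \<Rightarrow> Suc (Suc i)"
  have "PRP (\<lambda>e. P (e (?\<rho> 0)) (\<lambda>i. e (?\<rho> (Suc i))))"
    by (rule PRP_rename[OF assms])
  then have "PRF (\<lambda>e. ?h (e 0) (\<lambda>i. e (Suc i)))"
    by (intro PRF_If PRF_ins PRF_emp PRF_var) simp
  from PRF_Union(2)[where h = ?h, OF PRF_var[of 0] this, of "case_nat a d"]
  have "is_set (\<lambda>v. \<exists>u. u \<epsilon> a \<and> v \<epsilon> (if P u d then ins emp u else emp))" by simp
  moreover have "(\<lambda>v. \<exists>u. u \<epsilon> a \<and> v \<epsilon> (if P u d then ins emp u else emp)) = (\<lambda>v. v \<epsilon> a \<and> P v d)"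
    by (auto simp: fun_eq_iff split: if_splits)
  ultimately show ?thesis by simp
qed

text \<open>Regularity applied to the set cut out by \<open>P\<close>. It does the work of
  \<in>-induction wherever the predicate is primitive recursive.\<close>

lemma minimal:
  assumes "PRP (\<lambda>e. P (e 0) (\<lambda>i. e (Suc i)))" "x \<epsilon> a" "P x d"
  shows "\<exists>y. y \<epsilon> a \<and> P y d \<and> (\<forall>z. z \<epsilon> a \<longrightarrow> P z d \<longrightarrow> \<not> z \<epsilon> y)"
proof -
  obtain b where b: "\<And>v. v \<epsilon> b \<longleftrightarrow> v \<epsilon> a \<and> P v d"
    using separation[of P, OF assms(1)] unfolding is_set_def by blast
  then show ?thesis using regular[of x b] assms by auto
qed

text \<open>Relativized to a set, all quantifiers of \<phi> become bounded, whatever its complexity;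
  hence the counterexamples inside a reflecting set can be separated. The map \<rho> tells where in
  \<open>e\<close> the values of the variables are found.\<close>

lemma PRP_sat:
  assumes "set_fm \<phi>"
  shows "PRP (\<lambda>e. sat E F {x. x \<epsilon> e k} (\<lambda>i. e (\<rho> i)) \<phi>)"
  using assms
proof (induction \<phi> arbitrary: k \<rho>)
  case (Mem s t)
  then show ?case by (cases s; cases t) (auto intro: PRP_mem PRF_var)
next
  case (NMem s t)
  then show ?case by (cases s; cases t) (auto intro!: PRP_not PRP_mem PRF_var)
next
  case (Eq s t)
  then show ?case by (cases s; cases t) (auto intro: PRP_eq PRF_var)
next
  case (NEq s t)
  then show ?case by (cases s; cases t) (auto intro!: PRP_not PRP_eq PRF_var)
next
  case (And \<phi> \<psi>)
  then show ?case by (simp add: PRP_conj)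
next
  case (Or \<phi> \<psi>)
  then show ?case by (simp add: PRP_disj)
next
  case (All \<phi>)
  let ?\<rho> = "case_nat 0 (\<lambda>i. Suc (\<rho> i))"
  have eq: "(\<lambda>i. e (?\<rho> i)) = case_nat (e 0) (\<lambda>i. e (Suc (\<rho> i)))" for e :: "nat \<Rightarrow> 'a"
    by (rule HOL.ext) (simp split: nat.split)
  have "PRP (\<lambda>e. sat E F {x. x \<epsilon> e (Suc k)} (\<lambda>i. e (?\<rho> i)) \<phi>)"
    by (rule All.IH) (use All.prems in simp)
  then have "PRP (\<lambda>e. \<forall>u. u \<epsilon> e k \<longrightarrow> sat E F {x. x \<epsilon> e k} (case_nat u (\<lambda>i. e (\<rho> i))) \<phi>)"
    unfolding eq by (intro PRP_ball PRF_var)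
  then show ?case by simp
next
  case (Ex \<phi>)
  let ?\<rho> = "case_nat 0 (\<lambda>i. Suc (\<rho> i))"
  have eq: "(\<lambda>i. e (?\<rho> i)) = case_nat (e 0) (\<lambda>i. e (Suc (\<rho> i)))" for e :: "nat \<Rightarrow> 'a"
    by (rule HOL.ext) (simp split: nat.split)
  have "PRP (\<lambda>e. sat E F {x. x \<epsilon> e (Suc k)} (\<lambda>i. e (?\<rho> i)) \<phi>)"
    by (rule Ex.IH) (use Ex.prems in simp)
  then have "PRP (\<lambda>e. \<exists>u. u \<epsilon> e k \<and> sat E F {x. x \<epsilon> e k} (case_nat u (\<lambda>i. e (\<rho> i))) \<phi>)"
    unfolding eq by (intro PRP_bex PRF_var)
  then show ?case by simp
qed

end

section \<open>Sigma- and Pi-formulas under negation and renaming\<close>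

lemma sigma_fm_neg: "sigma_fm \<phi> \<Longrightarrow> pi_fm (neg \<phi>)"
  by (induction rule: sigma_fm.induct)
    (auto intro: pi_fm.intros pi_fm.intros(8)[unfolded BEx_def, simplified] simp: BAll_def)

lemma pi_fm_neg: "pi_fm \<phi> \<Longrightarrow> sigma_fm (neg \<phi>)"
  by (induction rule: pi_fm.induct)
    (auto intro: sigma_fm.intros sigma_fm.intros(7)[unfolded BAll_def, simplified] simp: BEx_def)

lemma up_Var_rename: "up (\<lambda>i. Var (\<rho> i)) = (\<lambda>i. Var (case_nat 0 (\<lambda>i. Suc (\<rho> i)) i))"
  by (rule ext) (simp add: up_def split: nat.split)

lemma sigma_fm_rename: "sigma_fm \<phi> \<Longrightarrow> sigma_fm (sb (\<lambda>i. Var (\<rho> i)) \<phi>)"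
  by (induction arbitrary: \<rho> rule: sigma_fm.induct)
    (auto intro: sigma_fm.intros sigma_fm.intros(7)[unfolded BAll_def, simplified]
      simp: BAll_def up_Var_rename)

lemma pi_fm_rename: "pi_fm \<phi> \<Longrightarrow> pi_fm (sb (\<lambda>i. Var (\<rho> i)) \<phi>)"
  by (induction arbitrary: \<rho> rule: pi_fm.induct)
    (auto intro: pi_fm.intros pi_fm.intros(8)[unfolded BEx_def, simplified]
      simp: BEx_def up_Var_rename)

lemma sigma_fm_set_fm: "sigma_fm \<phi> \<Longrightarrow> set_fm \<phi>"
  by (induction rule: sigma_fm.induct) (auto simp: BAll_def)

lemma set_fm_rename: "set_fm \<phi> \<Longrightarrow> set_fm (sb (\<lambda>i. Var (\<rho> i)) \<phi>)"
proof (induction \<phi> arbitrary: \<rho>)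
  case (Mem s t) then show ?case by (cases s; cases t) auto
next
  case (NMem s t) then show ?case by (cases s; cases t) auto
next
  case (Eq s t) then show ?case by (cases s; cases t) auto
next
  case (NEq s t) then show ?case by (cases s; cases t) auto
qed (auto simp: up_Var_rename)

lemma fv_rename: "fv (sb (\<lambda>i. Var (\<rho> i)) \<phi>) \<subseteq> range \<rho>"
proof -
  have trm: "fv_trm (sb_trm (\<lambda>i. Var (\<rho> i)) t) = \<rho> ` fv_trm t" for \<rho> t
    by (induction t) auto
  have "fv (sb (\<lambda>i. Var (\<rho> i)) \<phi>) \<subseteq> \<rho> ` fv \<phi>"
  proof (induction \<phi> arbitrary: \<rho>)
    case (All \<phi>)
    show ?case
      using All.IH[of "case_nat 0 (\<lambda>i. Suc (\<rho> i))"] by (fastforce simp: up_Var_rename split: nat.splits)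
  next
    case (Ex \<phi>)
    show ?case
      using Ex.IH[of "case_nat 0 (\<lambda>i. Suc (\<rho> i))"] by (fastforce simp: up_Var_rename split: nat.splits)
  next
    case (And \<phi> \<psi>)
    show ?case using And.IH[of \<rho>] by (auto simp: image_Un)
  next
    case (Or \<phi> \<psi>)
    show ?case using Or.IH[of \<rho>] by (auto simp: image_Un)
  qed (auto simp: trm image_Un)
  then show ?thesis by auto
qed

context prs_model
begin

subsection \<open>Definable predicates\<close>

text \<open>One formula of both syntactic kinds can fill both places of a \<Delta>-definition.
  \<open>PRP\<close> is carried along so that the same closure rules also yield separation.\<close>

definition D0 :: "((nat \<Rightarrow> 'a) \<Rightarrow> bool) \<Rightarrow> bool" where
  "D0 P \<longleftrightarrow> (\<exists>\<theta>. sigma_fm \<theta> \<and> pi_fm \<theta> \<and> (\<forall>e. sat E F UNIV e \<theta> \<longleftrightarrow> P e)) \<and> PRP P"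

lemma D0I:
  "sigma_fm \<theta> \<Longrightarrow> pi_fm \<theta> \<Longrightarrow> (\<And>e. sat E F UNIV e \<theta> \<longleftrightarrow> P e) \<Longrightarrow> PRP P \<Longrightarrow> D0 P"
  unfolding D0_def by blast

lemma D0_PRP: "D0 P \<Longrightarrow> PRP P"
  by (simp add: D0_def)

lemma D0_mem: "D0 (\<lambda>e. e i \<epsilon> e j)"
  by (rule D0I[of "Mem (Var i) (Var j)"]) (auto intro: sigma_fm.intros pi_fm.intros PRP_mem PRF_var)

lemma D0_eq: "D0 (\<lambda>e. e i = e j)"
  by (rule D0I[of "Eq (Var i) (Var j)"]) (auto intro: sigma_fm.intros pi_fm.intros PRP_eq PRF_var)

lemma D0_not: "D0 P \<Longrightarrow> D0 (\<lambda>e. \<not> P e)"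
  unfolding D0_def using sigma_fm_neg pi_fm_neg PRP_not by (metis sat_neg)

lemma D0_conj:
  assumes "D0 P" "D0 Q" shows "D0 (\<lambda>e. P e \<and> Q e)"
proof -
  obtain \<theta> \<theta>' where "sigma_fm \<theta>" "pi_fm \<theta>" "\<forall>e. sat E F UNIV e \<theta> \<longleftrightarrow> P e"
      "sigma_fm \<theta>'" "pi_fm \<theta>'" "\<forall>e. sat E F UNIV e \<theta>' \<longleftrightarrow> Q e"
    using assms by (auto simp: D0_def)
  then show ?thesis
    by (intro D0I[of "And \<theta> \<theta>'"]) (auto intro: sigma_fm.intros pi_fm.intros PRP_conj D0_PRP assms)
qed

lemma D0_disj: "D0 P \<Longrightarrow> D0 Q \<Longrightarrow> D0 (\<lambda>e. P e \<or> Q e)"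
  using D0_not[OF D0_conj[OF D0_not[of P] D0_not[of Q]]] by simp

lemma D0_imp: "D0 P \<Longrightarrow> D0 Q \<Longrightarrow> D0 (\<lambda>e. P e \<longrightarrow> Q e)"
  unfolding imp_conv_disj by (intro D0_disj D0_not)

lemma D0_const: "D0 (\<lambda>e. b)"
  using D0_eq[of 0 0] D0_not[OF D0_eq[of 0 0]] by (cases b) auto

lemma D0_finite_ball: "finite A \<Longrightarrow> (\<And>a. a \<in> A \<Longrightarrow> D0 (P a)) \<Longrightarrow> D0 (\<lambda>e. \<forall>a\<in>A. P a e)"
  by (induction A rule: finite_induct) (auto intro: D0_const D0_conj)

lemma D0_rename: "D0 P \<Longrightarrow> D0 (\<lambda>e. P (\<lambda>i. e (\<rho> i)))"
proof -
  assume P: "D0 P"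
  then obtain \<theta> where "sigma_fm \<theta>" "pi_fm \<theta>" "\<forall>e. sat E F UNIV e \<theta> \<longleftrightarrow> P e"
    by (auto simp: D0_def)
  then show ?thesis
    by (intro D0I[of "sb (\<lambda>i. Var (\<rho> i)) \<theta>"])
      (auto intro: sigma_fm_rename pi_fm_rename PRP_rename D0_PRP P)
qed

lemma D0_bex:
  assumes "D0 (\<lambda>e. P (e 0) (\<lambda>i. e (Suc i)))"
  shows "D0 (\<lambda>e. \<exists>u. u \<epsilon> e j \<and> P u e)"
proof -
  obtain \<theta> where \<theta>: "sigma_fm \<theta>" "pi_fm \<theta>"
      "\<forall>e. sat E F UNIV e \<theta> \<longleftrightarrow> P (e 0) (\<lambda>i. e (Suc i))"
    using assms by (auto simp: D0_def)
  show ?thesis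
  proof (rule D0I[of "BEx (Var j) \<theta>"])
    show "sigma_fm (BEx (Var j) \<theta>)"
      unfolding BEx_def using \<theta>(1) by (auto intro!: sigma_fm.intros)
    show "pi_fm (BEx (Var j) \<theta>)" using \<theta>(2) by (rule pi_fm.intros)
    show "sat E F UNIV e (BEx (Var j) \<theta>) \<longleftrightarrow> (\<exists>u. u \<epsilon> e j \<and> P u e)" for e
      using \<theta>(3) by simp
    show "PRP (\<lambda>e. \<exists>u. u \<epsilon> e j \<and> P u e)"
      using assms by (intro PRP_bex PRF_var D0_PRP)
  qed
qed

lemma D0_ball:
  assumes "D0 (\<lambda>e. P (e 0) (\<lambda>i. e (Suc i)))"
  shows "D0 (\<lambda>e. \<forall>u. u \<epsilon> e j \<longrightarrow> P u e)"
  using D0_not[OF D0_bex[of "\<lambda>u e. \<not> P u e", OF D0_not[OF assms]]] by simp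

lemmas D0_basic = D0_mem D0_eq D0_not D0_conj D0_disj D0_imp D0_const D0_bex D0_ball

lemma D0_emp: "D0 (\<lambda>e. e i = emp)"
proof -
  have "D0 (\<lambda>e. \<forall>u. u \<epsilon> e i \<longrightarrow> False)" by (intro D0_basic)
  moreover have "(\<forall>u. u \<epsilon> x \<longrightarrow> False) \<longleftrightarrow> x = emp" for x using nonempty[of x] by auto
  ultimately show ?thesis by simp
qed

lemma eq_upr_iff: "p = upr a b \<longleftrightarrow> (\<forall>u. u \<epsilon> p \<longrightarrow> u = a \<or> u = b) \<and> a \<epsilon> p \<and> b \<epsilon> p"
  using ext[of p "upr a b"] by auto

lemma D0_upr: "D0 (\<lambda>e. e i = upr (e j) (e k))"
  unfolding eq_upr_iff by (intro D0_basic)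

lemma eq_succ_iff:
  "n = ins m m \<longleftrightarrow> (\<forall>u. u \<epsilon> n \<longrightarrow> u \<epsilon> m \<or> u = m) \<and> (\<forall>u. u \<epsilon> m \<longrightarrow> u \<epsilon> n) \<and> m \<epsilon> n"
  using ext[of n "ins m m"] by auto

lemma D0_succ: "D0 (\<lambda>e. e i = ins (e j) (e j))"
  unfolding eq_succ_iff by (intro D0_basic)

definition opr :: "'a \<Rightarrow> 'a \<Rightarrow> 'a" where
  "opr a b = upr (upr a a) (upr a b)"

lemma upr_eq_iff: "upr a b = upr c d \<longleftrightarrow> a = c \<and> b = d \<or> a = d \<and> b = c"
  unfolding eq_upr_iff[of "upr a b"] by auto

lemma opr_inject [simp]: "opr a b = opr c d \<longleftrightarrow> a = c \<and> b = d"
  unfolding opr_def upr_eq_iff by auto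

lemma D0_opr: "D0 (\<lambda>e. e i = opr (e j) (e k))"
proof -
  have "D0 (\<lambda>e. \<exists>p. p \<epsilon> e i \<and> (\<exists>q. q \<epsilon> e i \<and>
      (p = upr (e j) (e j) \<and> q = upr (e j) (e k) \<and> e i = upr p q)))"
    by (intro D0_upr D0_basic)
  moreover have "(\<exists>p. p \<epsilon> x \<and> (\<exists>q. q \<epsilon> x \<and> (p = upr y y \<and> q = upr y z \<and> x = upr p q)))
      \<longleftrightarrow> x = opr y z" for x y z
    by (auto simp: opr_def)
  ultimately show ?thesis by simp
qed

text \<open>Both components of a pair lie in its element \<open>upr x y\<close>, which bounds the
  quantifiers over them. In the bounded form \<open>y\<close> is innermost and the auxiliary
  \<open>q\<close> stands outside \<open>x\<close>, hence the permutation
  \<open>?\<rho>\<close>.\<close>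

lemma D0_ex_opr:
  assumes "D0 (\<lambda>e. P (e 0) (e 1) (\<lambda>i. e (Suc (Suc i))))"
  shows "D0 (\<lambda>e. \<exists>x y. e i = opr x y \<and> P x y e)"
proof -
  let ?\<rho> = "case_nat 1 (case_nat 0 (\<lambda>i. Suc (Suc (Suc i))))"
  have "D0 (\<lambda>e. P (e 1) (e 0) (\<lambda>i. e (Suc (Suc (Suc i)))))"
    using D0_rename[OF assms, of ?\<rho>] by simp
  then have "D0 (\<lambda>e. \<exists>q. q \<epsilon> e i \<and> (\<exists>x. x \<epsilon> q \<and> (\<exists>y. y \<epsilon> q \<and> (e i = opr x y \<and> P x y e))))"
    by (intro D0_bex D0_conj D0_opr) simp
  moreover have "(\<exists>q. q \<epsilon> z \<and> (\<exists>x. x \<epsilon> q \<and> (\<exists>y. y \<epsilon> q \<and> (z = opr x y \<and> P x y e)))) \<longleftrightarrow>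
      (\<exists>x y. z = opr x y \<and> P x y e)" for z e
  proof -
    have "upr x y \<epsilon> opr x y \<and> x \<epsilon> upr x y \<and> y \<epsilon> upr x y" for x y by (simp add: opr_def)
    then show ?thesis by blast
  qed
  ultimately show ?thesis by simp
qed

lemma D0_all_opr:
  assumes "D0 (\<lambda>e. P (e 0) (e 1) (\<lambda>i. e (Suc (Suc i))))"
  shows "D0 (\<lambda>e. \<forall>x y. e i = opr x y \<longrightarrow> P x y e)"
  using D0_not[OF D0_ex_opr[of "\<lambda>x y e. \<not> P x y e", OF D0_not[OF assms]]] by simp

section \<open>Numerals as names of formulas\<close>

primrec num :: "nat \<Rightarrow> 'a" where
  "num 0 = emp"
| "num (Suc n) = ins (num n) (num n)"

lemma D0_num: "D0 (\<lambda>e. e i = num n)"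
proof (induction n arbitrary: i)
  case 0
  then show ?case using D0_emp by simp
next
  case (Suc n)
  have "D0 (\<lambda>e. \<exists>y. y \<epsilon> e i \<and> (y = num n \<and> e i = ins y y))"
    by (intro D0_bex D0_conj Suc.IH D0_succ)
  moreover have "(\<exists>y. y \<epsilon> x \<and> (y = num n \<and> x = ins y y)) \<longleftrightarrow> x = num (Suc n)" for x by auto
  ultimately show ?case by simp
qed

lemma num_less: "m < n \<Longrightarrow> num m \<epsilon> num n"
  by (induction n) (auto simp: less_Suc_eq)

lemma num_inject: "num m = num n \<longleftrightarrow> m = n"
  using num_less mem_irrefl by (metis linorder_neqE_nat)

text \<open>Only standard numerals serve as names, so being the name of a given formula is a bounded
  property without parameters; no syntax has to be coded inside the model.\<close>

definition code :: "fm \<Rightarrow> 'a" where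
  "code \<phi> = num (to_nat \<phi>)"

lemma code_inject [simp]: "code \<phi> = code \<psi> \<longleftrightarrow> \<phi> = \<psi>"
  by (simp add: code_def num_inject)

lemma D0_code: "D0 (\<lambda>e. e i = code \<phi>)"
  unfolding code_def by (rule D0_num)

definition DE :: "((nat \<Rightarrow> 'a) \<Rightarrow> bool) \<Rightarrow> bool" where
  "DE P \<longleftrightarrow> (\<exists>\<phi>. set_fm \<phi> \<and> (\<forall>e. sat E F UNIV e \<phi> \<longleftrightarrow> P e))"

lemma DE_D0: "D0 P \<Longrightarrow> DE P"
  unfolding D0_def DE_def using sigma_fm_set_fm by blast

lemma DE_not: "DE P \<Longrightarrow> DE (\<lambda>e. \<not> P e)"
  unfolding DE_def by (metis sat_neg set_fm_neg)

lemma DE_conj: "DE P \<Longrightarrow> DE Q \<Longrightarrow> DE (\<lambda>e. P e \<and> Q e)"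
  unfolding DE_def by (metis sat.simps(5) set_fm.simps(5))

lemma DE_disj: "DE P \<Longrightarrow> DE Q \<Longrightarrow> DE (\<lambda>e. P e \<or> Q e)"
  unfolding DE_def by (metis sat.simps(6) set_fm.simps(6))

lemma DE_imp: "DE P \<Longrightarrow> DE Q \<Longrightarrow> DE (\<lambda>e. P e \<longrightarrow> Q e)"
  unfolding imp_conv_disj by (intro DE_disj DE_not)

lemma DE_ex:
  assumes "DE (\<lambda>e. P (e 0) (\<lambda>i. e (Suc i)))"
  shows "DE (\<lambda>e. \<exists>u. P u e)"
proof -
  obtain \<phi> where "set_fm \<phi>" "\<forall>e. sat E F UNIV e \<phi> \<longleftrightarrow> P (e 0) (\<lambda>i. e (Suc i))"
    using assms by (auto simp: DE_def)
  then have "set_fm (Ex \<phi>)" "\<forall>e. sat E F UNIV e (Ex \<phi>) \<longleftrightarrow> (\<exists>u. P u e)" by auto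
  then show ?thesis unfolding DE_def by blast
qed

lemma DE_all:
  assumes "DE (\<lambda>e. P (e 0) (\<lambda>i. e (Suc i)))"
  shows "DE (\<lambda>e. \<forall>u. P u e)"
  using DE_not[OF DE_ex[of "\<lambda>u e. \<not> P u e", OF DE_not[OF assms]]] by simp

lemma DE_rename: "DE P \<Longrightarrow> DE (\<lambda>e. P (\<lambda>i. e (\<rho> i)))"
proof -
  assume "DE P"
  then obtain \<phi> where "set_fm \<phi>" "\<forall>e. sat E F UNIV e \<phi> \<longleftrightarrow> P e" by (auto simp: DE_def)
  then have "set_fm (sb (\<lambda>i. Var (\<rho> i)) \<phi>)"
      "\<forall>e. sat E F UNIV e (sb (\<lambda>i. Var (\<rho> i)) \<phi>) \<longleftrightarrow> P (\<lambda>i. e (\<rho> i))"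
    by (auto simp: set_fm_rename)
  then show ?thesis unfolding DE_def by blast
qed

lemma DE_finite_bex: "finite A \<Longrightarrow> (\<And>a. a \<in> A \<Longrightarrow> DE (P a)) \<Longrightarrow> DE (\<lambda>e. \<exists>a\<in>A. P a e)"
  by (induction A rule: finite_induct) (auto intro: DE_disj DE_D0[OF D0_const])

end

section \<open>The axioms are well-formed sentences\<close>

text \<open>An upper bound on the free variables is compositional under de Bruijn binding: each
  quantifier raises it by one.\<close>

definition cl_trm :: "nat \<Rightarrow> trm \<Rightarrow> bool" where
  "cl_trm n t \<longleftrightarrow> fv_trm t \<subseteq> {..<n}"

definition cl :: "nat \<Rightarrow> fm \<Rightarrow> bool" where
  "cl n \<phi> \<longleftrightarrow> fv \<phi> \<subseteq> {..<n}"

lemma cl_trm_simps [simp]: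
  "cl_trm n (Var i) \<longleftrightarrow> i < n"
  "cl_trm n (Fn f ts) \<longleftrightarrow> list_all (cl_trm n) ts"
  by (auto simp: cl_trm_def list_all_iff)

lemma cl_trm_lift_trm [simp]: "cl_trm (Suc n) (lift_trm t) \<longleftrightarrow> cl_trm n t"
  by (induction t) (auto simp: list_all_iff)

lemma cl_simps [simp]:
  "cl n (Mem s t) \<longleftrightarrow> cl_trm n s \<and> cl_trm n t"
  "cl n (NMem s t) \<longleftrightarrow> cl_trm n s \<and> cl_trm n t"
  "cl n (Eq s t) \<longleftrightarrow> cl_trm n s \<and> cl_trm n t"
  "cl n (NEq s t) \<longleftrightarrow> cl_trm n s \<and> cl_trm n t"
  "cl n (And \<phi> \<psi>) \<longleftrightarrow> cl n \<phi> \<and> cl n \<psi>"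
  "cl n (Or \<phi> \<psi>) \<longleftrightarrow> cl n \<phi> \<and> cl n \<psi>"
  by (auto simp: cl_def cl_trm_def)

lemma cl_quantifiers [simp]:
  "cl n (All \<phi>) \<longleftrightarrow> cl (Suc n) \<phi>"
  "cl n (Ex \<phi>) \<longleftrightarrow> cl (Suc n) \<phi>"
proof -
  have "{i. Suc i \<in> A} \<subseteq> {..<n} \<longleftrightarrow> A \<subseteq> {..<Suc n}" for A
  proof
    assume *: "{i. Suc i \<in> A} \<subseteq> {..<n}"
    show "A \<subseteq> {..<Suc n}"
    proof
      fix i assume "i \<in> A"
      then show "i \<in> {..<Suc n}" using * by (cases i) auto
    qed
  qed auto
  then show "cl n (All \<phi>) \<longleftrightarrow> cl (Suc n) \<phi>" "cl n (Ex \<phi>) \<longleftrightarrow> cl (Suc n) \<phi>"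
    by (auto simp: cl_def)
qed

lemma cl_derived [simp]:
  "cl n (neg \<phi>) \<longleftrightarrow> cl n \<phi>"
  "cl n (Imp \<phi> \<psi>) \<longleftrightarrow> cl n \<phi> \<and> cl n \<psi>"
  "cl n (Iff \<phi> \<psi>) \<longleftrightarrow> cl n \<phi> \<and> cl n \<psi>"
  "cl n (BAll t \<phi>) \<longleftrightarrow> cl_trm n t \<and> cl (Suc n) \<phi>"
  "cl n (BEx t \<phi>) \<longleftrightarrow> cl_trm n t \<and> cl (Suc n) \<phi>"
proof -
  show neg: "cl n (neg \<phi>) \<longleftrightarrow> cl n \<phi>" for n \<phi> by (simp add: cl_def)
  show "cl n (Imp \<phi> \<psi>) \<longleftrightarrow> cl n \<phi> \<and> cl n \<psi>" "cl n (Iff \<phi> \<psi>) \<longleftrightarrow> cl n \<phi> \<and> cl n \<psi>"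
    by (auto simp: Imp_def Iff_def neg)
  show "cl n (BAll t \<phi>) \<longleftrightarrow> cl_trm n t \<and> cl (Suc n) \<phi>" "cl n (BEx t \<phi>) \<longleftrightarrow> cl_trm n t \<and> cl (Suc n) \<phi>"
    by (auto simp: BAll_def BEx_def)
qed

lemma cl_Alls [simp]: "cl n (Alls k \<phi>) \<longleftrightarrow> cl (n + k) \<phi>"
  by (induction k arbitrary: n) (auto simp: Alls_def)

lemma cl_trm_sb_trm: "cl_trm m t \<Longrightarrow> (\<And>i. i < m \<Longrightarrow> cl_trm n (\<sigma> i)) \<Longrightarrow> cl_trm n (sb_trm \<sigma> t)"
  by (induction t) (auto simp: list_all_iff)

lemma cl_sb: "cl m \<phi> \<Longrightarrow> (\<And>i. i < m \<Longrightarrow> cl_trm n (\<sigma> i)) \<Longrightarrow> cl n (sb \<sigma> \<phi>)"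
proof (induction \<phi> arbitrary: m n \<sigma>)
  case (All \<phi>)
  have "cl (Suc n) (sb (up \<sigma>) \<phi>)"
  proof (rule All.IH[of "Suc m"])
    show "cl_trm (Suc n) (up \<sigma> i)" if "i < Suc m" for i using that All.prems by (cases i) auto
  qed (use All.prems in simp)
  then show ?case by simp
next
  case (Ex \<phi>)
  have "cl (Suc n) (sb (up \<sigma>) \<phi>)"
  proof (rule Ex.IH[of "Suc m"])
    show "cl_trm (Suc n) (up \<sigma> i)" if "i < Suc m" for i using that Ex.prems by (cases i) auto
  qed (use Ex.prems in simp)
  then show ?case by simp
qed (auto simp: cl_trm_sb_trm)

lemma cl_inst: "cl (length ts) \<phi> \<Longrightarrow> list_all (cl_trm n) ts \<Longrightarrow> cl n (inst \<phi> ts)"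
  unfolding inst_def by (rule cl_sb) (auto simp: list_all_length)

lemma cl_rel: "cl n \<phi> \<Longrightarrow> cl_trm n N \<Longrightarrow> cl n (rel N \<phi>)"
  by (induction \<phi> arbitrary: n N) auto

lemma fv_empty_iff: "fv \<phi> = {} \<longleftrightarrow> cl 0 \<phi>"
  by (simp add: cl_def)

lemma wf_derived [simp]:
  "wf_fm (Imp \<phi> \<psi>) \<longleftrightarrow> wf_fm \<phi> \<and> wf_fm \<psi>"
  "wf_fm (Iff \<phi> \<psi>) \<longleftrightarrow> wf_fm \<phi> \<and> wf_fm \<psi>"
  by (auto simp: Imp_def Iff_def)

lemma wf_trm_lift_trm_iff [simp]: "wf_trm (lift_trm t) \<longleftrightarrow> wf_trm t"
  by (induction t) (auto simp: list_all_iff)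

lemma wf_bounded [simp]:
  "wf_fm (BAll t \<phi>) \<longleftrightarrow> wf_trm t \<and> wf_fm \<phi>"
  "wf_fm (BEx t \<phi>) \<longleftrightarrow> wf_trm t \<and> wf_fm \<phi>"
  by (auto simp: BAll_def BEx_def)

lemma wf_Alls [simp]: "wf_fm (Alls k \<phi>) \<longleftrightarrow> wf_fm \<phi>"
  by (induction k) (auto simp: Alls_def)

lemma wf_rel: "wf_fm \<phi> \<Longrightarrow> wf_trm N \<Longrightarrow> wf_fm (rel N \<phi>)"
  by (induction \<phi> arbitrary: N) auto

lemma wf_set_fm: "set_fm \<phi> \<Longrightarrow> wf_fm \<phi>"
proof -
  have "is_Var t \<Longrightarrow> wf_trm t" for t by (cases t) auto
  then show "set_fm \<phi> \<Longrightarrow> wf_fm \<phi>" by (induction \<phi>) auto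
qed

lemma pi_fm_set_fm: "pi_fm \<phi> \<Longrightarrow> set_fm \<phi>"
  using sigma_fm_set_fm[OF pi_fm_neg] by simp

lemma sentence_defining_axiom: "wf_psf f \<Longrightarrow> wf_fm (defining_axiom f) \<and> cl 0 (defining_axiom f)"
  by (cases f)
    (auto simp: Subset_def Inductive_def Let_def list_all_iff simp del: upt_Suc)

lemma sentence_PRS_DC: "\<phi> \<in> PRS_DC \<Longrightarrow> wf_fm \<phi> \<and> cl 0 \<phi>"
  by (auto simp: PRS_DC_def PRS_def sentence_defining_axiom extensionality_def regularity_def
      infinity_def Inductive_def dependent_choice_def Function_to_def)

lemma sentence_Reflection: "\<phi> \<in> Reflection \<Longrightarrow> wf_fm \<phi> \<and> cl 0 \<phi>"
proof -
  assume "\<phi> \<in> Reflection"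
  then obtain \<psi> where \<psi>: "\<phi> = reflection \<psi>" "set_fm \<psi>" "fv \<psi> \<subseteq> {0}" by (auto simp: Reflection_def)
  have "cl (Suc 0) \<psi>" using \<psi>(3) by (auto simp: cl_def)
  then show ?thesis using \<psi>(1,2)
    by (simp add: reflection_def Subset_def Transitive_def wf_rel wf_inst wf_set_fm cl_rel cl_inst)
qed

lemma sentence_Class_Induction: "\<phi> \<in> Class_Induction \<Longrightarrow> wf_fm \<phi> \<and> cl 0 \<phi>"
proof -
  assume "\<phi> \<in> Class_Induction"
  then obtain \<theta> \<theta>' k \<chi> where *: "\<phi> = class_induction \<theta> \<theta>' k \<chi>" "sigma_fm \<theta>" "fv \<theta> \<subseteq> {0, 1, 2}"
      "pi_fm \<theta>'" "fv \<theta>' \<subseteq> {0, 1, 2}" "set_fm \<chi>" "fv \<chi> \<subseteq> {0..k}"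
    by (auto simp: Class_Induction_def)
  have cl: "cl (Suc (Suc (Suc 0))) \<theta>" "cl (Suc (Suc (Suc 0))) \<theta>'" "cl (Suc k) \<chi>"
    using *(3,5,7) by (auto simp: cl_def)
  have wf: "wf_fm \<theta>" "wf_fm \<theta>'" "wf_fm \<chi>"
    using * by (auto simp: wf_set_fm sigma_fm_set_fm pi_fm_set_fm)
  show ?thesis using cl wf unfolding *(1)
    by (simp add: class_induction_def Subset_def Delta_Rel_def WF_def Ind_def in_X_def less_X_def
        le_X_def wf_inst cl_inst list_all_iff del: upt_Suc)
qed


section \<open>Meaning of the two schemas\<close>

text \<open>Repeating \<open>r\<close> at all later places keeps the whole assignment inside any set
  that contains \<open>x\<close>, \<open>y\<close> and \<open>r\<close>, as upward absoluteness
  requires.\<close>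

definition tri :: "'a \<Rightarrow> 'a \<Rightarrow> 'a \<Rightarrow> nat \<Rightarrow> 'a" where
  "tri x y r = case_nat x (case_nat y (\<lambda>_. r))"

lemma sat_inst_tri:
  assumes "fv \<theta> \<subseteq> {0, 1, 2}"
  shows "sat E F U e (inst \<theta> [s, t, u]) \<longleftrightarrow> sat E F U (tri (val F e s) (val F e t) (val F e u)) \<theta>"
  unfolding sat_inst by (rule sat_cong) (use assms in \<open>auto simp: tri_def\<close>)

lemma sat_inst_tail:
  assumes "fv \<phi> \<subseteq> {0..k}"
  shows "sat E F U e (inst \<phi> (Var 0 # map Var [m..<k + m])) \<longleftrightarrow>
    sat E F U (case_nat (e 0) (\<lambda>i. e (i + m))) \<phi>"
proof -
  have "sat E F U e (inst \<phi> (Var 0 # map Var [m..<k + m])) \<longleftrightarrow>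
    sat E F U (\<lambda>i. if i < Suc k then val F e ((Var 0 # map Var [m..<k + m]) ! i) else e (i - Suc k)) \<phi>"
    by (simp add: sat_inst cong: if_cong)
  also have "\<dots> \<longleftrightarrow> sat E F U (case_nat (e 0) (\<lambda>i. e (i + m))) \<phi>"
  proof (rule sat_cong)
    fix i assume "i \<in> fv \<phi>"
    then have "i \<le> k" using assms by auto
    then show "(if i < Suc k then val F e ((Var 0 # map Var [m..<k + m]) ! i) else e (i - Suc k)) =
        case_nat (e 0) (\<lambda>i. e (i + m)) i"
      by (cases i) (auto simp: add.commute)
  qed
  finally show ?thesis .
qed

lemma sat_Ind:
  assumes \<theta>: "fv \<theta> \<subseteq> {0, 1, 2}" and \<phi>: "fv \<phi> \<subseteq> {0..k}"
  shows "sat E F U e (Ind \<theta> k \<phi>) \<longleftrightarrow>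
    (\<forall>d. (\<forall>i<k. d i \<in> U) \<and> (\<forall>i. d (k + i) = e i) \<longrightarrow>
      (\<forall>x\<in>U. sat E F U (tri x x (e 0)) \<theta> \<longrightarrow>
         (\<forall>y\<in>U. sat E F U (tri y x (e 0)) \<theta> \<and> y \<noteq> x \<longrightarrow> sat E F U (case_nat y d) \<phi>) \<longrightarrow>
         sat E F U (case_nat x d) \<phi>) \<longrightarrow>
      (\<forall>x\<in>U. sat E F U (tri x x (e 0)) \<theta> \<longrightarrow> sat E F U (case_nat x d) \<phi>))"
proof -
  have t1: "sat E F U (case_nat x d) (inst \<phi> (Var 0 # map Var [Suc 0..<Suc k])) \<longleftrightarrow>
      sat E F U (case_nat x d) \<phi>" for x d
    using sat_inst_tail[OF \<phi>, of E F U "case_nat x d" 1] by (simp del: upt_Suc)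
  have t2: "sat E F U (case_nat y (case_nat x d)) (inst \<phi> (Var 0 # map Var [2..<Suc (Suc k)])) \<longleftrightarrow>
      sat E F U (case_nat y d) \<phi>" for x y d
    using sat_inst_tail[OF \<phi>, of E F U "case_nat y (case_nat x d)" 2] by (simp del: upt_Suc)
  have r: "d k = e 0" if "\<forall>i. d (k + i) = e i" for d :: "nat \<Rightarrow> 'a"
    using that[rule_format, of 0] by simp
  show ?thesis
    unfolding Ind_def sat_Alls
    by (simp add: in_X_def less_X_def le_X_def sat_inst_tri[OF \<theta>] r t1 t2
        del: upt_Suc cong: conj_cong imp_cong)
qed

lemma sat_WF:
  assumes \<theta>: "fv \<theta> \<subseteq> {0, 1, 2}"
  shows "sat E F UNIV e (WF \<theta>) \<longleftrightarrow> (\<forall>w. w \<noteq> F Zero [] \<longrightarrow>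
    (\<exists>x. E x w \<and> (\<forall>y. E y w \<longrightarrow> \<not> (sat E F UNIV (tri y x (e 0)) \<theta> \<and> y \<noteq> x))))"
  by (simp add: WF_def less_X_def le_X_def sat_inst_tri[OF \<theta>] numeral_3_eq_3)

lemma sat_Delta_Rel:
  assumes "fv \<theta> \<subseteq> {0, 1, 2}" "fv \<theta>' \<subseteq> {0, 1, 2}"
  shows "sat E F UNIV e (Delta_Rel \<theta> \<theta>') \<longleftrightarrow>
    (\<forall>x y. sat E F UNIV (tri x y (e 0)) \<theta> \<longrightarrow>
      sat E F UNIV (tri x x (e 0)) \<theta> \<and> sat E F UNIV (tri y y (e 0)) \<theta>) \<and>
    (\<forall>x y. sat E F UNIV (tri x y (e 0)) \<theta> \<longleftrightarrow> sat E F UNIV (tri x y (e 0)) \<theta>')"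
  by (simp add: Delta_Rel_def in_X_def le_X_def sat_inst_tri[OF assms(1)] sat_inst_tri[OF assms(2)]
      numeral_2_eq_2)

lemma sat_Subset [simp]:
  "sat E F UNIV e (Subset s t) \<longleftrightarrow> (\<forall>x. E x (val F e s) \<longrightarrow> E x (val F e t))"
  by (simp add: Subset_def)

lemma sat_Transitive [simp]:
  "sat E F UNIV e (Transitive t) \<longleftrightarrow> (\<forall>y. E y (val F e t) \<longrightarrow> (\<forall>x. E x y \<longrightarrow> E x (val F e t)))"
  by (simp add: Transitive_def)

lemma sat_reflection:
  assumes "fv \<psi> \<subseteq> {0}"
  shows "sat E F UNIV e (reflection \<psi>) \<longleftrightarrow>
    (\<forall>r. (\<forall>x. E x r \<longrightarrow> E x (F Omega [])) \<longrightarrow> sat E F UNIV (\<lambda>_. r) \<psi> \<longrightarrow>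
      (\<exists>N. (\<forall>y. E y N \<longrightarrow> (\<forall>x. E x y \<longrightarrow> E x N)) \<and> sat E F {x. E x N} (\<lambda>_. r) \<psi>))"
proof -
  have "sat E F U e (inst \<psi> [t]) \<longleftrightarrow> sat E F U (\<lambda>_. val F e t) \<psi>" for U e t
    unfolding sat_inst by (rule sat_cong) (use assms in auto)
  then show ?thesis by (simp add: reflection_def sat_rel)
qed


section \<open>Reflection implies induction\<close>

text \<open>Witnesses of existential quantifiers persist. The bound of a universal quantifier is an
  element of \<open>N\<close>, so by transitivity the quantifier meets only elements of
  \<open>N\<close>.\<close>

lemma sat_sigma_fm_upward:
  assumes "sigma_fm \<theta>" "\<And>x y. E x y \<Longrightarrow> E y N \<Longrightarrow> E x N" "\<And>i. E (e i) N"
    and "sat E F {x. E x N} e \<theta>"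
  shows "sat E F UNIV e \<theta>"
  using assms(1,3,4)
proof (induction arbitrary: e rule: sigma_fm.induct)
  case (7 \<phi> i)
  show ?case
  proof (simp, intro allI impI)
    fix x assume x: "E x (e i)"
    then have N: "E x N" using assms(2) "7.prems"(1) by blast
    show "sat E F UNIV (case_nat x e) \<phi>"
    proof (rule "7.IH")
      show "E (case_nat x e j) N" for j using N "7.prems"(1) by (cases j) auto
    qed (use "7.prems"(2) x N in simp)
  qed
next
  case (8 \<phi>)
  then obtain x where x: "E x N" "sat E F {x. E x N} (case_nat x e) \<phi>" by auto
  have "E (case_nat x e j) N" for j using x(1) "8.prems"(1) by (cases j) auto
  then show ?case using "8.IH"[of "case_nat x e"] x(2) by auto
qed auto

locale reflecting_model = prs_model +
  assumes Reflection: "\<phi> \<in> Reflection \<Longrightarrow> sat E F UNIV e \<phi>"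
begin

theorem class_induction:
  assumes \<theta>: "sigma_fm \<theta>" "fv \<theta> \<subseteq> {0, 1, 2}" and \<theta>': "fv \<theta>' \<subseteq> {0, 1, 2}"
    and \<phi>: "set_fm \<phi>" "fv \<phi> \<subseteq> {0..k}"
  shows "sat E F UNIV e (class_induction \<theta> \<theta>' k \<phi>)"
proof -
  define L where "L U r x y \<longleftrightarrow> sat E F U (tri x y r) \<theta>" for U r x y
  \<comment> \<open>The field condition has to be reflected too: what lies below \<open>x\<close> in
    the sense of \<open>N\<close> must belong to the class in the sense of \<open>N\<close>, since
    the counterexamples are collected there.\<close>
  let ?C = "All (All (Imp (le_X \<theta> (Var 2) (Var 1) (Var 0))
    (And (in_X \<theta> (Var 2) (Var 1)) (in_X \<theta> (Var 2) (Var 0)))))"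
  let ?\<psi> = "And (Ex (Eq (Var 0) (Var 1))) (And ?C (neg (Ind \<theta> k \<phi>)))"
  \<comment> \<open>Relativization does not put the parameter into \<open>N\<close>; the first conjunct of \<open>?\<psi>\<close> does.\<close>
  have "sat E F UNIV e' (Ind \<theta> k \<phi>)" if r: "\<forall>x. x \<epsilon> e' 0 \<longrightarrow> x \<epsilon> om"
      and \<Delta>: "sat E F UNIV e' (Delta_Rel \<theta> \<theta>')" and wf: "sat E F UNIV e' (WF \<theta>)" for e'
  proof (rule ccontr)
    assume "\<not> sat E F UNIV e' (Ind \<theta> k \<phi>)"
    define r where "r = e' 0"
    have cl: "cl (Suc 0) (Ind \<theta> k \<phi>)"
    proof -
      have cl: "cl (Suc (Suc (Suc 0))) \<theta>" "cl (Suc k) \<phi>" using \<theta> \<phi> by (auto simp: cl_def)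
      then show ?thesis
        by (simp add: Ind_def in_X_def less_X_def le_X_def cl_inst list_all_iff del: upt_Suc)
    qed
    have "\<not> sat E F UNIV (\<lambda>_. r) (Ind \<theta> k \<phi>)"
      using \<open>\<not> sat E F UNIV e' (Ind \<theta> k \<phi>)\<close> sat_cong[of "Ind \<theta> k \<phi>" e' "\<lambda>_. r"] cl
      by (auto simp: cl_def r_def)
    moreover have "sat E F U (\<lambda>_. r) ?C \<longleftrightarrow>
        (\<forall>x\<in>U. \<forall>y\<in>U. L U r x y \<longrightarrow> L U r x x \<and> L U r y y)" for U
      by (simp add: in_X_def le_X_def sat_inst_tri[OF \<theta>(2)] L_def numeral_2_eq_2)
    note C = this
    have "\<forall>x y. L UNIV r x y \<longrightarrow> L UNIV r x x \<and> L UNIV r y y"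
      using \<Delta> unfolding sat_Delta_Rel[OF \<theta>(2) \<theta>'] L_def r_def by blast
    ultimately have "sat E F UNIV (\<lambda>_. r) ?\<psi>" using C[of UNIV] by simp
    moreover have fv: "fv ?\<psi> \<subseteq> {0}"
    proof -
      have "cl (Suc (Suc (Suc 0))) \<theta>" using \<theta> by (auto simp: cl_def)
      then have "cl (Suc 0) ?\<psi>" using cl by (simp add: in_X_def le_X_def cl_inst)
      then show ?thesis unfolding cl_def by auto
    qed
    moreover have "reflection ?\<psi> \<in> Reflection"
    proof -
      have var: "set_fm (inst \<chi> (map Var is))" if "set_fm \<chi>" for \<chi> "is"
      proof -
        have "inst \<chi> (map Var is) = sb (\<lambda>i. Var (if i < length is then is ! i else i - length is)) \<chi>"
          unfolding inst_def by (rule sb_cong) auto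
        then show ?thesis using set_fm_rename that by simp
      qed
      have Alls: "set_fm (Alls k \<chi>) \<longleftrightarrow> set_fm \<chi>" for k \<chi>
        by (induction k) (auto simp: Alls_def)
      have "set_fm (inst \<theta> [Var i, Var j, Var l])" for i j l
        using var[of \<theta> "[i, j, l]"] sigma_fm_set_fm[OF \<theta>(1)] by simp
      moreover have "set_fm (inst \<phi> (Var 0 # map Var [m..<n]))" for m n
        using var[of \<phi> "0 # [m..<n]"] \<phi>(1) by simp
      ultimately have "set_fm ?\<psi>"
        by (simp add: Ind_def in_X_def less_X_def le_X_def Alls Imp_def del: upt_Suc)
      then show ?thesis unfolding Reflection_def using fv by blast
    qed
    then have "sat E F UNIV (\<lambda>_. r) (reflection ?\<psi>)" by (rule Reflection)
    ultimately obtain N where N: "\<And>x y. x \<epsilon> y \<Longrightarrow> y \<epsilon> N \<Longrightarrow> x \<epsilon> N"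
        "sat E F {x. x \<epsilon> N} (\<lambda>_. r) ?\<psi>"
      using r unfolding sat_reflection[OF fv] r_def by blast
    let ?N = "{x. x \<epsilon> N}"
    have rN: "r \<epsilon> N" using N(2) by auto
    have CN: "\<And>x y. x \<epsilon> N \<Longrightarrow> y \<epsilon> N \<Longrightarrow> L ?N r x y \<Longrightarrow> L ?N r x x \<and> L ?N r y y"
      using N(2) C[of ?N] by simp
    have "\<not> sat E F ?N (\<lambda>_. r) (Ind \<theta> k \<phi>)" using N(2) by simp
    then obtain d where d: "\<forall>i<k. d i \<epsilon> N" "\<forall>i. d (k + i) = r"
      and prog: "\<forall>x. x \<epsilon> N \<longrightarrow> L ?N r x x \<longrightarrow>
        (\<forall>y. y \<epsilon> N \<longrightarrow> L ?N r y x \<and> y \<noteq> x \<longrightarrow> sat E F ?N (case_nat y d) \<phi>) \<longrightarrow>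
        sat E F ?N (case_nat x d) \<phi>"
      and "\<exists>x. x \<epsilon> N \<and> L ?N r x x \<and> \<not> sat E F ?N (case_nat x d) \<phi>"
      unfolding sat_Ind[OF \<theta>(2) \<phi>(2)] L_def by auto
    then obtain x0 where x0: "x0 \<epsilon> N" "L ?N r x0 x0" "\<not> sat E F ?N (case_nat x0 d) \<phi>" by blast
    have "is_set (\<lambda>v. v \<epsilon> N \<and> (L ?N r v v \<and> \<not> sat E F ?N (case_nat v d) \<phi>))"
    proof -
      \<comment> \<open>The parameters are \<open>N\<close>, \<open>r\<close> and then
        \<open>d\<close>. With the candidate \<open>v\<close> at place 0 they start at places 1, 2
        and 3, which determines \<open>?\<rho>\<close> and \<open>?\<rho>'\<close>.\<close>
      let ?P = "\<lambda>v e. sat E F {x. x \<epsilon> e 0} (tri v v (e 1)) \<theta> \<and>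
        \<not> sat E F {x. x \<epsilon> e 0} (case_nat v (\<lambda>i. e (i + 2))) \<phi>"
      let ?\<rho> = "\<lambda>i. if i < 2 then 0 else 2" and ?\<rho>' = "case_nat 0 (\<lambda>i. i + 3)"
      have 1: "(\<lambda>i. e (?\<rho> i)) = tri (e 0) (e 0) (e 2)" for e :: "nat \<Rightarrow> 'a"
        by (rule HOL.ext) (auto simp: tri_def split: nat.split)
      have 2: "(\<lambda>i. e (?\<rho>' i)) = case_nat (e 0) (\<lambda>i. e (i + 3))" for e :: "nat \<Rightarrow> 'a"
        by (rule HOL.ext) (auto split: nat.split)
      have "PRP (\<lambda>e. ?P (e 0) (\<lambda>i. e (Suc i)))"
        using PRP_conj[OF PRP_sat[OF sigma_fm_set_fm[OF \<theta>(1)], of 1 ?\<rho>]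
            PRP_not[OF PRP_sat[OF \<phi>(1), of 1 ?\<rho>']]]
        unfolding 1 2 by (simp add: numeral_eq_Suc)
      from separation[of ?P, OF this, of N "case_nat N (case_nat r d)"]
      show ?thesis by (simp add: L_def numeral_2_eq_2)
    qed
    then obtain w where w: "\<And>v. v \<epsilon> w \<longleftrightarrow>
        v \<epsilon> N \<and> (L ?N r v v \<and> \<not> sat E F ?N (case_nat v d) \<phi>)"
      unfolding is_set_def by blast
    have "w \<noteq> emp" using w[of x0] x0 nonempty by blast
    then obtain x where x: "x \<epsilon> w" "\<And>y. y \<epsilon> w \<Longrightarrow> L UNIV r y x \<Longrightarrow> y = x"
      using wf unfolding sat_WF[OF \<theta>(2)] L_def r_def by blast
    have "sat E F ?N (case_nat x d) \<phi>"
    proof (rule prog[rule_format])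
      show "x \<epsilon> N" "L ?N r x x" using x(1) w by auto
      fix y assume "y \<epsilon> N" "L ?N r y x \<and> y \<noteq> x"
      then have y: "y \<epsilon> N" "L ?N r y x" "y \<noteq> x" by auto
      have "tri y x r i \<epsilon> N" for i
        using \<open>x \<epsilon> N\<close> y(1) rN by (auto simp: tri_def split: nat.split)
      then have "L UNIV r y x"
        using sat_sigma_fm_upward[OF \<theta>(1), of E N "tri y x r"] N(1) y(2) unfolding L_def by blast
      then have "\<not> y \<epsilon> w" using x(2) y(3) by blast
      then show "sat E F ?N (case_nat y d) \<phi>" using w y(1,2) CN \<open>x \<epsilon> N\<close> by blast
    qed
    then show False using x(1) w by blast
  qed
  then show ?thesis by (simp add: class_induction_def)
qed

end

section \<open>Models of class induction\<close>

locale inductive_model = prs_model +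
  assumes Class_Induction: "\<phi> \<in> Class_Induction \<Longrightarrow> sat E F UNIV e \<phi>"
    and DC: "sat E F UNIV e dependent_choice"
begin

text \<open>The schema in semantic form. The formula for \<open>L\<close> is used both as \<Sigma>-
  and as \<Pi>-formula, which makes their equivalence trivial.\<close>

lemma class_induct:
  assumes L: "D0 (\<lambda>e. L (e 0) (e 1) (e 2))"
    and r: "\<forall>x. x \<epsilon> r \<longrightarrow> x \<epsilon> om"
    and field: "\<forall>x y. L x y r \<longrightarrow> L x x r \<and> L y y r"
    and wf: "\<forall>w. w \<noteq> emp \<longrightarrow> (\<exists>x. x \<epsilon> w \<and> (\<forall>y. y \<epsilon> w \<longrightarrow> \<not> (L y x r \<and> y \<noteq> x)))"
    and P: "DE (\<lambda>e. P (e 0) (\<lambda>i. e (Suc i)))"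
    and progressive: "\<forall>x. L x x r \<longrightarrow> (\<forall>y. L y x r \<and> y \<noteq> x \<longrightarrow> P y d) \<longrightarrow> P x d"
  shows "\<forall>x. L x x r \<longrightarrow> P x d"
proof -
  obtain \<theta>0 where \<theta>0: "sigma_fm \<theta>0" "pi_fm \<theta>0" "\<forall>e. sat E F UNIV e \<theta>0 \<longleftrightarrow> L (e 0) (e 1) (e 2)"
    using L unfolding D0_def by blast
  \<comment> \<open>Identifying all variables from 2 on leaves only 0, 1, 2 free and does not affect
    a predicate of the first three values.\<close>
  let ?\<rho> = "\<lambda>i :: nat. min i 2"
  define \<theta> where "\<theta> = sb (\<lambda>i. Var (?\<rho> i)) \<theta>0"
  have \<theta>: "sigma_fm \<theta>" "pi_fm \<theta>"
    unfolding \<theta>_def by (rule sigma_fm_rename[OF \<theta>0(1)], rule pi_fm_rename[OF \<theta>0(2)])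
  have "range ?\<rho> \<subseteq> {0, 1, 2}" by (auto simp: min_def)
  then have fv\<theta>: "fv \<theta> \<subseteq> {0, 1, 2}"
    unfolding \<theta>_def by (rule subset_trans[OF fv_rename[of ?\<rho> \<theta>0]])
  have sat\<theta>: "sat E F UNIV (tri x y r) \<theta> \<longleftrightarrow> L x y r" for x y
    unfolding \<theta>_def using \<theta>0(3) by (simp add: tri_def numeral_2_eq_2)
  obtain \<phi> where \<phi>: "set_fm \<phi>" "\<forall>e. sat E F UNIV e \<phi> \<longleftrightarrow> P (e 0) (\<lambda>i. e (Suc i))"
    using P unfolding DE_def by blast
  obtain k where "\<forall>i\<in>fv \<phi>. i \<le> k"
    using finite_nat_set_iff_bounded_le[of "fv \<phi>"] finite_fv[of \<phi>] by blast
  then have k: "fv \<phi> \<subseteq> {0..k}" by auto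
  \<comment> \<open>Behind the \<open>k\<close> parameters quantified in \<open>Ind\<close> comes
    the outer assignment, which is taken to be constantly \<open>r\<close>.\<close>
  define d' where "d' i = (if i < k then d i else r)" for i
  have sat\<phi>: "sat E F UNIV (case_nat x d') \<phi> \<longleftrightarrow> P x d" for x
  proof -
    have "sat E F UNIV (case_nat x d') \<phi> \<longleftrightarrow> sat E F UNIV (case_nat x d) \<phi>"
    proof (rule sat_cong)
      fix i assume "i \<in> fv \<phi>"
      then have "i \<le> k" using k by auto
      then show "case_nat x d' i = case_nat x d i" by (cases i) (auto simp: d'_def)
    qed
    then show ?thesis using \<phi>(2) by simp
  qed
  have d': "d' (k + i) = r" for i by (simp add: d'_def)
  have "class_induction \<theta> \<theta> k \<phi> \<in> Class_Induction"
    unfolding Class_Induction_def using \<theta> fv\<theta> \<phi>(1) k by blast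
  from Class_Induction[OF this, of undefined]
  have "\<forall>r. (\<forall>x. x \<epsilon> r \<longrightarrow> x \<epsilon> om) \<longrightarrow>
      sat E F UNIV (case_nat r undefined) (Delta_Rel \<theta> \<theta>) \<longrightarrow>
      sat E F UNIV (case_nat r undefined) (WF \<theta>) \<longrightarrow> sat E F UNIV (case_nat r undefined) (Ind \<theta> k \<phi>)"
    by (simp add: class_induction_def)
  moreover have "sat E F UNIV (case_nat r undefined) (Delta_Rel \<theta> \<theta>)"
    unfolding sat_Delta_Rel[OF fv\<theta> fv\<theta>] nat.case sat\<theta> using field by blast
  moreover have "sat E F UNIV (case_nat r undefined) (WF \<theta>)"
    unfolding sat_WF[OF fv\<theta>] nat.case sat\<theta> by (rule wf)
  ultimately have "sat E F UNIV (case_nat r undefined) (Ind \<theta> k \<phi>)"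
    using r by blast
  then have "sat E F UNIV (\<lambda>_. r) (Ind \<theta> k \<phi>)"
  proof -
    have "cl (Suc (Suc (Suc 0))) \<theta>" "cl (Suc k) \<phi>" using fv\<theta> k by (auto simp: cl_def)
    then have "cl (Suc 0) (Ind \<theta> k \<phi>)"
      by (simp add: Ind_def in_X_def less_X_def le_X_def cl_inst list_all_iff del: upt_Suc)
    then have "sat E F UNIV (case_nat r undefined) (Ind \<theta> k \<phi>) \<longleftrightarrow> sat E F UNIV (\<lambda>_. r) (Ind \<theta> k \<phi>)"
      by (intro sat_cong) (auto simp: cl_def)
    with \<open>sat E F UNIV (case_nat r undefined) (Ind \<theta> k \<phi>)\<close> show ?thesis by simp
  qed
  then have "(\<forall>i<k. d' i \<in> UNIV) \<and> (\<forall>i. d' (k + i) = r) \<longrightarrow>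
      (\<forall>x. L x x r \<longrightarrow> (\<forall>y. L y x r \<and> y \<noteq> x \<longrightarrow> P y d) \<longrightarrow> P x d) \<longrightarrow> (\<forall>x. L x x r \<longrightarrow> P x d)"
    unfolding sat_Ind[OF fv\<theta> k] sat\<theta> ball_UNIV by (subst sat\<phi>[symmetric])+ (erule spec)
  then show ?thesis using progressive d' by simp
qed

text \<open>Membership, made reflexive, is a \<Delta> relation whose well-foundedness with respect
  to sets is regularity; the schema thus lifts regularity to induction for arbitrary
  formulas.\<close>

lemma mem_induct:
  assumes "DE (\<lambda>e. P (e 0) (\<lambda>i. e (Suc i)))" "\<And>x. (\<And>y. y \<epsilon> x \<Longrightarrow> P y d) \<Longrightarrow> P x d"
  shows "P x d"
proof -
  let ?L = "\<lambda>x y r. x \<epsilon> y \<or> x = y"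
  have wf: "\<exists>x. x \<epsilon> w \<and> (\<forall>y. y \<epsilon> w \<longrightarrow> \<not> (?L y x emp \<and> y \<noteq> x))" if "w \<noteq> emp" for w
    using nonempty[of w] regular[of _ w] that by blast
  have "\<forall>x. ?L x x emp \<longrightarrow> P x d"
  proof (rule class_induct[where L = ?L])
    show "D0 (\<lambda>e. ?L (e 0) (e 1) (e 2))" by (intro D0_basic)
    show "\<forall>x. ?L x x emp \<longrightarrow> (\<forall>y. ?L y x emp \<and> y \<noteq> x \<longrightarrow> P y d) \<longrightarrow> P x d"
      using assms(2) mem_irrefl by metis
  qed (use wf assms(1) in auto)
  then show ?thesis by simp
qed

section \<open>Natural numbers of the model\<close>

lemma om_axiom:
  "emp \<epsilon> om \<and> (\<forall>n. n \<epsilon> om \<longrightarrow> ins n n \<epsilon> om) \<and>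
   (\<forall>a. emp \<epsilon> a \<and> (\<forall>n. n \<epsilon> a \<longrightarrow> ins n n \<epsilon> a) \<longrightarrow> (\<forall>n. n \<epsilon> om \<longrightarrow> n \<epsilon> a))"
proof -
  have "sat E F UNIV e (Inductive t) \<longleftrightarrow>
      emp \<epsilon> val F e t \<and> (\<forall>n. n \<epsilon> val F e t \<longrightarrow> ins n n \<epsilon> val F e t)" for e t
    unfolding Inductive_def by (simp only: sat.simps sat_BAll val.simps list.map nat.case val_lift_trm ball_UNIV)
  note Inductive = this
  have "sat E F UNIV undefined (defining_axiom Omega)" by (rule defining_axiom) simp
  then show ?thesis
    unfolding defining_axiom.simps sat.simps sat_Imp sat_Subset Inductive val.simps list.map nat.case
      ball_UNIV conj_assoc .
qed

lemma emp_om: "emp \<epsilon> om" and succ_om: "n \<epsilon> om \<Longrightarrow> ins n n \<epsilon> om"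
  and om_least: "emp \<epsilon> a \<Longrightarrow> (\<And>n. n \<epsilon> a \<Longrightarrow> ins n n \<epsilon> a) \<Longrightarrow> n \<epsilon> om \<Longrightarrow> n \<epsilon> a"
  using om_axiom by blast+

lemma om_cases:
  assumes "n \<epsilon> om"
  shows "n = emp \<or> (\<exists>m. m \<epsilon> om \<and> n = ins m m)"
proof -
  let ?P = "\<lambda>n d. n = emp \<or> (\<exists>m. m \<epsilon> d 0 \<and> n = ins m m)"
  have "PRP (\<lambda>e. ?P (e 0) (\<lambda>i. e (Suc i)))" by (rule D0_PRP) (intro D0_basic D0_emp D0_succ)
  from separation[of ?P, OF this, of om "\<lambda>_. om"]
  obtain a where a: "\<And>v. v \<epsilon> a \<longleftrightarrow> v \<epsilon> om \<and> (v = emp \<or> (\<exists>m. m \<epsilon> om \<and> v = ins m m))"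
    unfolding is_set_def by blast
  have "n \<epsilon> a" by (rule om_least) (use a emp_om succ_om assms in auto)
  then show ?thesis using a by blast
qed

text \<open>\<open>om_least\<close> needs a set, which an arbitrary formula does not provide. Hence
  the detour through \<in>-induction, with \<open>om_cases\<close> supplying the
  predecessor.\<close>

lemma om_induct:
  assumes P: "DE (\<lambda>e. P (e 0) (\<lambda>i. e (Suc i)))"
    and "P emp d" "\<And>n. n \<epsilon> om \<Longrightarrow> P n d \<Longrightarrow> P (ins n n) d" "n \<epsilon> om"
  shows "P n d"
proof -
  let ?Q = "\<lambda>n e. n \<epsilon> e 0 \<longrightarrow> P n (\<lambda>i. e (Suc i))"
  have "?Q n (case_nat om d)"
  proof (rule mem_induct[of ?Q])
    have "DE (\<lambda>e. P (e 0) (\<lambda>i. e (Suc (Suc i))))"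
      using DE_rename[OF P, of "case_nat 0 (\<lambda>i. Suc (Suc i))"] by simp
    then show "DE (\<lambda>e. ?Q (e 0) (\<lambda>i. e (Suc i)))"
      by (rule DE_imp[OF DE_D0[OF D0_mem]])
    show "?Q n (case_nat om d)" if "\<And>m. m \<epsilon> n \<Longrightarrow> ?Q m (case_nat om d)" for n
      using that om_cases[of n] assms(2,3) by auto
  qed
  then show ?thesis using assms(4) by simp
qed

lemma om_transitive: "n \<epsilon> om \<Longrightarrow> m \<epsilon> n \<Longrightarrow> m \<epsilon> om"
proof -
  assume n: "n \<epsilon> om" and m: "m \<epsilon> n"
  let ?P = "\<lambda>n d. \<forall>m. m \<epsilon> n \<longrightarrow> m \<epsilon> d 0"
  have "?P n (\<lambda>_. om)"
    by (rule om_induct[of ?P]) (use n in \<open>auto intro!: DE_D0 D0_basic\<close>)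
  then show ?thesis using m by simp
qed

lemma nat_transitive: "n \<epsilon> om \<Longrightarrow> m \<epsilon> n \<Longrightarrow> k \<epsilon> m \<Longrightarrow> k \<epsilon> n"
proof -
  assume n: "n \<epsilon> om" and m: "m \<epsilon> n" "k \<epsilon> m"
  let ?P = "\<lambda>n d. \<forall>m. m \<epsilon> n \<longrightarrow> (\<forall>k. k \<epsilon> m \<longrightarrow> k \<epsilon> n)"
  have "?P n (\<lambda>_. om)"
    by (rule om_induct[of ?P]) (use n in \<open>auto intro!: DE_D0 D0_basic\<close>)
  then show ?thesis using m by simp
qed

lemma nat_emp_or_mem:
  assumes "n \<epsilon> om"
  shows "n = emp \<or> emp \<epsilon> n"
proof -
  let ?P = "\<lambda>n d. n = emp \<or> (\<exists>k. k \<epsilon> n \<and> k = emp)"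
  have "?P n (\<lambda>_. om)"
  proof (rule om_induct[of ?P])
    show "DE (\<lambda>e. ?P (e 0) (\<lambda>i. e (Suc i)))" by (intro DE_D0 D0_emp D0_basic)
  qed (use assms in auto)
  then show ?thesis by auto
qed

lemma nat_succ_le:
  assumes "m \<epsilon> om" "n \<epsilon> m"
  shows "ins n n \<epsilon> m \<or> ins n n = m"
proof -
  let ?P = "\<lambda>m d. \<forall>n. n \<epsilon> m \<longrightarrow> (\<exists>k. k \<epsilon> m \<and> k = ins n n) \<or> m = ins n n"
  have "?P m (\<lambda>_. om)"
  proof (rule om_induct[of ?P])
    show "DE (\<lambda>e. ?P (e 0) (\<lambda>i. e (Suc i)))" by (intro DE_D0 D0_succ D0_basic)
  qed (use assms in auto)
  then show ?thesis using assms by auto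
qed

lemma nat_linear:
  assumes "m \<epsilon> om" "n \<epsilon> om"
  shows "m \<epsilon> n \<or> m = n \<or> n \<epsilon> m"
proof -
  let ?P = "\<lambda>n d. d 0 \<epsilon> n \<or> d 0 = n \<or> n \<epsilon> d 0"
  have "?P n (\<lambda>_. m)"
  proof (rule om_induct[of ?P])
    show "DE (\<lambda>e. ?P (e 0) (\<lambda>i. e (Suc i)))" by (intro DE_D0 D0_basic)
    show "?P emp (\<lambda>_. m)" using nat_emp_or_mem[OF assms(1)] by auto
    show "?P (ins k k) (\<lambda>_. m)" if "?P k (\<lambda>_. m)" for k using that nat_succ_le[OF assms(1), of k] by auto
  qed (fact assms(2))
  then show ?thesis .
qed

text \<open>A description of the elements of \<open>\<omega>\<close> that is \<open>\<Delta>\<^sub>0\<close> without \<open>\<omega>\<close> as a parameter.\<close>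

definition isnat :: "'a \<Rightarrow> bool" where
  "isnat n \<longleftrightarrow> (n = emp \<or> (\<exists>k. k \<epsilon> n \<and> n = ins k k)) \<and>
    (\<forall>m. m \<epsilon> n \<longrightarrow> (m = emp \<or> (\<exists>k. k \<epsilon> n \<and> m = ins k k)))"

lemma D0_isnat: "D0 (\<lambda>e. isnat (e i))"
  unfolding isnat_def by (intro D0_emp D0_succ D0_basic)

text \<open>An \<in>-minimal element of \<open>ins n n\<close> outside \<open>om\<close> would be
  empty or the successor of an element of \<open>om\<close>, hence in \<open>om\<close> after all.
  The converse is an induction.\<close>

lemma isnat_iff: "isnat n \<longleftrightarrow> n \<epsilon> om"
proof
  assume n: "isnat n"
  show "n \<epsilon> om"
  proof (rule ccontr)
    assume not: "\<not> n \<epsilon> om"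
    let ?P = "\<lambda>m d. \<not> m \<epsilon> d 0"
    have "PRP (\<lambda>e. ?P (e 0) (\<lambda>i. e (Suc i)))" by (rule D0_PRP) (intro D0_basic)
    from minimal[of ?P, OF this, of n "ins n n" "\<lambda>_. om"] not
    obtain m where m: "m \<epsilon> ins n n" "\<not> m \<epsilon> om" "\<forall>z. z \<epsilon> ins n n \<longrightarrow> \<not> z \<epsilon> om \<longrightarrow> \<not> z \<epsilon> m"
      by auto
    then have "m = emp \<or> (\<exists>k. k \<epsilon> n \<and> m = ins k k)" using n by (auto simp: isnat_def)
    then show False using m emp_om succ_om by auto
  qed
next
  assume "n \<epsilon> om"
  let ?P = "\<lambda>n d. isnat n"
  show "isnat n"
  proof (rule om_induct[of ?P])
    show "DE (\<lambda>e. ?P (e 0) (\<lambda>i. e (Suc i)))" by (intro DE_D0 D0_isnat)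
    show "isnat (ins k k)" if "isnat k" for k using that by (auto simp: isnat_def)
  qed (use \<open>n \<epsilon> om\<close> in \<open>auto simp: isnat_def\<close>)
qed

section \<open>Dependent choice for bounded relations\<close>

lemma PRF_opr: "PRF f \<Longrightarrow> PRF g \<Longrightarrow> PRF (\<lambda>e. opr (f e) (g e))"
  unfolding opr_def by (intro PRF_ins PRF_emp)

lemma is_set_square: "is_set (\<lambda>v. \<exists>x y. x \<epsilon> w \<and> y \<epsilon> w \<and> v = opr x y)"
proof -
  let ?h = "\<lambda>x e. coll (\<lambda>v. \<exists>y. y \<epsilon> e 0 \<and> v = opr x y)"
  have "PRF (\<lambda>e. opr (e (Suc 0)) (e 0))" by (intro PRF_opr PRF_var)
  then have img: "PRF (\<lambda>e. coll (\<lambda>v. \<exists>y. y \<epsilon> e (Suc 0) \<and> v = opr (e 0) y))"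
      "is_set (\<lambda>v. \<exists>y. y \<epsilon> e (Suc 0) \<and> v = opr (e 0) y)" for e
    using PRF_image[OF PRF_var[of "Suc 0"], of "\<lambda>y e. opr (e 0) y"] by simp_all
  have "is_set (\<lambda>v. \<exists>u. u \<epsilon> w \<and> v \<epsilon> ?h u (\<lambda>_. w))"
    using PRF_Union(2)[OF PRF_var[of 0], of ?h "\<lambda>_. w"] img(1) by simp
  moreover have "v \<epsilon> ?h u (\<lambda>_. w) \<longleftrightarrow> (\<exists>y. y \<epsilon> w \<and> v = opr u y)" for u v
    using in_coll[OF img(2)[of "case_nat u (\<lambda>_. w)"]] by simp
  ultimately show ?thesis by (auto simp: is_set_def)
qed

text \<open>The axiom speaks of a relation that is a set, so the bounded relation \<open>R\<close>
  is first cut down to pairs from \<open>w\<close> by separation.\<close>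

lemma dependent_choice:
  assumes R: "D0 (\<lambda>e. R (e 0) (e 1) (\<lambda>i. e (Suc (Suc i))))"
    and "x0 \<epsilon> w" and total: "\<And>x. x \<epsilon> w \<Longrightarrow> \<exists>y. y \<epsilon> w \<and> R x y d"
  shows "\<exists>f. (\<forall>n x. opr n x \<epsilon> f \<longrightarrow> n \<epsilon> om \<and> x \<epsilon> w) \<and>
    (\<forall>n. n \<epsilon> om \<longrightarrow> (\<exists>x. opr n x \<epsilon> f)) \<and>
    (\<forall>n x y. opr n x \<epsilon> f \<longrightarrow> opr n y \<epsilon> f \<longrightarrow> x = y) \<and>
    (\<forall>n x y. opr n x \<epsilon> f \<longrightarrow> opr (ins n n) y \<epsilon> f \<longrightarrow> R x y d)"
proof -
  obtain W where W: "\<And>v. v \<epsilon> W \<longleftrightarrow> (\<exists>x y. x \<epsilon> w \<and> y \<epsilon> w \<and> v = opr x y)"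
    using is_set_square unfolding is_set_def by blast
  let ?P = "\<lambda>v d. \<exists>x y. v = opr x y \<and> R x y d"
  have "D0 (\<lambda>e. R (e 0) (e 1) (\<lambda>i. e (Suc (Suc (Suc i)))))"
    using D0_rename[OF R, of "\<lambda>i. if i < 2 then i else Suc i"] by simp
  then have "PRP (\<lambda>e. ?P (e 0) (\<lambda>i. e (Suc i)))" by (intro D0_PRP D0_ex_opr)
  from separation[of ?P, OF this, of W d]
  obtain Rs where Rs: "\<And>v. v \<epsilon> Rs \<longleftrightarrow> v \<epsilon> W \<and> (\<exists>x y. v = opr x y \<and> R x y d)"
    unfolding is_set_def by blast
  have Rs': "opr x y \<epsilon> Rs \<longleftrightarrow> x \<epsilon> w \<and> y \<epsilon> w \<and> R x y d" for x y using Rs W by auto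
  have "w \<noteq> emp" using nonempty assms(2) by blast
  moreover have "\<forall>x. x \<epsilon> w \<longrightarrow> (\<exists>y. y \<epsilon> w \<and> opr x y \<epsilon> Rs)" using total Rs' by blast
  ultimately have w: "w \<noteq> emp \<and> (\<forall>x. x \<epsilon> w \<longrightarrow> (\<exists>y. y \<epsilon> w \<and> opr x y \<epsilon> Rs))" ..
  have dc: "\<forall>A R. A \<noteq> emp \<and> (\<forall>x. x \<epsilon> A \<longrightarrow> (\<exists>y. y \<epsilon> A \<and> opr x y \<epsilon> R)) \<longrightarrow>
      (\<exists>f. (\<forall>p. p \<epsilon> f \<longrightarrow> (\<exists>n. n \<epsilon> om \<and> (\<exists>x. x \<epsilon> A \<and> p = opr n x))) \<and>
        (\<forall>n. n \<epsilon> om \<longrightarrow> (\<exists>x. x \<epsilon> A \<and> opr n x \<epsilon> f)) \<and>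
        (\<forall>n. n \<epsilon> om \<longrightarrow> (\<forall>x. x \<epsilon> A \<longrightarrow> (\<forall>y. y \<epsilon> A \<longrightarrow> opr n x \<epsilon> f \<and> opr n y \<epsilon> f \<longrightarrow> x = y))) \<and>
        (\<forall>n. n \<epsilon> om \<longrightarrow> (\<forall>x. x \<epsilon> A \<longrightarrow> (\<forall>y. y \<epsilon> A \<longrightarrow>
          opr n x \<epsilon> f \<and> opr (ins n n) y \<epsilon> f \<longrightarrow> opr x y \<epsilon> R))))" (is ?DC)
  proof -
    have "sat E F UNIV undefined dependent_choice \<longleftrightarrow> ?DC"
      by (simp add: dependent_choice_def Function_to_def Let_def numeral_eq_Suc
          flip: opr_def del: in_ins)
    then show ?thesis using DC by blast
  qed
  from dc[THEN spec, of w, THEN spec, of Rs, THEN mp, OF w]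
  obtain f where f: "\<forall>p. p \<epsilon> f \<longrightarrow> (\<exists>n. n \<epsilon> om \<and> (\<exists>x. x \<epsilon> w \<and> p = opr n x))"
    "\<forall>n. n \<epsilon> om \<longrightarrow> (\<exists>x. x \<epsilon> w \<and> opr n x \<epsilon> f)"
    "\<forall>n. n \<epsilon> om \<longrightarrow> (\<forall>x. x \<epsilon> w \<longrightarrow> (\<forall>y. y \<epsilon> w \<longrightarrow> opr n x \<epsilon> f \<and> opr n y \<epsilon> f \<longrightarrow> x = y))"
    "\<forall>n. n \<epsilon> om \<longrightarrow> (\<forall>x. x \<epsilon> w \<longrightarrow> (\<forall>y. y \<epsilon> w \<longrightarrow>
          opr n x \<epsilon> f \<and> opr (ins n n) y \<epsilon> f \<longrightarrow> opr x y \<epsilon> Rs))"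
    by blast
  have dom: "n \<epsilon> om \<and> x \<epsilon> w" if "opr n x \<epsilon> f" for n x using f(1) that by fastforce
  show ?thesis
  proof (rule exI[of _ f], intro conjI allI impI)
    show "n \<epsilon> om" "x \<epsilon> w" if "opr n x \<epsilon> f" for n x using dom[OF that] by auto
    show "\<exists>x. opr n x \<epsilon> f" if "n \<epsilon> om" for n using f(2) that by blast
    show "x = y" if "opr n x \<epsilon> f" "opr n y \<epsilon> f" for n x y
      using f(3) that dom[OF that(1)] dom[OF that(2)] by blast
    show "R x y d" if "opr n x \<epsilon> f" "opr (ins n n) y \<epsilon> f" for n x y
      using f(4) that dom[OF that(1)] dom[OF that(2)] Rs' by blast
  qed
qed

end

section \<open>Subformulas\<close>

primrec subs :: "fm \<Rightarrow> fm set" where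
  "subs (Mem s t) = {Mem s t}"
| "subs (NMem s t) = {NMem s t}"
| "subs (Eq s t) = {Eq s t}"
| "subs (NEq s t) = {NEq s t}"
| "subs (And \<phi> \<psi>) = insert (And \<phi> \<psi>) (subs \<phi> \<union> subs \<psi>)"
| "subs (Or \<phi> \<psi>) = insert (Or \<phi> \<psi>) (subs \<phi> \<union> subs \<psi>)"
| "subs (All \<phi>) = insert (All \<phi>) (subs \<phi>)"
| "subs (Ex \<phi>) = insert (Ex \<phi>) (subs \<phi>)"

lemma finite_subs: "finite (subs \<phi>)"
  by (induction \<phi>) auto

lemma subs_refl: "\<phi> \<in> subs \<phi>"
  by (cases \<phi>) auto

lemma subs_trans: "\<phi> \<in> subs \<psi> \<Longrightarrow> subs \<phi> \<subseteq> subs \<psi>"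
  by (induction \<psi>) auto

lemma subs_closed:
  "And \<phi> \<chi> \<in> subs \<psi> \<Longrightarrow> \<phi> \<in> subs \<psi> \<and> \<chi> \<in> subs \<psi>"
  "Or \<phi> \<chi> \<in> subs \<psi> \<Longrightarrow> \<phi> \<in> subs \<psi> \<and> \<chi> \<in> subs \<psi>"
  "All \<phi> \<in> subs \<psi> \<Longrightarrow> \<phi> \<in> subs \<psi>"
  "Ex \<phi> \<in> subs \<psi> \<Longrightarrow> \<phi> \<in> subs \<psi>"
  using subs_trans[of "And \<phi> \<chi>" \<psi>] subs_trans[of "Or \<phi> \<chi>" \<psi>] subs_trans[of "All \<phi>" \<psi>]
    subs_trans[of "Ex \<phi>" \<psi>] subs_refl[of \<phi>] subs_refl[of \<chi>] by auto

text \<open>The atoms of a pure set formula contain variables only; the value at function terms is a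
  dummy.\<close>

primrec idx :: "trm \<Rightarrow> nat" where
  "idx (Var i) = i"
| "idx (Fn f ts) = 0"

context prs_model
begin

subsection \<open>Truth for coded assignments\<close>

text \<open>Nested pairs follow the de Bruijn convention: entering a quantifier replaces the coded
  assignment \<open>c\<close> by \<open>opr x c\<close>, just as \<open>case_nat x\<close> does
  outside the model.\<close>

primrec lst :: "'a list \<Rightarrow> 'a" where
  "lst [] = emp"
| "lst (x # xs) = opr x (lst xs)"

text \<open>The entry is handed to a predicate \<open>Q\<close> instead of being returned, because a
  bounded formula has no terms for the components of a pair.\<close>

primrec at :: "nat \<Rightarrow> 'a \<Rightarrow> ('a \<Rightarrow> bool) \<Rightarrow> bool" where
  "at 0 c Q \<longleftrightarrow> (\<exists>x y. c = opr x y \<and> Q x)"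
| "at (Suc i) c Q \<longleftrightarrow> (\<exists>x y. c = opr x y \<and> at i y Q)"

lemma at_lst: "i < length xs \<Longrightarrow> at i (lst xs) Q \<longleftrightarrow> Q (xs ! i)"
proof (induction i arbitrary: xs)
  case 0
  then show ?case by (cases xs) auto
next
  case (Suc i)
  then show ?case by (cases xs) auto
qed

lemma D0_at:
  assumes "D0 (\<lambda>e. P (e 0) (\<lambda>i. e (Suc i)))"
  shows "D0 (\<lambda>e. at i (e k) (\<lambda>x. P x e))"
  using assms
proof (induction i arbitrary: k P)
  case 0
  have "D0 (\<lambda>e. P (e 0) (\<lambda>i. e (Suc (Suc i))))"
    using D0_rename[OF 0, of "case_nat 0 (\<lambda>i. Suc (Suc i))"] by simp
  then show ?case unfolding at.simps by (rule D0_ex_opr)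
next
  case (Suc i)
  let ?P = "\<lambda>x e. P x (\<lambda>i. e (Suc (Suc i)))"
  have "D0 (\<lambda>e. P (e 0) (\<lambda>i. e (Suc (Suc (Suc i)))))"
    using D0_rename[OF Suc.prems, of "case_nat 0 (\<lambda>i. Suc (Suc (Suc i)))"] by simp
  from Suc.IH[of ?P 1, OF this] show ?case unfolding at.simps by (rule D0_ex_opr)
qed

text \<open>The recursion is on formulas outside the model, so definability is obtained for each
  fixed formula and no uniform truth predicate arises. The domain \<open>U\<close> varies because
  truth in the universe has to be turned into truth in a set.\<close>

primrec Tr :: "'a set \<Rightarrow> fm \<Rightarrow> 'a \<Rightarrow> bool" where
  "Tr U (Mem s t) c \<longleftrightarrow> at (idx s) c (\<lambda>x. at (idx t) c (\<lambda>y. x \<epsilon> y))"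
| "Tr U (NMem s t) c \<longleftrightarrow> at (idx s) c (\<lambda>x. at (idx t) c (\<lambda>y. \<not> x \<epsilon> y))"
| "Tr U (Eq s t) c \<longleftrightarrow> at (idx s) c (\<lambda>x. at (idx t) c (\<lambda>y. x = y))"
| "Tr U (NEq s t) c \<longleftrightarrow> at (idx s) c (\<lambda>x. at (idx t) c (\<lambda>y. \<not> x = y))"
| "Tr U (And \<phi> \<psi>) c \<longleftrightarrow> Tr U \<phi> c \<and> Tr U \<psi> c"
| "Tr U (Or \<phi> \<psi>) c \<longleftrightarrow> Tr U \<phi> c \<or> Tr U \<psi> c"
| "Tr U (All \<phi>) c \<longleftrightarrow> (\<forall>x\<in>U. Tr U \<phi> (opr x c))"
| "Tr U (Ex \<phi>) c \<longleftrightarrow> (\<exists>x\<in>U. Tr U \<phi> (opr x c))"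

lemma Tr_lst:
  assumes "set_fm \<phi>" "cl (length xs) \<phi>"
  shows "Tr U \<phi> (lst xs) \<longleftrightarrow> sat E F U (\<lambda>i. xs ! i) \<phi>"
  using assms
proof (induction \<phi> arbitrary: xs)
  case (Mem s t)
  then show ?case by (cases s; cases t) (auto simp: at_lst)
next
  case (NMem s t)
  then show ?case by (cases s; cases t) (auto simp: at_lst)
next
  case (Eq s t)
  then show ?case by (cases s; cases t) (auto simp: at_lst)
next
  case (NEq s t)
  then show ?case by (cases s; cases t) (auto simp: at_lst)
next
  case (All \<phi>)
  have "(\<lambda>i. (x # xs) ! i) = case_nat x (\<lambda>i. xs ! i)" for x
    by (rule HOL.ext) (simp add: nth_Cons)
  then show ?case using All.IH[of "_ # xs"] All.prems by simp
next
  case (Ex \<phi>)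
  have "(\<lambda>i. (x # xs) ! i) = case_nat x (\<lambda>i. xs ! i)" for x
    by (rule HOL.ext) (simp add: nth_Cons)
  then show ?case using Ex.IH[of "_ # xs"] Ex.prems by simp
qed auto

lemma D0_Tr_atomic:
  "D0 (\<lambda>e. Tr U (Mem s t) (e k))" "D0 (\<lambda>e. Tr U (NMem s t) (e k))"
  "D0 (\<lambda>e. Tr U (Eq s t) (e k))" "D0 (\<lambda>e. Tr U (NEq s t) (e k))"
  unfolding Tr.simps by (intro D0_at D0_basic)+

lemma DE_Tr: "DE (\<lambda>e. Tr UNIV \<phi> (e k))"
proof (induction \<phi> arbitrary: k)
  case (And \<phi> \<psi>)
  then show ?case by (simp add: DE_conj)
next
  case (Or \<phi> \<psi>)
  then show ?case by (simp add: DE_disj)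
next
  case (All \<phi>)
  have "DE (\<lambda>e. \<forall>x. \<forall>z. z = opr x (e k) \<longrightarrow> Tr UNIV \<phi> z)"
    by (intro DE_all DE_imp DE_D0[OF D0_opr] All.IH)
  then show ?case by simp
next
  case (Ex \<phi>)
  have "DE (\<lambda>e. \<exists>x. \<exists>z. z = opr x (e k) \<and> Tr UNIV \<phi> z)"
    by (intro DE_ex DE_conj DE_D0[OF D0_opr] Ex.IH)
  then show ?case by simp
qed (rule DE_D0, rule D0_Tr_atomic)+

subsection \<open>Sequences of claims\<close>

text \<open>
  A claim is a pair \<open>opr (code \<phi>) c\<close>, asserting \<open>\<phi>\<close> at the assignment \<open>c\<close>. A sequence of claims is a set
  of pairs of an index and a claim. The definitions are spelled out in such a way that all quantifiers
  are visibly bounded.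
\<close>

definition has1 :: "'a \<Rightarrow> fm \<Rightarrow> 'a \<Rightarrow> bool" where
  "has1 s \<phi> c \<longleftrightarrow> (\<exists>p. p \<epsilon> s \<and> (\<exists>i q. p = opr i q \<and> (\<exists>k d. q = opr k d \<and> k = code \<phi> \<and> d = c)))"

definition has2 :: "'a \<Rightarrow> fm \<Rightarrow> 'a \<Rightarrow> 'a \<Rightarrow> bool" where
  "has2 s \<phi> b c \<longleftrightarrow>
    (\<exists>p. p \<epsilon> s \<and> (\<exists>i q. p = opr i q \<and> (\<exists>k d. q = opr k d \<and> k = code \<phi> \<and> d = opr b c)))"

definition hasx :: "'a \<Rightarrow> fm \<Rightarrow> 'a \<Rightarrow> bool" where
  "hasx s \<phi> c \<longleftrightarrow> (\<exists>p. p \<epsilon> s \<and> (\<exists>i q. p = opr i q \<and> (\<exists>k d. q = opr k d \<and> k = code \<phi> \<and>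
    (\<exists>b a. d = opr b a \<and> a = c))))"

definition has0 :: "'a \<Rightarrow> fm \<Rightarrow> 'a \<Rightarrow> bool" where
  "has0 s \<phi> r \<longleftrightarrow> (\<exists>p. p \<epsilon> s \<and> (\<exists>i q. p = opr i q \<and> (\<exists>k d. q = opr k d \<and> k = code \<phi> \<and>
    (\<exists>b a. d = opr b a \<and> b = r \<and> a = emp))))"

definition has :: "'a \<Rightarrow> 'a \<Rightarrow> bool" where
  "has s c \<longleftrightarrow> (\<exists>i. opr i c \<epsilon> s)"

lemma has_simps:
  "has1 s \<phi> c \<longleftrightarrow> has s (opr (code \<phi>) c)"
  "has2 s \<phi> b c \<longleftrightarrow> has s (opr (code \<phi>) (opr b c))"
  "hasx s \<phi> c \<longleftrightarrow> (\<exists>b. has s (opr (code \<phi>) (opr b c)))"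
  "has0 s \<phi> r \<longleftrightarrow> has s (opr (code \<phi>) (opr r emp))"
  unfolding has1_def has2_def hasx_def has0_def has_def by blast+

lemma has_mono: "has s c \<Longrightarrow> (\<And>p. p \<epsilon> s \<Longrightarrow> p \<epsilon> t) \<Longrightarrow> has t c"
  unfolding has_def by blast

lemmas D0_rules = D0_emp D0_code D0_opr D0_ex_opr D0_all_opr D0_basic

lemma D0_has1: "D0 (\<lambda>e. has1 (e i) \<phi> (e j))"
  unfolding has1_def by (intro D0_rules)

lemma D0_has2: "D0 (\<lambda>e. has2 (e i) \<phi> (e j) (e k))"
  unfolding has2_def by (intro D0_rules)

lemma D0_hasx: "D0 (\<lambda>e. hasx (e i) \<phi> (e j))"
  unfolding hasx_def by (intro D0_rules)

lemma D0_has0: "D0 (\<lambda>e. has0 (e i) \<phi> (e j))"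
  unfolding has0_def by (intro D0_rules)

text \<open>
  Universal claims of \<open>u\<close> are instantiated not only to the heads of all assignments in \<open>u\<close>, but also to
  all \<open>i \<epsilon> n\<close>. This puts \<open>\<omega>\<close> into the model along a branch, so that its collapse fixes \<open>r \<subseteq> \<omega>\<close>.
\<close>

primrec handled :: "'a \<Rightarrow> 'a \<Rightarrow> 'a \<Rightarrow> fm \<Rightarrow> 'a \<Rightarrow> bool" where
  "handled n u v (Mem s t) c \<longleftrightarrow> Tr UNIV (Mem s t) c"
| "handled n u v (NMem s t) c \<longleftrightarrow> Tr UNIV (NMem s t) c"
| "handled n u v (Eq s t) c \<longleftrightarrow> Tr UNIV (Eq s t) c"
| "handled n u v (NEq s t) c \<longleftrightarrow> Tr UNIV (NEq s t) c"
| "handled n u v (And \<phi> \<psi>) c \<longleftrightarrow> has1 v \<phi> c \<and> has1 v \<psi> c"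
| "handled n u v (Or \<phi> \<psi>) c \<longleftrightarrow> has1 v \<phi> c \<or> has1 v \<psi> c"
| "handled n u v (All \<phi>) c \<longleftrightarrow> (\<forall>i. i \<epsilon> n \<longrightarrow> has2 v \<phi> i c) \<and>
    (\<forall>p. p \<epsilon> u \<longrightarrow> (\<forall>i q. p = opr i q \<longrightarrow> (\<forall>k d. q = opr k d \<longrightarrow> (\<forall>b a. d = opr b a \<longrightarrow>
      has2 v \<phi> b c))))"
| "handled n u v (Ex \<phi>) c \<longleftrightarrow> hasx v \<phi> c"

lemma D0_handled: "D0 (\<lambda>e. handled (e n) (e u) (e v) \<phi> (e c))"
  by (cases \<phi>) (simp_all only: handled.simps,
    (intro D0_Tr_atomic D0_has1 D0_has2 D0_hasx D0_rules)+)

text \<open>Apart from atomic truth, \<open>handled\<close> only asks for claims to be present in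
  \<open>v\<close>; this is what allows tasks to be treated one after another.\<close>

lemma handled_mono:
  "handled n u v \<phi> c \<Longrightarrow> (\<And>p. p \<epsilon> v \<Longrightarrow> p \<epsilon> w) \<Longrightarrow> handled n u w \<phi> c"
  by (cases \<phi>) (auto simp: has_simps intro: has_mono[of v])

end

section \<open>The tree of claims\<close>

text \<open>Steps that handle one task at a time are combined into one that handles \<open>n\<close> tasks.\<close>

lemma (in inductive_model) finite_iteration:
  assumes A: "DE (\<lambda>e. A (e 0) (\<lambda>i. e (Suc i)))"
    and H: "DE (\<lambda>e. H (e 0) (e 1) (\<lambda>i. e (Suc (Suc i))))"
    and mono: "\<And>j v w. H j v d \<Longrightarrow> (\<And>p. p \<epsilon> v \<Longrightarrow> p \<epsilon> w) \<Longrightarrow> H j w d"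
    and step: "\<And>j v. j \<epsilon> n \<Longrightarrow> A v d \<Longrightarrow> \<exists>w. A w d \<and> (\<forall>p. p \<epsilon> v \<longrightarrow> p \<epsilon> w) \<and> H j w d"
    and n: "n \<epsilon> om" and v0: "A v0 d"
  shows "\<exists>v. A v d \<and> (\<forall>p. p \<epsilon> v0 \<longrightarrow> p \<epsilon> v) \<and> (\<forall>j. j \<epsilon> n \<longrightarrow> H j v d)"
proof -
  \<comment> \<open>The statement is restricted to \<open>i\<close> included in \<open>n\<close>,
    since \<open>step\<close> is available only for elements of \<open>n\<close>. The environment
    carries \<open>n\<close>, \<open>v0\<close> and then \<open>d\<close>.\<close>
  let ?P = "\<lambda>i e. (\<forall>j. j \<epsilon> i \<longrightarrow> j \<epsilon> e 0) \<longrightarrow>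
    (\<exists>v. A v (\<lambda>i. e (Suc (Suc i))) \<and> (\<forall>p. p \<epsilon> e 1 \<longrightarrow> p \<epsilon> v) \<and>
      (\<forall>j. j \<epsilon> i \<longrightarrow> H j v (\<lambda>i. e (Suc (Suc i)))))"
  let ?e = "case_nat n (case_nat v0 d)"
  have "?P n ?e"
  proof (rule om_induct[of ?P])
    have "DE (\<lambda>e. A (e 0) (\<lambda>i. e (Suc (Suc (Suc (Suc i))))))"
      using DE_rename[OF A, of "case_nat 0 (\<lambda>i. Suc (Suc (Suc (Suc i))))"] by simp
    moreover have "DE (\<lambda>e. H (e 0) (e (Suc 0)) (\<lambda>i. e (Suc (Suc (Suc (Suc (Suc i)))))))"
      using DE_rename[OF H, of "case_nat 0 (case_nat 1 (\<lambda>i. Suc (Suc (Suc (Suc (Suc i))))))"] by simp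
    ultimately show "DE (\<lambda>e. ?P (e 0) (\<lambda>i. e (Suc i)))"
      by (intro DE_imp DE_ex DE_conj DE_all DE_D0[OF D0_mem]) auto
    show "?P emp ?e" using v0 by auto
    show "?P (ins k k) ?e" if IH: "?P k ?e" for k
    proof
      assume *: "\<forall>j. j \<epsilon> ins k k \<longrightarrow> j \<epsilon> ?e 0"
      then obtain v where v: "A v d" "\<forall>p. p \<epsilon> v0 \<longrightarrow> p \<epsilon> v" "\<forall>j. j \<epsilon> k \<longrightarrow> H j v d"
        using IH by auto
      have "k \<epsilon> n" using * by simp
      then obtain w where w: "A w d" "\<forall>p. p \<epsilon> v \<longrightarrow> p \<epsilon> w" "H k w d" using step v(1) by blast
      have "H j w d" if "j \<epsilon> ins k k" for j
        using that v(3) w(2,3) mono[of j v w] by auto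
      then show "\<exists>v. A v (\<lambda>i. ?e (Suc (Suc i))) \<and> (\<forall>p. p \<epsilon> ?e 1 \<longrightarrow> p \<epsilon> v) \<and>
          (\<forall>j. j \<epsilon> ins k k \<longrightarrow> H j v (\<lambda>i. ?e (Suc (Suc i))))"
        using w(1,2) v(2) by (intro exI[of _ w]) simp
    qed
  qed (fact n)
  then show ?thesis by simp
qed

locale claim_tree = inductive_model E F
  for E :: "'a \<Rightarrow> 'a \<Rightarrow> bool" (infix "\<epsilon>" 50) and F +
  fixes \<Psi> :: fm
begin

text \<open>
  Nodes \<open>opr n s\<close> consist of a natural number \<open>n\<close> and a partial function \<open>s\<close> from \<open>n\<close> to claims, which
  contains the root claim.
\<close>

definition node :: "'a \<Rightarrow> 'a \<Rightarrow> bool" where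
  "node r x \<longleftrightarrow> (\<exists>n s. x = opr n s \<and> isnat n \<and>
    (\<forall>p. p \<epsilon> s \<longrightarrow> (\<exists>i c. p = opr i c \<and> i \<epsilon> n)) \<and>
    (\<forall>p. p \<epsilon> s \<longrightarrow> (\<forall>q. q \<epsilon> s \<longrightarrow>
      (\<forall>i c. p = opr i c \<longrightarrow> (\<forall>j d. q = opr j d \<longrightarrow> i = j \<longrightarrow> c = d)))) \<and>
    has0 s \<Psi> r)"

lemma node_opr:
  "node r (opr n s) \<longleftrightarrow> n \<epsilon> om \<and> (\<forall>p. p \<epsilon> s \<longrightarrow> (\<exists>i c. p = opr i c \<and> i \<epsilon> n)) \<and>
    (\<forall>i c d. opr i c \<epsilon> s \<longrightarrow> opr i d \<epsilon> s \<longrightarrow> c = d) \<and> has s (opr (code \<Psi>) (opr r emp))"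
  unfolding node_def isnat_iff has_simps opr_inject by blast

lemma nodeE:
  assumes "node r x"
  obtains n s where "x = opr n s" "node r (opr n s)"
proof -
  obtain n s where "x = opr n s" using assms unfolding node_def by (elim exE conjE)
  then show ?thesis using that assms by blast
qed

text \<open>The condition \<open>n \<epsilon> m\<close> makes steps irreflexive and lets the bounds
  exhaust \<omega> along a branch. The quantifier over \<open>subs \<Psi>\<close> is a finite
  conjunction outside the model.\<close>

definition step :: "'a \<Rightarrow> 'a \<Rightarrow> bool" where
  "step y x \<longleftrightarrow> (\<exists>n u. x = opr n u \<and> (\<exists>m v. y = opr m v \<and> n \<epsilon> m \<and> (\<forall>p. p \<epsilon> u \<longrightarrow> p \<epsilon> v) \<and>
    (\<forall>p. p \<epsilon> u \<longrightarrow> (\<forall>i q. p = opr i q \<longrightarrow> (\<forall>k d. q = opr k d \<longrightarrow>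
      (\<forall>\<phi>\<in>subs \<Psi>. k = code \<phi> \<longrightarrow> handled n u v \<phi> d))))))"

lemma step_opr:
  "step (opr m v) (opr n u) \<longleftrightarrow> n \<epsilon> m \<and> (\<forall>p. p \<epsilon> u \<longrightarrow> p \<epsilon> v) \<and>
    (\<forall>\<phi>\<in>subs \<Psi>. \<forall>d. has u (opr (code \<phi>) d) \<longrightarrow> handled n u v \<phi> d)"
  unfolding step_def has_def opr_inject by blast

text \<open>A single step, made reflexive on nodes: \<open>Delta_Rel\<close> asks for the field
  condition and not for transitivity.\<close>

definition le :: "'a \<Rightarrow> 'a \<Rightarrow> 'a \<Rightarrow> bool" where
  "le y x r \<longleftrightarrow> node r y \<and> node r x \<and> (y = x \<or> step y x)"

lemma D0_le: "D0 (\<lambda>e. le (e i) (e j) (e k))"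
  unfolding le_def node_def step_def
  by (intro D0_isnat D0_has0 D0_handled D0_finite_ball finite_subs D0_rules)

section \<open>Construction of a true successor node\<close>

definition true_claim :: "'a \<Rightarrow> bool" where
  "true_claim q \<longleftrightarrow> (\<exists>\<phi>\<in>subs \<Psi>. \<exists>k. k = code \<phi> \<and> (\<exists>d. q = opr k d \<and> Tr UNIV \<phi> d))"

definition true_seq :: "'a \<Rightarrow> bool" where
  "true_seq v \<longleftrightarrow> (\<forall>i. \<forall>q. \<forall>p. p = opr i q \<longrightarrow> p \<epsilon> v \<longrightarrow> true_claim q)"

text \<open>The invariant while a successor of the node \<open>opr n u\<close> is built. The bound
  \<open>m\<close> is quantified away so that only \<open>v\<close> is iterated, and
  \<open>le z z r\<close> says by a bounded formula that \<open>z\<close> is a node.\<close>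

definition good :: "'a \<Rightarrow> 'a \<Rightarrow> 'a \<Rightarrow> 'a \<Rightarrow> bool" where
  "good r n u v \<longleftrightarrow> (\<exists>m. \<exists>z. z = opr m v \<and> le z z r \<and> true_seq v \<and> n \<epsilon> m \<and> (\<forall>p. p \<epsilon> u \<longrightarrow> p \<epsilon> v))"

lemma good_iff:
  "good r n u v \<longleftrightarrow> (\<exists>m. node r (opr m v) \<and> true_seq v \<and> n \<epsilon> m \<and> (\<forall>p. p \<epsilon> u \<longrightarrow> p \<epsilon> v))"
  by (simp add: good_def le_def)

lemma true_claimI: "\<phi> \<in> subs \<Psi> \<Longrightarrow> Tr UNIV \<phi> d \<Longrightarrow> true_claim (opr (code \<phi>) d)"
  unfolding true_claim_def by blast

lemmas DE_rules = DE_not DE_conj DE_disj DE_imp DE_ex DE_all DE_D0[OF D0_mem] DE_D0[OF D0_eq]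
  DE_D0[OF D0_opr] DE_D0[OF D0_code]

lemma DE_true_seq: "DE (\<lambda>e. true_seq (e i))"
  unfolding true_seq_def true_claim_def by (intro DE_finite_bex finite_subs DE_Tr DE_rules)

lemma DE_good: "DE (\<lambda>e. good (e i) (e j) (e k) (e l))"
  unfolding good_def by (intro DE_D0[OF D0_le] DE_true_seq DE_rules)

text \<open>The bound \<open>m\<close> is itself a free index, since all indices in use are elements
  of \<open>m\<close>; the new claim is put there and the bound moves on to the successor of
  \<open>m\<close>.\<close>

lemma extend:
  assumes "good r n u v" "true_claim c"
  shows "\<exists>w. good r n u w \<and> (\<forall>p. p \<epsilon> v \<longrightarrow> p \<epsilon> w) \<and> has w c"
proof -
  obtain m where m: "node r (opr m v)" "true_seq v" "n \<epsilon> m" "\<forall>p. p \<epsilon> u \<longrightarrow> p \<epsilon> v"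
    using assms(1) by (auto simp: good_iff)
  let ?w = "ins v (opr m c)" and ?m = "ins m m"
  have dom: "i \<epsilon> m" if "opr i q \<epsilon> v" for i q using m(1) that unfolding node_opr by fastforce
  have "node r (opr ?m ?w)"
    unfolding node_opr
  proof (intro conjI allI impI)
    show "?m \<epsilon> om" using m(1) succ_om by (simp add: node_opr)
    show "\<exists>i c. p = opr i c \<and> i \<epsilon> ?m" if "p \<epsilon> ?w" for p
      using that m(1) unfolding node_opr by auto
    show "a = b" if "opr i a \<epsilon> ?w" "opr i b \<epsilon> ?w" for i a b
      using that m(1) dom mem_irrefl[of m] unfolding node_opr by auto
    show "has ?w (opr (code \<Psi>) (opr r emp))"
      using m(1) has_mono[of v _ ?w] by (simp add: node_opr)
  qed
  moreover have "true_seq ?w" using m(2) assms(2) unfolding true_seq_def by auto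
  ultimately have "good r n u ?w" using m(3,4) unfolding good_iff by (intro exI[of _ ?m]) auto
  moreover have "has ?w c" unfolding has_def by auto
  ultimately show ?thesis by auto
qed

text \<open>Truth guides the choice of a disjunct or a witness. All instances of a true universal
  claim are true, and those that are due are indexed by elements of \<open>n\<close>, which calls
  for \<open>finite_iteration\<close>.\<close>

lemma handle:
  assumes x: "node r (opr n u)" and v: "good r n u v" and \<phi>: "\<phi> \<in> subs \<Psi>" "Tr UNIV \<phi> d"
  shows "\<exists>w. good r n u w \<and> (\<forall>p. p \<epsilon> v \<longrightarrow> p \<epsilon> w) \<and> handled n u w \<phi> d"
proof (cases \<phi>)
  case (And \<alpha> \<beta>)
  then have "true_claim (opr (code \<alpha>) d)" "true_claim (opr (code \<beta>) d)"
    using \<phi> subs_closed(1)[of \<alpha> \<beta> \<Psi>] true_claimI by auto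
  then obtain w w' where "good r n u w" "\<forall>p. p \<epsilon> v \<longrightarrow> p \<epsilon> w" "has w (opr (code \<alpha>) d)"
      "good r n u w'" "\<forall>p. p \<epsilon> w \<longrightarrow> p \<epsilon> w'" "has w' (opr (code \<beta>) d)"
    using extend[OF v] extend by metis
  then show ?thesis
    using And has_mono[of w "opr (code \<alpha>) d" w'] by (intro exI[of _ w']) (auto simp: has_simps)
next
  case (Or \<alpha> \<beta>)
  then have "true_claim (opr (code \<alpha>) d) \<or> true_claim (opr (code \<beta>) d)"
    using \<phi> subs_closed(2)[of \<alpha> \<beta> \<Psi>] true_claimI by auto
  then show ?thesis using extend[OF v] Or by (auto simp: has_simps)
next
  case (Ex \<alpha>)
  then obtain b where "true_claim (opr (code \<alpha>) (opr b d))"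
    using \<phi> subs_closed(4)[of \<alpha> \<Psi>] true_claimI by auto
  from extend[OF v this] show ?thesis unfolding Ex handled.simps has_simps by blast
next
  case (All \<alpha>)
  have claim: "true_claim (opr (code \<alpha>) (opr b d))" for b
    using \<phi> All subs_closed(3)[of \<alpha> \<Psi>] true_claimI by auto
  let ?A = "\<lambda>v e. good (e 0) (e 1) (e 2) v"
  \<comment> \<open>One index \<open>j\<close> accounts for two instances: at \<open>j\<close>
    itself, and at the head of the assignment in claim number \<open>j\<close> of \<open>u\<close>,
    if there is one. The environment lists \<open>r\<close>, \<open>n\<close>, \<open>u\<close>, and
    \<open>d\<close> from place 3 on.\<close>
  let ?H = "\<lambda>j v e. has2 v \<alpha> j (e 3) \<and> (\<forall>q. \<forall>p. p = opr j q \<longrightarrow> p \<epsilon> e 2 \<longrightarrow>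
    (\<forall>k. \<forall>d. q = opr k d \<longrightarrow> (\<forall>b. \<forall>a. d = opr b a \<longrightarrow> has2 v \<alpha> b (e 3))))"
  let ?e = "case_nat r (case_nat n (case_nat u (\<lambda>_. d)))"
  have "\<exists>w. ?A w ?e \<and> (\<forall>p. p \<epsilon> v \<longrightarrow> p \<epsilon> w) \<and> (\<forall>j. j \<epsilon> n \<longrightarrow> ?H j w ?e)"
  proof (rule finite_iteration[of ?A ?H])
    show "DE (\<lambda>e. ?A (e 0) (\<lambda>i. e (Suc i)))" by (intro DE_good)
    show "DE (\<lambda>e. ?H (e 0) (e 1) (\<lambda>i. e (Suc (Suc i))))"
      by (intro DE_D0[OF D0_has2] DE_rules)
    show "?H j w' ?e" if "?H j w ?e" "\<And>p. p \<epsilon> w \<Longrightarrow> p \<epsilon> w'" for j w w'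
      using that(1) has_mono[of w _ w', OF _ that(2)] unfolding has_simps by blast
    show "\<exists>w'. ?A w' ?e \<and> (\<forall>p. p \<epsilon> w \<longrightarrow> p \<epsilon> w') \<and> ?H j w' ?e" if "j \<epsilon> n" "?A w ?e" for j w
    proof -
      have "good r n u w" using that(2) by (simp add: numeral_2_eq_2)
      then obtain w1 where w1: "good r n u w1" "\<forall>p. p \<epsilon> w \<longrightarrow> p \<epsilon> w1"
          "has w1 (opr (code \<alpha>) (opr j d))"
        using extend[OF _ claim] by blast
      \<comment> \<open>Since \<open>u\<close> is a function, at most one head belongs to the index
        \<open>j\<close>, so one further claim is enough.\<close>
      obtain w2 where w2: "good r n u w2" "\<forall>p. p \<epsilon> w1 \<longrightarrow> p \<epsilon> w2"
          "\<forall>k b a. opr j (opr k (opr b a)) \<epsilon> u \<longrightarrow> has w2 (opr (code \<alpha>) (opr b d))"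
      proof (cases "\<exists>k b a. opr j (opr k (opr b a)) \<epsilon> u")
        case True
        then obtain k b a where kba: "opr j (opr k (opr b a)) \<epsilon> u" by blast
        obtain w2 where "good r n u w2" "\<forall>p. p \<epsilon> w1 \<longrightarrow> p \<epsilon> w2" "has w2 (opr (code \<alpha>) (opr b d))"
          using extend[OF w1(1) claim] by blast
        moreover have "k' = k \<and> b' = b \<and> a' = a" if "opr j (opr k' (opr b' a')) \<epsilon> u" for k' b' a'
          using x kba that unfolding node_opr by (metis opr_inject)
        ultimately show ?thesis using that by blast
      next
        case False
        then show ?thesis using that w1(1) by blast
      qed
      have "has w2 (opr (code \<alpha>) (opr j d))" using has_mono[OF w1(3)] w2(2) by blast
      then show ?thesis
        using w1(2) w2
        by (intro exI[of _ w2]) (simp add: has_simps numeral_2_eq_2 numeral_3_eq_3, blast)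
    qed
    show "n \<epsilon> om" using x by (simp add: node_opr)
    show "?A v ?e" using v by (simp add: numeral_2_eq_2)
  qed
  then obtain w where w: "good r n u w" "\<forall>p. p \<epsilon> v \<longrightarrow> p \<epsilon> w"
      and H: "\<forall>j. j \<epsilon> n \<longrightarrow> ?H j w ?e" by (auto simp: numeral_2_eq_2)
  have "has2 w \<alpha> j d" if "j \<epsilon> n" for j using H that by (simp add: numeral_3_eq_3)
  moreover have "has2 w \<alpha> b d" if "opr i (opr k (opr b a)) \<epsilon> u" for i k b a
  proof -
    have "i \<epsilon> n" using x that unfolding node_opr by fastforce
    with H that show ?thesis by (auto simp: numeral_2_eq_2 numeral_3_eq_3)
  qed
  ultimately have "handled n u w \<phi> d" unfolding All handled.simps by blast
  with w show ?thesis by blast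
qed (use v \<phi> in auto)

definition handled_at :: "'a \<Rightarrow> 'a \<Rightarrow> 'a \<Rightarrow> 'a \<Rightarrow> bool" where
  "handled_at n u j v \<longleftrightarrow> (\<forall>q. \<forall>p. p = opr j q \<longrightarrow> p \<epsilon> u \<longrightarrow>
    (\<forall>k. \<forall>d. q = opr k d \<longrightarrow> (\<forall>\<phi>\<in>subs \<Psi>. k = code \<phi> \<longrightarrow> handled n u v \<phi> d)))"

lemma handled_at_iff:
  "handled_at n u j v \<longleftrightarrow> (\<forall>\<phi>\<in>subs \<Psi>. \<forall>d. opr j (opr (code \<phi>) d) \<epsilon> u \<longrightarrow> handled n u v \<phi> d)"
  unfolding handled_at_def by blast

lemma DE_handled_at: "DE (\<lambda>e. handled_at (e n) (e u) (e j) (e v))"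
proof -
  have "D0 (\<lambda>e. \<forall>\<phi>\<in>subs \<Psi>. e k = code \<phi> \<longrightarrow> handled (e i) (e j) (e l) \<phi> (e d))" for k i j l d
    by (intro D0_finite_ball finite_subs D0_imp D0_code D0_handled)
  note ball = DE_D0[OF this]
  show ?thesis unfolding handled_at_def by (intro ball DE_rules)
qed

text \<open>A second iteration, now over the claims of \<open>u\<close>; what is already handled
  remains so by \<open>handled_mono\<close>, and an index without a claim poses no task.\<close>

lemma progress:
  assumes x: "node r (opr n u)" and u: "true_seq u"
  shows "\<exists>m v. node r (opr m v) \<and> true_seq v \<and> step (opr m v) (opr n u)"
proof -
  let ?A = "\<lambda>v e. good (e 0) (e 1) (e 2) v"
  let ?H = "\<lambda>j v e. handled_at (e 1) (e 2) j v"
  let ?e = "case_nat r (case_nat n (\<lambda>_. u))"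
  have "\<exists>w. ?A w ?e \<and> (\<forall>p. p \<epsilon> u \<longrightarrow> p \<epsilon> w) \<and> (\<forall>j. j \<epsilon> n \<longrightarrow> ?H j w ?e)"
  proof (rule finite_iteration[of ?A ?H])
    show "DE (\<lambda>e. ?A (e 0) (\<lambda>i. e (Suc i)))" by (intro DE_good)
    show "DE (\<lambda>e. ?H (e 0) (e 1) (\<lambda>i. e (Suc (Suc i))))" by (rule DE_handled_at)
    show "?H j w' ?e" if "?H j w ?e" "\<And>p. p \<epsilon> w \<Longrightarrow> p \<epsilon> w'" for j w w'
      using that(1) handled_mono[OF _ that(2)] unfolding handled_at_iff by blast
    show "\<exists>w'. ?A w' ?e \<and> (\<forall>p. p \<epsilon> w \<longrightarrow> p \<epsilon> w') \<and> ?H j w' ?e" if "j \<epsilon> n" "?A w ?e" for j w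
    proof (cases "\<exists>q. opr j q \<epsilon> u")
      case True
      then obtain q where q: "opr j q \<epsilon> u" by blast
      then have "true_claim q" using u unfolding true_seq_def by blast
      then obtain \<phi> d where \<phi>: "\<phi> \<in> subs \<Psi>" "q = opr (code \<phi>) d" "Tr UNIV \<phi> d"
        unfolding true_claim_def by blast
      have "good r n u w" using that(2) by (simp add: numeral_2_eq_2)
      from handle[OF x this \<phi>(1,3)]
      obtain w' where w': "good r n u w'" "\<forall>p. p \<epsilon> w \<longrightarrow> p \<epsilon> w'" "handled n u w' \<phi> d" by blast
      have "q' = q" if "opr j q' \<epsilon> u" for q' using x q that unfolding node_opr by blast
      then have "handled_at n u j w'"
        unfolding handled_at_iff using \<phi>(2) w'(3) by (metis opr_inject code_inject)
      then show ?thesis using w' by (intro exI[of _ w']) (simp add: numeral_2_eq_2)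
    next
      case False
      then have "handled_at n u j w" unfolding handled_at_iff by blast
      then show ?thesis using that(2) by (intro exI[of _ w]) (simp add: numeral_2_eq_2)
    qed
    show "n \<epsilon> om" using x by (simp add: node_opr)
    \<comment> \<open>The iteration starts from \<open>u\<close> itself under the successor of
      \<open>n\<close> as bound, because \<open>good\<close> asks for a bound above
      \<open>n\<close>.\<close>
    have "node r (opr (ins n n) u)" using x succ_om unfolding node_opr by (metis in_ins)
    then have "good r n u u" using u unfolding good_iff by (intro exI[of _ "ins n n"]) simp
    then show "?A u ?e" by (simp add: numeral_2_eq_2)
  qed
  then obtain w where w: "good r n u w" and H: "\<forall>j. j \<epsilon> n \<longrightarrow> handled_at n u j w"
    by (auto simp: numeral_2_eq_2)
  from w obtain m where m: "node r (opr m w)" "true_seq w" "n \<epsilon> m" "\<forall>p. p \<epsilon> u \<longrightarrow> p \<epsilon> w"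
    by (auto simp: good_iff)
  have "handled n u w \<phi> d" if \<phi>: "\<phi> \<in> subs \<Psi>" and u: "has u (opr (code \<phi>) d)" for \<phi> d
  proof -
    obtain i where i: "opr i (opr (code \<phi>) d) \<epsilon> u" using u by (auto simp: has_def)
    then have "i \<epsilon> n" using x unfolding node_opr by fastforce
    with H i \<phi> show ?thesis unfolding handled_at_iff by blast
  qed
  then have "step (opr m w) (opr n u)" using m(3,4) unfolding step_opr by blast
  with m show ?thesis by blast
qed

lemma step_irrefl: "\<not> step x x"
  using mem_irrefl unfolding step_def by fastforce

lemma not_well_founded:
  assumes r: "\<forall>x. x \<epsilon> r \<longrightarrow> x \<epsilon> om" and \<Psi>: "Tr UNIV \<Psi> (opr r emp)"
  shows "\<exists>w. w \<noteq> emp \<and> (\<forall>x. x \<epsilon> w \<longrightarrow> (\<exists>y. y \<epsilon> w \<and> le y x r \<and> y \<noteq> x))"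
proof (rule ccontr)
  assume "\<not> ?thesis"
  then have wf: "\<forall>w. w \<noteq> emp \<longrightarrow> (\<exists>x. x \<epsilon> w \<and> (\<forall>y. y \<epsilon> w \<longrightarrow> \<not> (le y x r \<and> y \<noteq> x)))" by blast
  let ?P = "\<lambda>x d. \<not> (\<exists>n. \<exists>u. x = opr n u \<and> true_seq u)"
  have "\<forall>x. le x x r \<longrightarrow> ?P x undefined"
  proof (rule class_induct[where L = le, OF D0_le r _ wf])
    show "\<forall>x y. le x y r \<longrightarrow> le x x r \<and> le y y r" by (auto simp: le_def)
    show "DE (\<lambda>e. ?P (e 0) (\<lambda>i. e (Suc i)))" by (intro DE_true_seq DE_rules)
    show "\<forall>x. le x x r \<longrightarrow> (\<forall>y. le y x r \<and> y \<noteq> x \<longrightarrow> ?P y undefined) \<longrightarrow> ?P x undefined"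
    proof (intro allI impI notI)
      fix x assume x: "le x x r" and IH: "\<forall>y. le y x r \<and> y \<noteq> x \<longrightarrow> ?P y undefined"
        and "\<exists>n u. x = opr n u \<and> true_seq u"
      then obtain n u where nu: "x = opr n u" "true_seq u" by blast
      then obtain m v where mv: "node r (opr m v)" "true_seq v" "step (opr m v) x"
        using progress[of r n u] x by (auto simp: le_def)
      then have "opr m v \<noteq> x" using step_irrefl by blast
      then show False using mv x IH by (auto simp: le_def)
    qed
  qed
  moreover
  let ?c = "opr (code \<Psi>) (opr r emp)"
  \<comment> \<open>The root node has bound 1 and carries its single claim at index 0.\<close>
  let ?u = "ins emp (opr emp ?c)"
  have "node r (opr one ?u)"
    unfolding node_opr has_def using succ_om[OF emp_om] by auto
  moreover have "true_seq ?u"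
    unfolding true_seq_def using true_claimI[OF subs_refl \<Psi>] by auto
  ultimately show False by (auto simp: le_def)
qed

end

context claim_tree
begin

subsection \<open>The model along a branch\<close>

text \<open>The growth that makes the nodes of a branch comparable. Being reflexive it covers equal
  nodes as well, and its universal form is bounded by \<open>D0_all_opr\<close>.\<close>

definition extends :: "'a \<Rightarrow> 'a \<Rightarrow> bool" where
  "extends x y \<longleftrightarrow> (\<forall>m u. x = opr m u \<longrightarrow> (\<forall>n v. y = opr n v \<longrightarrow>
    (\<forall>p. p \<epsilon> u \<longrightarrow> p \<epsilon> v) \<and> (\<forall>i. i \<epsilon> m \<longrightarrow> i \<epsilon> n)))"

lemma extends_opr:
  "extends (opr m u) (opr n v) \<longleftrightarrow> (\<forall>p. p \<epsilon> u \<longrightarrow> p \<epsilon> v) \<and> (\<forall>i. i \<epsilon> m \<longrightarrow> i \<epsilon> n)"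
  by (simp add: extends_def)

lemma D0_extends: "D0 (\<lambda>e. extends (e i) (e j))"
  unfolding extends_def by (intro D0_rules)

lemma extends_refl: "extends x x"
  by (simp add: extends_def)

lemma extends_step:
  assumes "node r y" "step y x" shows "extends x y"
proof -
  obtain m v where y: "y = opr m v" "node r (opr m v)" using assms(1) by (rule nodeE)
  obtain n u where x: "x = opr n u" using assms(2) unfolding step_def by blast
  then show ?thesis
    using assms(2) y nat_transitive[of m n] unfolding x y(1) step_opr extends_opr node_opr by blast
qed

lemma extends_trans:
  assumes "extends x y" "extends y z" "node r y" shows "extends x z"
proof -
  obtain n v where "y = opr n v" using assms(3) by (rule nodeE)
  then show ?thesis using assms(1,2) unfolding extends_def by blast
qed

text \<open>Dependent choice runs through the set \<open>w\<close>. Induction on indices shows that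
  nodes grow along \<open>f\<close>, so any two are comparable, and that bound number
  \<open>k\<close> exceeds \<open>k\<close>, so every natural number lies below some bound.\<close>

lemma branch:
  assumes w: "w \<noteq> emp" "\<And>x. x \<epsilon> w \<Longrightarrow> \<exists>y. y \<epsilon> w \<and> le y x r \<and> y \<noteq> x"
  obtains f where "\<exists>x. opr emp x \<epsilon> f" "\<And>n x. opr n x \<epsilon> f \<Longrightarrow> x \<epsilon> w"
    "\<And>n x. opr n x \<epsilon> f \<Longrightarrow> \<exists>m u. x = opr m u \<and> node r (opr m u)"
    "\<And>n x. opr n x \<epsilon> f \<Longrightarrow> \<exists>m y. opr m y \<epsilon> f \<and> step y x"
    "\<And>n m x y. opr n x \<epsilon> f \<Longrightarrow> opr m y \<epsilon> f \<Longrightarrow> extends x y \<or> extends y x"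
    "\<And>k. k \<epsilon> om \<Longrightarrow> \<exists>n m u. opr n (opr m u) \<epsilon> f \<and> k \<epsilon> m"
proof -
  let ?R = "\<lambda>x y e. le y x (e 0) \<and> \<not> y = x"
  obtain x0 where "x0 \<epsilon> w" using w(1) nonempty by blast
  have "D0 (\<lambda>e. ?R (e 0) (e 1) (\<lambda>i. e (Suc (Suc i))))" by (intro D0_le D0_basic)
  from dependent_choice[of ?R x0 w "\<lambda>_. r", OF this \<open>x0 \<epsilon> w\<close> w(2)]
  obtain f where f: "\<forall>n x. opr n x \<epsilon> f \<longrightarrow> n \<epsilon> om \<and> x \<epsilon> w"
    "\<forall>n. n \<epsilon> om \<longrightarrow> (\<exists>x. opr n x \<epsilon> f)"
    "\<forall>n x y. opr n x \<epsilon> f \<longrightarrow> opr n y \<epsilon> f \<longrightarrow> x = y"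
    "\<forall>n x y. opr n x \<epsilon> f \<longrightarrow> opr (ins n n) y \<epsilon> f \<longrightarrow> ?R x y (\<lambda>_. r)"
    by blast
  have succ: "\<exists>y. opr (ins n n) y \<epsilon> f" if "opr n x \<epsilon> f" for n x
    using f(1,2) succ_om that by blast
  have step: "node r x \<and> node r y \<and> step y x" if "opr n x \<epsilon> f" "opr (ins n n) y \<epsilon> f" for n x y
    using f(4) that unfolding le_def by blast
  have node: "node r x" if "opr n x \<epsilon> f" for n x using succ[OF that] step[OF that] by blast
  have mono: "extends x y" if "k \<epsilon> om" "j \<epsilon> k" "opr j x \<epsilon> f" "opr k y \<epsilon> f" for j k x y
  proof -
    let ?P = "\<lambda>k e. \<forall>j. j \<epsilon> k \<longrightarrow> (\<forall>x. \<forall>p. p = opr j x \<longrightarrow> p \<epsilon> e 0 \<longrightarrow>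
      (\<forall>y. \<forall>q. q = opr k y \<longrightarrow> q \<epsilon> e 0 \<longrightarrow> extends x y))"
    have "?P k (\<lambda>_. f)"
    proof (rule om_induct[of ?P])
      show "DE (\<lambda>e. ?P (e 0) (\<lambda>i. e (Suc i)))" by (intro DE_D0[OF D0_extends] DE_rules)
      show "?P (ins k k) (\<lambda>_. f)" if "k \<epsilon> om" and IH: "?P k (\<lambda>_. f)" for k
      proof (intro allI impI)
        fix j x p y q
        assume j: "j \<epsilon> ins k k" and "p = opr j x" "p \<epsilon> f" "q = opr (ins k k) y" "q \<epsilon> f"
        then have jx: "opr j x \<epsilon> f" and ky: "opr (ins k k) y \<epsilon> f" by auto
        obtain z where z: "opr k z \<epsilon> f" using f(2) \<open>k \<epsilon> om\<close> by blast
        have zy: "extends z y" using step[OF z ky] extends_step by blast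
        show "extends x y"
        proof (cases "j = k")
          case True
          then show ?thesis using zy f(3) jx z by blast
        next
          case False
          then have "j \<epsilon> k" using j by simp
          then have "extends x z" using IH jx z by blast
          then show ?thesis using zy node[OF z] extends_trans by blast
        qed
      qed
    qed (use that(1) in auto)
    then show ?thesis using that by blast
  qed
  have large: "k \<epsilon> m" if "k \<epsilon> om" "opr k (opr m u) \<epsilon> f" for k m u
  proof -
    let ?P = "\<lambda>k e. \<forall>m. \<forall>u. \<forall>x. x = opr m u \<longrightarrow> (\<forall>p. p = opr k x \<longrightarrow> p \<epsilon> e 0 \<longrightarrow> k \<epsilon> m)"
    have "?P k (\<lambda>_. f)"
    proof (rule om_induct[of ?P])
      show "DE (\<lambda>e. ?P (e 0) (\<lambda>i. e (Suc i)))" by (intro DE_rules)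
      show "?P emp (\<lambda>_. f)"
      proof (intro allI impI)
        fix m u x p assume "x = opr m u" "p = opr emp x" "p \<epsilon> f"
        then have "node r (opr m u)" using node by blast
        \<comment> \<open>The root claim sits at some index below \<open>m\<close>, so
          \<open>m\<close> is not 0.\<close>
        then have "m \<epsilon> om" "\<exists>i. i \<epsilon> m" unfolding node_opr has_def by blast+
        then show "emp \<epsilon> m" using nat_emp_or_mem[of m] by auto
      qed
      show "?P (ins k k) (\<lambda>_. f)" if "k \<epsilon> om" and IH: "?P k (\<lambda>_. f)" for k
      proof (intro allI impI)
        fix m u x p assume "x = opr m u" "p = opr (ins k k) x" "p \<epsilon> f"
        then have mu: "opr (ins k k) (opr m u) \<epsilon> f" by simp
        obtain z where z: "opr k z \<epsilon> f" using f(2) \<open>k \<epsilon> om\<close> by blast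
        obtain n v where nv: "z = opr n v" "node r (opr n v)" using node[OF z] by (rule nodeE)
        have "k \<epsilon> n" using IH z nv(1) by blast
        moreover have "n \<epsilon> m" using step[OF z mu] unfolding nv(1) step_opr by blast
        moreover have "n \<epsilon> om" "m \<epsilon> om" using nv(2) node[OF mu] unfolding node_opr by blast+
        ultimately show "ins k k \<epsilon> m" using nat_succ_le[of n k] nat_transitive[of m n] by blast
      qed
    qed (use that(1) in auto)
    then show ?thesis using that by blast
  qed
  show ?thesis
  proof (rule that[of f])
    show "\<exists>x. opr emp x \<epsilon> f" using f(2) emp_om by blast
    show "x \<epsilon> w" if "opr n x \<epsilon> f" for n x using f(1) that by blast
    show "\<exists>m u. x = opr m u \<and> node r (opr m u)" if "opr n x \<epsilon> f" for n x
      using node[OF that] by (rule nodeE) blast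
    show "\<exists>m y. opr m y \<epsilon> f \<and> step y x" if "opr n x \<epsilon> f" for n x
      using succ[OF that] step[OF that] by blast
    show "extends x y \<or> extends y x" if "opr n x \<epsilon> f" "opr m y \<epsilon> f" for n m x y
    proof -
      have om: "n \<epsilon> om" "m \<epsilon> om" using f(1) that by blast+
      then consider "n \<epsilon> m" | "n = m" | "m \<epsilon> n" using nat_linear by blast
      then show ?thesis
      proof cases
        case 1 then show ?thesis using mono om that by blast
      next
        case 2 then have "x = y" using f(3) that by blast
        then show ?thesis using extends_refl by blast
      next
        case 3 then show ?thesis using mono om that by blast
      qed
    qed
    show "\<exists>n m u. opr n (opr m u) \<epsilon> f \<and> k \<epsilon> m" if "k \<epsilon> om" for k
    proof -
      obtain x where x: "opr k x \<epsilon> f" using f(2) \<open>k \<epsilon> om\<close> by blast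
      obtain m u where "x = opr m u" using node[OF x] by (rule nodeE)
      then show ?thesis using large[OF that] x by blast
    qed
  qed
qed

section \<open>Unions and the domain of a branch\<close>

definition un :: "'a \<Rightarrow> 'a" where
  "un a = coll (\<lambda>v. \<exists>u. u \<epsilon> a \<and> v \<epsilon> u)"

lemma in_un: "v \<epsilon> un a \<longleftrightarrow> (\<exists>u. u \<epsilon> a \<and> v \<epsilon> u)"
  unfolding un_def
  using in_coll[OF PRF_Union(2)[OF PRF_var[of 0], of "\<lambda>u e. u" "\<lambda>_. a"]] PRF_var[of 0] by simp

lemma opr_in_un: "opr a b \<epsilon> s \<Longrightarrow> a \<epsilon> un (un s) \<and> b \<epsilon> un (un s)"
proof -
  assume "opr a b \<epsilon> s"
  moreover have "upr a b \<epsilon> opr a b" "a \<epsilon> upr a b" "b \<epsilon> upr a b" by (simp_all add: opr_def)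
  ultimately show ?thesis unfolding in_un by blast
qed

text \<open>The domain consists of \<omega> and the heads of the assignments on the branch. Every
  claim on the branch holds in it by induction on the formula, as in the truth lemma for Hintikka
  sets.\<close>

lemma branch_model:
  assumes w: "w \<noteq> emp" "\<And>x. x \<epsilon> w \<Longrightarrow> \<exists>y. y \<epsilon> w \<and> le y x r \<and> y \<noteq> x"
  shows "\<exists>M. (\<forall>n. n \<epsilon> om \<longrightarrow> n \<epsilon> M) \<and> r \<epsilon> M \<and> Tr {x. x \<epsilon> M} \<Psi> (opr r emp)"
proof -
  obtain f where f: "\<exists>x. opr emp x \<epsilon> f" "\<And>n x. opr n x \<epsilon> f \<Longrightarrow> x \<epsilon> w"
    "\<And>n x. opr n x \<epsilon> f \<Longrightarrow> \<exists>m u. x = opr m u \<and> node r (opr m u)"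
    "\<And>n x. opr n x \<epsilon> f \<Longrightarrow> \<exists>m y. opr m y \<epsilon> f \<and> step y x"
    "\<And>n m x y. opr n x \<epsilon> f \<Longrightarrow> opr m y \<epsilon> f \<Longrightarrow> extends x y \<or> extends y x"
    "\<And>k. k \<epsilon> om \<Longrightarrow> \<exists>n m u. opr n (opr m u) \<epsilon> f \<and> k \<epsilon> m"
    using branch[OF w] by blast
  define B where "B m u \<longleftrightarrow> (\<exists>n. opr n (opr m u) \<epsilon> f)" for m u
  define U where "U = {b. b \<epsilon> om \<or> (\<exists>m u i k a. B m u \<and> opr i (opr k (opr b a)) \<epsilon> u)}"
  have "is_set (\<lambda>b. b \<in> U)"
  proof -
    let ?P = "\<lambda>b e. b \<epsilon> e 0 \<or> (\<exists>p. p \<epsilon> e 1 \<and> (\<exists>n x. p = opr n x \<and> (\<exists>m u. x = opr m u \<and>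
      (\<exists>q. q \<epsilon> u \<and> (\<exists>i c. q = opr i c \<and> (\<exists>k d. c = opr k d \<and> (\<exists>b' a. d = opr b' a \<and> b' = b)))))))"
    let ?e = "case_nat om (\<lambda>_. f)"
    \<comment> \<open>An explicit bounding set for separation. Two unions lead from \<open>w\<close>
      to the sequences, one to their entries, and two for each of the three nested pairs down to
      \<open>b\<close>; the outer union adds \<open>om\<close>.\<close>
    let ?T = "un (upr om (un (un (un (un (un (un (un (un (un w))))))))))"
    have P: "?P b ?e \<longleftrightarrow> b \<in> U" for b by (simp add: U_def B_def) blast
    have "b \<epsilon> ?T" if bU: "b \<in> U" for b
    proof (cases "b \<epsilon> om")
      case True
      then show ?thesis unfolding in_un[of b "upr _ _"] by auto
    next
      case False
      then obtain m u i k a n where *: "opr n (opr m u) \<epsilon> f" "opr i (opr k (opr b a)) \<epsilon> u"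
        using bU unfolding U_def B_def by blast
      have "u \<epsilon> un (un w)" using opr_in_un[OF f(2)[OF *(1)]] ..
      then have "opr i (opr k (opr b a)) \<epsilon> un (un (un w))" using *(2) in_un by blast
      from opr_in_un[OF this] have "opr k (opr b a) \<epsilon> un (un (un (un (un w))))" ..
      from opr_in_un[OF this] have "opr b a \<epsilon> un (un (un (un (un (un (un w))))))" ..
      from opr_in_un[OF this] have "b \<epsilon> un (un (un (un (un (un (un (un (un w))))))))" ..
      then show ?thesis unfolding in_un[of b "upr _ _"] by auto
    qed
    moreover have "PRP (\<lambda>e. ?P (e 0) (\<lambda>i. e (Suc i)))" by (rule D0_PRP) (intro D0_rules)
    then have "is_set (\<lambda>b. b \<epsilon> ?T \<and> ?P b ?e)" by (rule separation[of ?P])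
    ultimately show ?thesis unfolding P is_set_def by blast
  qed
  then obtain M where M: "\<And>b. b \<epsilon> M \<longleftrightarrow> b \<in> U" unfolding is_set_def by blast
  have next_stage: "\<exists>m v. B m v \<and> step (opr m v) (opr n u)" if Bnu: "B n u" for n u
  proof -
    obtain k where "opr k (opr n u) \<epsilon> f" using Bnu unfolding B_def by blast
    then obtain l y where y: "opr l y \<epsilon> f" "step y (opr n u)" using f(4) by blast
    then obtain m v where "y = opr m v" using f(3) by blast
    then show ?thesis using y unfolding B_def by blast
  qed
  have claim: "Tr U \<phi> c" if "\<phi> \<in> subs \<Psi>" "B n u" "has u (opr (code \<phi>) c)" for \<phi> n u c
    using that
  proof (induction \<phi> arbitrary: n u c)
    case (And \<phi> \<psi>)
    obtain m v where v: "B m v" "step (opr m v) (opr n u)" using next_stage And.prems by blast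
    then have "handled n u v (And \<phi> \<psi>) c" using And.prems unfolding step_opr by blast
    then show ?case using And.IH v(1) subs_closed(1)[OF And.prems(1)] by (auto simp: has_simps)
  next
    case (Or \<phi> \<psi>)
    obtain m v where v: "B m v" "step (opr m v) (opr n u)" using next_stage Or.prems by blast
    then have "handled n u v (Or \<phi> \<psi>) c" using Or.prems unfolding step_opr by blast
    then show ?case using Or.IH v(1) subs_closed(2)[OF Or.prems(1)] by (auto simp: has_simps)
  next
    case (Ex \<phi>)
    obtain m v where v: "B m v" "step (opr m v) (opr n u)" using next_stage Ex.prems by blast
    then have "handled n u v (Ex \<phi>) c" using Ex.prems unfolding step_opr by blast
    then obtain b where b: "has v (opr (code \<phi>) (opr b c))" by (auto simp: has_simps)
    then have "b \<in> U" using v(1) unfolding U_def has_def by blast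
    then show ?case using Ex.IH[OF _ v(1) b] subs_closed(4)[OF Ex.prems(1)] by auto
  next
    case (All \<phi>)
    have "Tr U \<phi> (opr b c)" if b: "b \<in> U" for b
    proof -
      \<comment> \<open>Of the node with the universal claim and a node that mentions
        \<open>b\<close>, the larger one has both, and its successor contains the instance at
        \<open>b\<close>. A natural number counts as mentioned once the bound exceeds it.\<close>
      obtain n' u' where u': "B n' u'" "b \<epsilon> n' \<or> (\<exists>i k a. opr i (opr k (opr b a)) \<epsilon> u')"
        using b f(6) unfolding U_def B_def by blast
      have "extends (opr n u) (opr n' u') \<or> extends (opr n' u') (opr n u)"
        using f(5) u'(1) All.prems(2) unfolding B_def by blast
      then obtain n2 u2 where u2: "B n2 u2" "has u2 (opr (code (All \<phi>)) c)"
          "b \<epsilon> n2 \<or> (\<exists>i k a. opr i (opr k (opr b a)) \<epsilon> u2)"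
        using u' All.prems(2,3) has_mono[of u _ u'] unfolding extends_opr by blast
      obtain m v where v: "B m v" "step (opr m v) (opr n2 u2)" using next_stage u2(1) by blast
      then have "handled n2 u2 v (All \<phi>) c" using All.prems(1) u2(2) unfolding step_opr by blast
      then have "has v (opr (code \<phi>) (opr b c))"
        using u2(3) unfolding handled.simps has_simps by blast
      then show ?thesis using All.IH v(1) subs_closed(3)[OF All.prems(1)] by blast
    qed
    then show ?case by simp
  next
    case (Mem s t)
    \<comment> \<open>A step exists only if the atomic claims are true in the universe, and atomic
      truth is the same in every domain.\<close>
    obtain m v where v: "B m v" "step (opr m v) (opr n u)" using next_stage Mem.prems by blast
    then have "handled n u v (Mem s t) c" using Mem.prems unfolding step_opr by blast
    then show ?case by simp
  next
    case (NMem s t)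
    obtain m v where v: "B m v" "step (opr m v) (opr n u)" using next_stage NMem.prems by blast
    then have "handled n u v (NMem s t) c" using NMem.prems unfolding step_opr by blast
    then show ?case by simp
  next
    case (Eq s t)
    obtain m v where v: "B m v" "step (opr m v) (opr n u)" using next_stage Eq.prems by blast
    then have "handled n u v (Eq s t) c" using Eq.prems unfolding step_opr by blast
    then show ?case by simp
  next
    case (NEq s t)
    obtain m v where v: "B m v" "step (opr m v) (opr n u)" using next_stage NEq.prems by blast
    then have "handled n u v (NEq s t) c" using NEq.prems unfolding step_opr by blast
    then show ?case by simp
  qed
  obtain m u where u: "B m u" "has u (opr (code \<Psi>) (opr r emp))"
  proof -
    obtain x where x: "opr emp x \<epsilon> f" using f(1) by blast
    then obtain m u where "x = opr m u" "node r (opr m u)" using f(3) by blast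
    then show ?thesis using that x unfolding B_def node_opr by blast
  qed
  have U: "{x. x \<epsilon> M} = U" using M by blast
  show ?thesis
  proof (intro exI[of _ M] conjI)
    show "\<forall>n. n \<epsilon> om \<longrightarrow> n \<epsilon> M" unfolding M U_def by blast
    show "r \<epsilon> M" using u unfolding M U_def has_def by blast
    show "Tr {x. x \<epsilon> M} \<Psi> (opr r emp)" unfolding U by (rule claim[OF subs_refl u])
  qed
qed

end


section \<open>Collapse\<close>

lemma sat_isomorphic:
  assumes "set_fm \<phi>" "\<And>i. e i \<in> U"
    and "\<And>x y. x \<in> U \<Longrightarrow> y \<in> U \<Longrightarrow> E (c x) (c y) \<longleftrightarrow> E x y" "inj_on c U"
  shows "sat E F (c ` U) (\<lambda>i. c (e i)) \<phi> \<longleftrightarrow> sat E F U e \<phi>"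
  using assms(1,2)
proof (induction \<phi> arbitrary: e)
  case (Mem s t)
  then show ?case using assms(3) by (cases s; cases t) auto
next
  case (NMem s t)
  then show ?case using assms(3) by (cases s; cases t) auto
next
  case (Eq s t)
  then show ?case using inj_on_eq_iff[OF assms(4)] by (cases s; cases t) auto
next
  case (NEq s t)
  then show ?case using inj_on_eq_iff[OF assms(4)] by (cases s; cases t) auto
next
  case (All \<phi>)
  have "sat E F (c ` U) (case_nat (c x) (\<lambda>i. c (e i))) \<phi> \<longleftrightarrow> sat E F U (case_nat x e) \<phi>"
    if "x \<in> U" for x
  proof -
    have "(\<lambda>i. c (case_nat x e i)) = case_nat (c x) (\<lambda>i. c (e i))"
      by (rule ext) (simp split: nat.split)
    moreover have "case_nat x e i \<in> U" for i using that All.prems(2) by (cases i) auto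
    ultimately show ?thesis using All.IH[of "case_nat x e"] All.prems(1) by simp
  qed
  then show ?case by simp
next
  case (Ex \<phi>)
  have "sat E F (c ` U) (case_nat (c x) (\<lambda>i. c (e i))) \<phi> \<longleftrightarrow> sat E F U (case_nat x e) \<phi>"
    if "x \<in> U" for x
  proof -
    have "(\<lambda>i. c (case_nat x e i)) = case_nat (c x) (\<lambda>i. c (e i))"
      by (rule ext) (simp split: nat.split)
    moreover have "case_nat x e i \<in> U" for i using that Ex.prems(2) by (cases i) auto
    ultimately show ?thesis using Ex.IH[of "case_nat x e"] Ex.prems(1) by simp
  qed
  then show ?case by simp
qed auto

text \<open>\<open>Rec\<close> forms the union of the earlier values and not the set of them. The
  recursion therefore computes \<open>p z M\<close>, the singleton of \<open>c z M\<close> for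
  \<open>z \<epsilon> M\<close> and \<open>emp\<close> otherwise; the union of these over
  \<open>u \<epsilon> z\<close> is \<open>c z M\<close>.\<close>

lemma (in prs_model) collapsing_function:
  "\<exists>c. PRF (\<lambda>e. c (e 0) (e 1)) \<and> (\<forall>M z v. v \<epsilon> c z M \<longleftrightarrow> (\<exists>u. u \<epsilon> z \<and> u \<epsilon> M \<and> v = c u M))"
proof -
  have "PRP (\<lambda>e. e 1 \<epsilon> e 2)" by (intro PRP_mem PRF_var)
  then have "PRF (\<lambda>e. if e 1 \<epsilon> e 2 then ins emp (e 0) else emp)"
    by (intro PRF_If PRF_ins PRF_emp PRF_var)
  then obtain k where k: "\<forall>n\<ge>k. \<exists>q. wf_psf q \<and> arity q = n \<and>
      (\<forall>e. F q (map e [0..<n]) = (if e 1 \<epsilon> e 2 then ins emp (e 0) else emp))"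
    unfolding PRF_def by blast
  define n where "n = max k 2"
  have n: "2 \<le> n" by (simp add: n_def)
  obtain q where q: "wf_psf q" "arity q = Suc n"
      "\<And>e. F q (map e [0..<Suc n]) = (if e 1 \<epsilon> e 2 then ins emp (e 0) else emp)"
    using k[rule_format, of "Suc n"] le_SucI[OF max.cobounded1[of k 2], folded n_def] by blast
  define p where "p z M = F (Rec q) (map (case_nat z (\<lambda>_. M)) [0..<n])" for z M
  have Cons: "map (case_nat w e) [0..<Suc k] = w # map e [0..<k]" for w k and e :: "nat \<Rightarrow> 'a"
    by (rule nth_equalityI) (auto simp del: upt_Suc simp: nth_Cons split: nat.split)
  have p: "\<exists>W. (\<forall>v. v \<epsilon> W \<longleftrightarrow> (\<exists>u. u \<epsilon> z \<and> v \<epsilon> p u M)) \<and> p z M = (if z \<epsilon> M then ins emp W else emp)"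
    for z M
  proof -
    let ?e = "case_nat z (\<lambda>_. M)"
    have tail: "u # map ?e [1..<n] = map (case_nat u (\<lambda>_. M)) [0..<n]" for u
      by (rule nth_equalityI) (use n in \<open>auto simp: nth_Cons split: nat.split\<close>)
    obtain W where W: "\<forall>v. v \<epsilon> W \<longleftrightarrow> (\<exists>u. u \<epsilon> ?e 0 \<and> v \<epsilon> F (Rec q) (u # map ?e [1..<n]))"
        "F (Rec q) (map ?e [0..<n]) = F q (W # map ?e [0..<n])"
      using rec[OF q(1,2), of ?e] n by auto
    have "F q (W # map ?e [0..<n]) = (if z \<epsilon> M then ins emp W else emp)"
      using q(3)[of "case_nat W ?e"] unfolding Cons by (simp add: numeral_2_eq_2)
    then show ?thesis using W unfolding tail p_def by auto
  qed
  have PRF_p: "PRF (\<lambda>e. p (e i) (e j))" for i j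
  proof -
    have "PRF (\<lambda>e. case_nat (e i) (\<lambda>_. e j) l)" for l by (cases l) (auto simp: PRF_var)
    then have "PRF (\<lambda>e. F (Rec q) (map (\<lambda>h. h e) (map (\<lambda>l e. case_nat (e i) (\<lambda>_. e j) l) [0..<n])))"
      by (intro PRF_fun) (use q n in auto)
    then show ?thesis by (simp add: p_def o_def)
  qed
  let ?h = "\<lambda>u e. p u (e 1)"
  define c where "c z M = coll (\<lambda>v. \<exists>u. u \<epsilon> z \<and> v \<epsilon> p u M)" for z M
  have h: "PRF (\<lambda>e. ?h (e 0) (\<lambda>i. e (Suc i)))" by (rule PRF_p)
  have "PRF (\<lambda>e. c (e 0) (e 1))"
    unfolding c_def using PRF_Union(1)[of "\<lambda>e. e 0" ?h, OF PRF_var h] .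
  moreover have c: "v \<epsilon> c z M \<longleftrightarrow> (\<exists>u. u \<epsilon> z \<and> v \<epsilon> p u M)" for v z M
    unfolding c_def
    using in_coll[OF PRF_Union(2)[of "\<lambda>e. e 0" ?h, OF PRF_var h, of "case_nat z (\<lambda>_. M)"]] by simp
  moreover have "v \<epsilon> p u M \<longleftrightarrow> u \<epsilon> M \<and> v = c u M" for u v M
  proof -
    obtain W where W: "\<forall>v. v \<epsilon> W \<longleftrightarrow> (\<exists>x. x \<epsilon> u \<and> v \<epsilon> p x M)" "p u M = (if u \<epsilon> M then ins emp W else emp)"
      using p[of u M] by blast
    then have "W = c u M" using c by (intro ext) blast
    then show ?thesis using W(2) by auto
  qed
  ultimately show ?thesis by (intro exI[of _ c]) auto
qed

definition extensional_fm :: fm where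
  "extensional_fm = All (All (Or (Eq (Var 1) (Var 0))
    (Or (Ex (And (Mem (Var 0) (Var 2)) (NMem (Var 0) (Var 1))))
        (Ex (And (NMem (Var 0) (Var 2)) (Mem (Var 0) (Var 1)))))))"

lemma sat_extensional_fm:
  "sat E F U e extensional_fm \<longleftrightarrow> (\<forall>x\<in>U. \<forall>y\<in>U. (\<forall>z\<in>U. E z x \<longleftrightarrow> E z y) \<longrightarrow> x = y)"
  by (simp add: extensional_fm_def numeral_2_eq_2) blast

text \<open>Mostowski collapse. As \<open>c\<close> is primitive recursive, \<open>minimal\<close>
  supplies least counterexamples to injectivity and to fixing \<omega>. A set whose elements are
  fixed and lie in \<open>M\<close> is itself fixed, which passes from \<omega> to
  \<open>r\<close>.\<close>

lemma (in inductive_model) collapse: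
  assumes ext: "\<And>x y. x \<epsilon> M \<Longrightarrow> y \<epsilon> M \<Longrightarrow> (\<And>z. z \<epsilon> M \<Longrightarrow> z \<epsilon> x \<longleftrightarrow> z \<epsilon> y) \<Longrightarrow> x = y"
    and om: "\<And>n. n \<epsilon> om \<Longrightarrow> n \<epsilon> M"
    and r: "\<And>x. x \<epsilon> r \<Longrightarrow> x \<epsilon> om" "r \<epsilon> M"
    and \<psi>: "set_fm \<psi>" "sat E F {x. x \<epsilon> M} (\<lambda>_. r) \<psi>"
  shows "\<exists>N. (\<forall>y. y \<epsilon> N \<longrightarrow> (\<forall>x. x \<epsilon> y \<longrightarrow> x \<epsilon> N)) \<and> sat E F {x. x \<epsilon> N} (\<lambda>_. r) \<psi>"
proof -
  obtain c where PRF_c: "PRF (\<lambda>e. c (e 0) (e 1))"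
    and c': "\<forall>M z v. v \<epsilon> c z M \<longleftrightarrow> (\<exists>u. u \<epsilon> z \<and> u \<epsilon> M \<and> v = c u M)"
    using collapsing_function by blast
  have c: "v \<epsilon> c z M \<longleftrightarrow> (\<exists>u. u \<epsilon> z \<and> u \<epsilon> M \<and> v = c u M)" for z v using c' by blast
  have PRF_c': "PRF (\<lambda>e. c (e i) (e j))" for i j
  proof -
    have "PRF (\<lambda>e. if l = 0 then e i else e j)" for l :: nat
      by (cases "l = 0") (simp_all add: PRF_var)
    from PRF_subst[OF PRF_c, of "\<lambda>l e. if l = 0 then e i else e j", OF this] show ?thesis by simp
  qed
  have inj: "x = y" if "x \<epsilon> M" "y \<epsilon> M" "c x M = c y M" for x y
  proof (rule ccontr)
    assume "x \<noteq> y"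
    let ?P = "\<lambda>x e. \<exists>y. y \<epsilon> e 0 \<and> (c x (e 0) = c y (e 0) \<and> \<not> x = y)"
    have "PRP (\<lambda>e. ?P (e 0) (\<lambda>i. e (Suc i)))"
      by (intro PRP_bex PRP_conj PRP_not PRP_eq PRF_c' PRF_var)
    from minimal[of ?P, OF this \<open>x \<epsilon> M\<close>, of "\<lambda>_. M"] that \<open>x \<noteq> y\<close>
    obtain a where a: "a \<epsilon> M" "\<exists>b. b \<epsilon> M \<and> c a M = c b M \<and> a \<noteq> b"
      and least: "\<forall>z. z \<epsilon> M \<longrightarrow> (\<exists>b. b \<epsilon> M \<and> c z M = c b M \<and> z \<noteq> b) \<longrightarrow> \<not> z \<epsilon> a" by auto
    then obtain b where b: "b \<epsilon> M" "c a M = c b M" "a \<noteq> b" by blast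
    have "z \<epsilon> a \<longleftrightarrow> z \<epsilon> b" if "z \<epsilon> M" for z
    proof
      assume z: "z \<epsilon> a"
      then have "c z M \<epsilon> c b M" using c[of "c z M" a] b(2) \<open>z \<epsilon> M\<close> by auto
      then obtain u where "u \<epsilon> b" "u \<epsilon> M" "c z M = c u M" using c by blast
      then show "z \<epsilon> b" using least z \<open>z \<epsilon> M\<close> by blast
    next
      assume z: "z \<epsilon> b"
      then have "c z M \<epsilon> c a M" using c[of "c z M" b] b(2) \<open>z \<epsilon> M\<close> by auto
      then obtain u where u: "u \<epsilon> a" "u \<epsilon> M" "c z M = c u M" using c by blast
      \<comment> \<open>Only \<open>a\<close> is minimal, so the collision of \<open>u\<close> and
        \<open>z\<close> is ruled out at \<open>u \<epsilon> a\<close> rather than at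
        \<open>z \<epsilon> b\<close>.\<close>
      then have "u = z" using least \<open>z \<epsilon> M\<close> by metis
      then show "z \<epsilon> a" using u(1) by simp
    qed
    then show False using ext[of a b] a(1) b by blast
  qed
  have mem: "c x M \<epsilon> c y M \<longleftrightarrow> x \<epsilon> y" if "x \<epsilon> M" "y \<epsilon> M" for x y
    using c[of "c x M" y] inj that by blast
  have fixed: "c z M = z" if "\<And>v. v \<epsilon> z \<Longrightarrow> c v M = v \<and> v \<epsilon> M" for z
  proof (rule prs_model.ext[OF prs_model_axioms])
    show "v \<epsilon> c z M \<longleftrightarrow> v \<epsilon> z" for v
      unfolding c[of v z] using that by auto
  qed
  have nat: "c n M = n" if "n \<epsilon> om" for n
  proof (rule ccontr)
    assume "c n M \<noteq> n"
    let ?P = "\<lambda>n e. \<not> c n (e 0) = n"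
    have "PRP (\<lambda>e. ?P (e 0) (\<lambda>i. e (Suc i)))" by (intro PRP_not PRP_eq PRF_c' PRF_var)
    from minimal[of ?P, OF this \<open>n \<epsilon> om\<close>, of "\<lambda>_. M"] \<open>c n M \<noteq> n\<close>
    obtain k where k: "k \<epsilon> om" "c k M \<noteq> k" "\<forall>z. z \<epsilon> om \<longrightarrow> c z M \<noteq> z \<longrightarrow> \<not> z \<epsilon> k" by auto
    have "c k M = k"
    proof (rule fixed)
      show "c v M = v \<and> v \<epsilon> M" if "v \<epsilon> k" for v
        using that k(3) om om_transitive[OF k(1) that] by blast
    qed
    then show False using k(2) by blast
  qed
  have r_fixed: "c r M = r"
    by (rule fixed) (use nat om r(1) in blast)
  obtain N where N: "\<And>v. v \<epsilon> N \<longleftrightarrow> (\<exists>u. u \<epsilon> M \<and> v = c u M)"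
    using PRF_image(2)[of "\<lambda>e. e 0" "\<lambda>u e. c u (e 0)", OF PRF_var PRF_c', of "\<lambda>_. M"]
    unfolding is_set_def by blast
  have "{x. x \<epsilon> N} = (\<lambda>x. c x M) ` {x. x \<epsilon> M}" using N by auto
  then have "sat E F {x. x \<epsilon> N} (\<lambda>_. c r M) \<psi>"
    using sat_isomorphic[of \<psi> "\<lambda>_. r" "{x. x \<epsilon> M}" E "\<lambda>x. c x M" F] \<psi> r(2) mem inj
    by (simp add: inj_on_def)
  moreover have "x \<epsilon> N" if y: "y \<epsilon> N" and x: "x \<epsilon> y" for x y
  proof -
    obtain u where "y = c u M" using y N by blast
    then have "\<exists>u. u \<epsilon> M \<and> x = c u M" using x c[of x u] by blast
    then show ?thesis using N by blast
  qed
  ultimately show ?thesis unfolding r_fixed by blast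
qed

theorem (in inductive_model) reflection:
  assumes \<psi>: "set_fm \<psi>" "fv \<psi> \<subseteq> {0}"
  shows "sat E F UNIV e (reflection \<psi>)"
  unfolding sat_reflection[OF \<psi>(2)]
proof (intro allI impI)
  fix r assume r: "\<forall>x. x \<epsilon> r \<longrightarrow> x \<epsilon> om" and sat: "sat E F UNIV (\<lambda>_. r) \<psi>"
  let ?\<Psi> = "And \<psi> extensional_fm"
  interpret claim_tree E F ?\<Psi> ..
  have "set_fm ?\<Psi>" using \<psi>(1) by (simp add: extensional_fm_def)
  moreover have cl: "cl (length [r]) ?\<Psi>"
    using \<psi>(2) by (auto simp: extensional_fm_def cl_def[of _ \<psi>])
  ultimately have Tr: "Tr U ?\<Psi> (opr r emp) \<longleftrightarrow> sat E F U (\<lambda>_. r) ?\<Psi>" for U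
  proof -
    have "sat E F U (\<lambda>i. [r] ! i) ?\<Psi> \<longleftrightarrow> sat E F U (\<lambda>_. r) ?\<Psi>"
      by (rule sat_cong) (use cl in \<open>auto simp: cl_def\<close>)
    then show ?thesis using Tr_lst[OF \<open>set_fm ?\<Psi>\<close> cl, of U] by simp
  qed
  have "sat E F UNIV (\<lambda>_. r) extensional_fm"
    unfolding sat_extensional_fm using prs_model.ext[OF prs_model_axioms] by blast
  then have "Tr UNIV ?\<Psi> (opr r emp)" unfolding Tr using sat by simp
  from not_well_founded[OF r this] obtain w where
    w: "w \<noteq> emp" "\<And>x. x \<epsilon> w \<Longrightarrow> \<exists>y. y \<epsilon> w \<and> le y x r \<and> y \<noteq> x" by blast
  from branch_model[OF this] obtain M where
    M: "\<forall>n. n \<epsilon> om \<longrightarrow> n \<epsilon> M" "r \<epsilon> M" "sat E F {x. x \<epsilon> M} (\<lambda>_. r) ?\<Psi>"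
    unfolding Tr by blast
  show "\<exists>N. (\<forall>y. y \<epsilon> N \<longrightarrow> (\<forall>x. x \<epsilon> y \<longrightarrow> x \<epsilon> N)) \<and> sat E F {x. x \<epsilon> N} (\<lambda>_. r) \<psi>"
  proof (rule collapse[of M])
    have "\<forall>x\<in>{x. x \<epsilon> M}. \<forall>y\<in>{x. x \<epsilon> M}. (\<forall>z\<in>{x. x \<epsilon> M}. z \<epsilon> x \<longleftrightarrow> z \<epsilon> y) \<longrightarrow> x = y"
      using M(3) unfolding sat.simps sat_extensional_fm by blast
    then show "x = y" if "x \<epsilon> M" "y \<epsilon> M" "\<And>z. z \<epsilon> M \<Longrightarrow> z \<epsilon> x \<longleftrightarrow> z \<epsilon> y" for x y
      using that by blast
  qed (use M r \<psi> in auto)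
qed


section \<open>The equivalence\<close>

lemma PRS_DC_completeness:
  assumes T: "\<forall>\<phi>\<in>T. wf_fm \<phi> \<and> cl 0 \<phi>" and \<chi>: "wf_fm \<chi>"
    and valid: "\<And>(E :: nat \<Rightarrow> nat \<Rightarrow> bool) F e.
      (\<And>\<phi> e. \<phi> \<in> PRS_DC \<union> T \<Longrightarrow> sat E F UNIV e \<phi>) \<Longrightarrow> sat E F UNIV e \<chi>"
  shows "PRS_DC \<union> T \<turnstile> \<chi>"
proof (rule completeness[OF _ _ _ _ \<chi> valid])
  show "regularity \<in> PRS_DC \<union> T" "defining_axiom Zero \<in> PRS_DC \<union> T" "defining_axiom Adj \<in> PRS_DC \<union> T"
    by (auto simp: PRS_DC_def PRS_def intro: exI[of _ Zero] exI[of _ Adj])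
  show "\<forall>\<phi>\<in>PRS_DC \<union> T. wf_fm \<phi> \<and> fv \<phi> = {}"
    unfolding fv_empty_iff using T sentence_PRS_DC by blast
qed

theorem theorem3p5:
  shows "(\<forall>\<chi>\<in>Class_Induction. PRS_DC \<union> Reflection \<turnstile> \<chi>) \<and>
         (\<forall>\<chi>\<in>Reflection. PRS_DC \<union> Class_Induction \<turnstile> \<chi>)"
proof (intro conjI ballI)
  fix \<chi> assume \<chi>: "\<chi> \<in> Class_Induction"
  show "PRS_DC \<union> Reflection \<turnstile> \<chi>"
  proof (rule PRS_DC_completeness)
    fix E :: "nat \<Rightarrow> nat \<Rightarrow> bool" and F e
    assume "\<And>\<phi> e. \<phi> \<in> PRS_DC \<union> Reflection \<Longrightarrow> sat E F UNIV e \<phi>"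
    then interpret reflecting_model E F by unfold_locales (auto simp: PRS_DC_def)
    show "sat E F UNIV e \<chi>" using \<chi> class_induction unfolding Class_Induction_def by blast
  qed (use \<chi> sentence_Class_Induction sentence_Reflection in auto)
next
  fix \<chi> assume \<chi>: "\<chi> \<in> Reflection"
  show "PRS_DC \<union> Class_Induction \<turnstile> \<chi>"
  proof (rule PRS_DC_completeness)
    fix E :: "nat \<Rightarrow> nat \<Rightarrow> bool" and F e
    assume "\<And>\<phi> e. \<phi> \<in> PRS_DC \<union> Class_Induction \<Longrightarrow> sat E F UNIV e \<phi>"
    then interpret inductive_model E F by unfold_locales (auto simp: PRS_DC_def)
    show "sat E F UNIV e \<chi>" using \<chi> reflection unfolding Reflection_def by blast
  qed (use \<chi> sentence_Class_Induction sentence_Reflection in auto)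
qed

end
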